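(* There exists an algorithm that, given a $k$-shortest graph $G$ on $n$ vertices (with its $k$ partitions), a set of $l$ pairs of vertices $(s_1,t_1),\dots,(s_l,t_l)$ of $G$ and a function $c:[l]\to[k]$, decides in time $n^{O(l^{5^k})}$ whether the $k$-DSP problem defined by $G$, the pairs $(s_i,t_i)$ and $c$ has a solution.
   Context: Graphs are finite, simple and undirected; $[k]=\{1,\dots,k\}$. A graph $G$ is a $k$-shortest graph if there exist $k$ partitions $(V^i_1,\dots,V^i_{l_i})$, $i\in[k]$, of $V(G)$ such that (1) for every edge $xy$ of $G$ there are $i\in[k]$ and $j\in[l_i-1]$ such that one endpoint is in $V^i_j$ and the other in $V^i_{j+1}$; (2) if $x\in V^i_j$ and $y\in V^i_r$ for some $i\in[k]$ with $|j-r|>1$, then $xy\notin E(G)$. A $k$-shortest graph is always considered together with such partitions. An edge with one endpoint in $V^i_j$ and the other in $V^i_{j+1}$ is said to be of colour $i$ (an edge may have several colours). Write $x\le_i y$ if $x\in V^i_j$, $y\in V^i_r$ with $j\le r$. A path $x_1,\dots,x_r$ is a path of colour $i$ if for every $j\in[r-1]$, $x_jx_{j+1}$ is an edge of colour $i$ and $x_j\le_i x_{j+1}$. It is oriented from $x_1$ to $x_r$; a path of colour $i$ between $x$ and $y$ is one whose endpoints are $x$ and $y$ (in either orientation). Given a $k$-shortest graph $G$, pairs $(s_1,t_1),\dots,(s_l,t_l)$ and $c:[l]\to[k]$, the $k$-DSP problem they define is to find pairwise internally vertex-disjoint paths $P_1,\dots,P_l$ such that for every $i\in[l]$, $P_i$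 is a path of colour $c(i)$ between $s_i$ and $t_i$. Two paths are internally vertex-disjoint if no internal vertex of one is a vertex of the other (they may share endpoints). Here $k$ is regarded as fixed, and the constant hidden in $O(\cdot)$ may depend on $k$. *)

theory Defs
  imports
    "HOL-Library.Disjoint_Sets"
    "HOL-Library.Landau_Symbols"
    "Graph_Theory.Graph_Theory"
begin

section \<open>k-shortest graphs\<close>

text \<open>
  Finite simple undirected graphs are those of the locale \<open>pair_graph\<close>: finite symmetric loopfree
  digraphs whose arcs are pairs, so that an edge \<open>xy\<close> appears as \<open>(x, y)\<close> and as \<open>(y, x)\<close>.

  A family of \<open>k\<close> ordered partitions is a list \<open>Vs\<close> of lists of parts. Indices start from 0, so
  colours are the numbers \<open>i < k\<close> and \<open>Vs ! i ! j\<close> is the set written \<open>V\<close> with superscript \<open>i + 1\<close>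
  and subscript \<open>j + 1\<close> in 1-based notation.
\<close>

definition col_edge :: "'a pair_pre_digraph \<Rightarrow> 'a set list list \<Rightarrow> nat \<Rightarrow> 'a \<Rightarrow> 'a \<Rightarrow> bool" where
  "col_edge G Vs i x y \<longleftrightarrow> (x, y) \<in> parcs G \<and>
     (\<exists>j. Suc j < length (Vs ! i) \<and>
        (x \<in> Vs ! i ! j \<and> y \<in> Vs ! i ! Suc j \<or> y \<in> Vs ! i ! j \<and> x \<in> Vs ! i ! Suc j))"

definition le_col :: "'a set list list \<Rightarrow> nat \<Rightarrow> 'a \<Rightarrow> 'a \<Rightarrow> bool" where
  "le_col Vs i x y \<longleftrightarrow>
     (\<exists>j r. j \<le> r \<and> r < length (Vs ! i) \<and> x \<in> Vs ! i ! j \<and> y \<in> Vs ! i ! r)"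

definition k_shortest_graph :: "nat \<Rightarrow> 'a pair_pre_digraph \<Rightarrow> 'a set list list \<Rightarrow> bool" where
  "k_shortest_graph k G Vs \<longleftrightarrow>
     pair_graph G \<and>
     length Vs = k \<and>
     (\<forall>i<k. distinct (Vs ! i) \<and> partition_on (pverts G) (set (Vs ! i))) \<and>
     (\<forall>(x, y) \<in> parcs G. \<exists>i<k. col_edge G Vs i x y) \<and>
     (\<forall>i<k. \<forall>j<length (Vs ! i). \<forall>r<length (Vs ! i). \<forall>x \<in> Vs ! i ! j. \<forall>y \<in> Vs ! i ! r.
        \<bar>int j - int r\<bar> > 1 \<longrightarrow> (x, y) \<notin> parcs G)"

section \<open>The k-DSP problem\<close>

definition col_path :: "'a pair_pre_digraph \<Rightarrow> 'a set list list \<Rightarrow> nat \<Rightarrow> 'a list \<Rightarrow> bool" where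
  "col_path G Vs i xs \<longleftrightarrow> vpath xs (with_proj G) \<and>
     (\<forall>j. Suc j < length xs \<longrightarrow>
        col_edge G Vs i (xs ! j) (xs ! Suc j) \<and> le_col Vs i (xs ! j) (xs ! Suc j))"

definition col_path_between ::
  "'a pair_pre_digraph \<Rightarrow> 'a set list list \<Rightarrow> nat \<Rightarrow> 'a \<Rightarrow> 'a \<Rightarrow> 'a list \<Rightarrow> bool" where
  "col_path_between G Vs i x y xs \<longleftrightarrow> col_path G Vs i xs \<and>
     (hd xs = x \<and> last xs = y \<or> hd xs = y \<and> last xs = x)"

definition internal_verts :: "'a list \<Rightarrow> 'a set" where
  "internal_verts xs = set (butlast (tl xs))"

definition internally_disjoint :: "'a list \<Rightarrow> 'a list \<Rightarrow> bool" where
  "internally_disjoint xs ys \<longleftrightarrow>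
     internal_verts xs \<inter> set ys = {} \<and> internal_verts ys \<inter> set xs = {}"

definition kdsp_instance ::
  "nat \<Rightarrow> 'a pair_pre_digraph \<Rightarrow> 'a set list list \<Rightarrow> ('a \<times> 'a) list \<Rightarrow> (nat \<Rightarrow> nat) \<Rightarrow> bool" where
  "kdsp_instance k G Vs sts c \<longleftrightarrow>
     k_shortest_graph k G Vs \<and>
     set sts \<subseteq> pverts G \<times> pverts G \<and>
     (\<forall>i<length sts. c i < k)"

definition kdsp_solvable ::
  "'a pair_pre_digraph \<Rightarrow> 'a set list list \<Rightarrow> ('a \<times> 'a) list \<Rightarrow> (nat \<Rightarrow> nat) \<Rightarrow> bool" where
  "kdsp_solvable G Vs sts c \<longleftrightarrow>
     (\<exists>P. (\<forall>i<length sts. col_path_between G Vs (c i) (fst (sts ! i)) (snd (sts ! i)) (P i)) \<and>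
          (\<forall>i<length sts. \<forall>j<length sts. i \<noteq> j \<longrightarrow> internally_disjoint (P i) (P j)))"

section \<open>Algorithms and their running time\<close>

text \<open>
  Algorithms are programs of a random access machine with structured control flow. The memory
  consists of finitely many named arrays (those occurring in the program) of natural numbers with
  unbounded index range; a scalar variable is an array of which only cell 0 is used. Every array
  access, arithmetic operation, assignment and test costs one step. There is deliberately no
  multiplication: with addition and (truncated) subtraction only, the numbers occurring within
  \<open>t\<close> steps have \<open>O(t)\<close> more bits than those of the input, so unit-cost time agrees with
  Turing machine time up to a polynomial, whereas unit-cost multiplication would be too powerful.
\<close>

type_synonym memory = "string \<Rightarrow> nat \<Rightarrow> nat"

datatype exp =
    Const nat
  | Read string exp
  | Plus exp exp
  | Minus exp exp

datatype com =
    Skip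
  | Write string exp exp
  | Seq com com
  | If exp com com
  | While exp com

primrec exp_val :: "exp \<Rightarrow> memory \<Rightarrow> nat" where
  "exp_val (Const m) M = m"
| "exp_val (Read a e) M = M a (exp_val e M)"
| "exp_val (Plus e1 e2) M = exp_val e1 M + exp_val e2 M"
| "exp_val (Minus e1 e2) M = exp_val e1 M - exp_val e2 M"

primrec exp_time :: "exp \<Rightarrow> nat" where
  "exp_time (Const m) = 1"
| "exp_time (Read a e) = exp_time e + 1"
| "exp_time (Plus e1 e2) = exp_time e1 + exp_time e2 + 1"
| "exp_time (Minus e1 e2) = exp_time e1 + exp_time e2 + 1"

text \<open>
  \<open>exec p M t M'\<close>: started with memory \<open>M\<close>, the program \<open>p\<close> halts after exactly \<open>t\<close> steps with
  memory \<open>M'\<close>. A test succeeds iff its value is nonzero. Programs are deterministic, as is proved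
  below.
\<close>

inductive exec :: "com \<Rightarrow> memory \<Rightarrow> nat \<Rightarrow> memory \<Rightarrow> bool" where
  Skip: "exec Skip M 1 M"
| Write: "exec (Write a e1 e2) M (exp_time e1 + exp_time e2 + 1)
            (M(a := (M a)(exp_val e1 M := exp_val e2 M)))"
| Seq: "exec p M t M' \<Longrightarrow> exec q M' u M'' \<Longrightarrow> exec (Seq p q) M (t + u) M''"
| IfTrue: "exp_val e M \<noteq> 0 \<Longrightarrow> exec p M t M' \<Longrightarrow> exec (If e p q) M (exp_time e + t + 1) M'"
| IfFalse: "exp_val e M = 0 \<Longrightarrow> exec q M t M' \<Longrightarrow> exec (If e p q) M (exp_time e + t + 1) M'"
| WhileFalse: "exp_val e M = 0 \<Longrightarrow> exec (While e p) M (exp_time e + 1) M"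
| WhileTrue: "exp_val e M \<noteq> 0 \<Longrightarrow> exec p M t M' \<Longrightarrow> exec (While e p) M' u M'' \<Longrightarrow>
            exec (While e p) M (exp_time e + t + u + 1) M''"

inductive_cases SkipE: "exec Skip M t M'"
  and WriteE: "exec (Write a e1 e2) M t M'"
  and SeqE: "exec (Seq p q) M t M'"
  and IfE: "exec (If e p q) M t M'"
  and WhileE: "exec (While e p) M t M'"

lemma exec_deterministic:
  "exec p M t M' \<Longrightarrow> exec p M u M'' \<Longrightarrow> t = u \<and> M' = M''"
proof (induction arbitrary: u M'' rule: exec.induct)
  case (Skip M)
  then show ?case by (rule SkipE) simp
next
  case (Write a e1 e2 M)
  then show ?case by (rule WriteE) simp
next
  case (Seq p M t M' q v N)
  from Seq.prems obtain t' v' M1 where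
    "exec p M t' M1" "exec q M1 v' M''" "u = t' + v'"
    by (rule SeqE)
  then show ?case using Seq.IH by metis
next
  case (IfTrue e M p t M' q)
  from IfTrue.prems IfTrue.hyps obtain t' where "exec p M t' M''" "u = exp_time e + t' + 1"
    by (auto elim: IfE)
  then show ?case using IfTrue.IH by metis
next
  case (IfFalse e M q t M' p)
  from IfFalse.prems IfFalse.hyps obtain t' where "exec q M t' M''" "u = exp_time e + t' + 1"
    by (auto elim: IfE)
  then show ?case using IfFalse.IH by metis
next
  case (WhileFalse e M p)
  from WhileFalse.prems show ?case by (rule WhileE) (use WhileFalse.hyps in simp_all)
next
  case (WhileTrue e M p t M' v N)
  from WhileTrue.prems obtain t' v' M1 where
    "exec p M t' M1" "exec (While e p) M1 v' M''" "u = exp_time e + t' + v' + 1"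
    by (rule WhileE) (use WhileTrue.hyps in simp_all)
  then show ?case using WhileTrue.IH by metis
qed

text \<open>
  For the purpose of encoding an instance, the \<open>n\<close> vertices are numbered, i.e. \<open>pverts G = {..<n}\<close>.
  The input consists of \<open>n\<close>, \<open>l\<close>, the adjacency matrix (row by row), for each of the \<open>k\<close> partitions
  and each vertex the index of the part containing it (again row by row), the pairs and the colours.
  The parts of a partition are nonempty, so this determines the partitions.
  All other memory cells are initially 0.
\<close>

definition part_index :: "'a set list \<Rightarrow> 'a \<Rightarrow> nat" where
  "part_index Ps v = (THE j. j < length Ps \<and> v \<in> Ps ! j)"

definition input_memory ::
  "nat pair_pre_digraph \<Rightarrow> nat set list list \<Rightarrow> (nat \<times> nat) list \<Rightarrow> (nat \<Rightarrow> nat) \<Rightarrow> memory" where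
  "input_memory G Vs sts c =
     (let n = card (pverts G); l = length sts in
      (\<lambda>a m. 0)
        (''n'' := (\<lambda>m. if m = 0 then n else 0),
         ''l'' := (\<lambda>m. if m = 0 then l else 0),
         ''adj'' := (\<lambda>m. if m < n * n \<and> (m div n, m mod n) \<in> parcs G then 1 else 0),
         ''part'' := (\<lambda>m. if m < length Vs * n then part_index (Vs ! (m div n)) (m mod n) else 0),
         ''s'' := (\<lambda>m. if m < l then fst (sts ! m) else 0),
         ''t'' := (\<lambda>m. if m < l then snd (sts ! m) else 0),
         ''c'' := (\<lambda>m. if m < l then c m else 0)))"

text \<open>The answer is read off cell 0 of the array \<open>out\<close>: 1 for yes, 0 for no.\<close>

definition kdsp_decides_within :: "nat \<Rightarrow> com \<Rightarrow> (nat \<Rightarrow> nat \<Rightarrow> real) \<Rightarrow> bool" where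
  "kdsp_decides_within k p T \<longleftrightarrow>
     (\<forall>n G Vs sts c. pverts G = {..<n} \<and> kdsp_instance k G Vs sts c \<longrightarrow>
        (\<exists>t M. exec p (input_memory G Vs sts c) t M \<and>
               real t \<le> T n (length sts) \<and>
               M ''out'' 0 = (if kdsp_solvable G Vs sts c then 1 else 0)))"

end

theory Submission
  imports Defs
begin

text \<open>
  Parametrise a path of colour \<open>i\<close> by its level in partition \<open>i\<close>. Along it the level in any other
  partition is 1-Lipschitz. Hence, if a path of colour \<open>a\<close> and one of colour \<open>b \<noteq> a\<close> meet in two
  points of the plane spanned by the levels \<open>a\<close> and \<open>b\<close>, then all levels are affine in between, so
  that both subpaths have both colours, and the points of coincidence form one subpath of each.
  Cutting all paths at the ends of these subpaths and adding colours to the resulting blocks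
  stabilises after \<open>k - 1\<close> rounds, each of which squares the number of blocks: any two blocks then
  carry the same set of colours, or they do not meet at all in some plane spanned by a colour of the
  one and a colour of the other. In the latter case, a last round of cuts encloses them in disjoint
  rectangles with diagonal sides. The decisive point is that a block stays in its rectangle if it is
  replaced by any other path of the same colour between the same ends.

  An instance is therefore solvable iff one can guess the ends of the pieces and one colour (label)
  for each piece such that pieces with different labels have disjoint rectangles, and such that the
  pieces with the same label can be routed disjointly. The latter is decided by dynamic programming:
  all pieces labelled \<open>a\<close> are routed synchronously along the levels of partition \<open>a\<close>, and two of
  them can only meet at the same time. The number of pieces is \<open>O(l ^ (2 ^ k + 1))\<close>, which bounds the
  exponent of the number of configurations.
\<close>

section \<open>Monotone curves in the plane\<close>

text \<open>The rigidity behind every round: in the plane of colours \<open>a\<close> and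
  \<open>b\<close>, the first path is the graph of a 1-Lipschitz function over one axis and the
  second over the other. If they meet twice, with coordinate differences \<open>u\<close> and
  \<open>v\<close>, then \<open>\<bar>v\<bar> \<le> \<bar>u\<bar>\<close> and
  \<open>\<bar>u\<bar> \<le> \<bar>v\<bar>\<close>, so both run along a diagonal in between. The
  obstacle is that a certificate fixes only ends and labels. Routes are found anew and need not
  follow the original paths, so disjointness for different labels has to follow from the ends alone.
  This is why disjoint curves do not suffice and rectangles are needed. For equal labels, both
  routes have unit speed in the level of the label, which thus acts as a common clock. A block is
  cut for each choice of its number, another path, a block of that path and two colours. This gives
  the recursion from \<open>\<kappa>\<close> to \<open>5 * k * k * l * \<kappa>\<^sup>2\<close>.
  Started at 1, it reaches the exponent \<open>2 ^ k - 1\<close> of \<open>5 * k * k * l\<close>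
  after \<open>k - 1\<close> rounds and the last round of cuts. One more factor \<open>l\<close>
  counts the paths, and \<open>2 ^ k + 1 \<le> 5 ^ k\<close> for positive \<open>k\<close>. The
  machine cannot multiply or divide, so products, remainders and digits are tabulated.\<close>

definition curve :: "(int \<Rightarrow> int \<Rightarrow> bool) \<Rightarrow> bool" where
  "curve C \<longleftrightarrow> (\<forall>x y x' y'. C x y \<longrightarrow> C x' y' \<longrightarrow> \<bar>y - y'\<bar> \<le> \<bar>x - x'\<bar>) \<and>
     (\<forall>x y x' y' z. C x y \<longrightarrow> C x' y' \<longrightarrow> x \<le> z \<longrightarrow> z \<le> x' \<longrightarrow> (\<exists>w. C z w))"

lemma curve_lip: "curve C \<Longrightarrow> C x y \<Longrightarrow> C x' y' \<Longrightarrow> \<bar>y - y'\<bar> \<le> \<bar>x - x'\<bar>"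
  unfolding curve_def by blast

lemma curve_between: "curve C \<Longrightarrow> C x y \<Longrightarrow> C x' y' \<Longrightarrow> x \<le> z \<Longrightarrow> z \<le> x' \<Longrightarrow> \<exists>w. C z w"
  unfolding curve_def by blast

text \<open>
  In the coordinates \<open>x + y\<close> and \<open>x - y\<close>, \<open>C\<close> increases in both, whereas \<open>D\<close> increases in the first and
  decreases in the second. The point \<open>(x1, y1)\<close> witnesses that \<open>(x0, y0)\<close> lies before \<open>D\<close>, and \<open>(x3, y3)\<close>
  that \<open>(x2, y2)\<close> lies before \<open>C\<close>.
\<close>

lemma before_before_aux:
  assumes C: "curve C" and D: "curve (\<lambda>y x. D x y)"
    and disj: "\<And>x y. C x y \<Longrightarrow> \<not> D x y"
    and 0: "C x0 y0" and 1: "D x1 y1" "\<bar>y0 - y1\<bar> \<le> x1 - x0"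
    and 2: "D x2 y2" and 3: "C x3 y3" "\<bar>x2 - x3\<bar> \<le> y3 - y2"
    and le: "y2 \<le> y1"
  shows "x0 - y0 < x2 - y2"
proof (rule ccontr)
  assume neg: "\<not> ?thesis"
  have d12: "\<bar>x1 - x2\<bar> \<le> y1 - y2" using curve_lip[OF D 1(1) 2] le by linarith
  \<comment> \<open>The negated claim closes a cycle of inequalities, so all three points lie on one
    diagonal. A curve joining two points of a diagonal follows it, and this produces a common point
    of \<open>C\<close> and \<open>D\<close>.\<close>
  have eq1: "x1 - y1 = x2 - y2" and eq0: "x0 - y0 = x2 - y2" using neg d12 1(2) by linarith+
  show False
  proof (cases "y2 \<le> y0")
    case True
    have "y0 \<le> y1" using eq0 eq1 1(2) by linarith
    then obtain w where w: "D w y0" using curve_between[OF D 2 1(1) True] by blast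
    have "w = x0"
      using curve_lip[OF D w 2] curve_lip[OF D w 1(1)] eq0 eq1 True \<open>y0 \<le> y1\<close> by linarith
    then show False using w 0 disj by blast
  next
    case False
    then have gt: "x2 > x0" using eq0 by linarith
    have c03: "\<bar>y0 - y3\<bar> \<le> \<bar>x0 - x3\<bar>" using curve_lip[OF C 0 3(1)] .
    show False
    proof (cases "x0 \<le> x3")
      case True
      have e: "y3 - x3 = y2 - x2" using c03 True 3(2) eq0 by linarith
      have "x2 \<le> x3" using e 3(2) by linarith
      then obtain w where w: "C x2 w" using curve_between[OF C 0 3(1), of x2] gt by auto
      have "w = y2"
        using curve_lip[OF C w 0] curve_lip[OF C w 3(1)] e eq0 gt \<open>x2 \<le> x3\<close> by linarith
      then show False using w 2 disj by blast
    next
      case F: False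
      then show False using c03 3(2) gt False by linarith
    qed
  qed
qed

text \<open>\<open>D\<close> is a graph over the second axis; with relations instead of functions,
  exchanging the axes costs nothing. If \<open>y2 \<le> y1\<close> the auxiliary lemma applies
  directly, and if \<open>x0 \<le> x3\<close> it applies with the axes and the roles of
  \<open>C\<close> and \<open>D\<close> exchanged. Otherwise the Lipschitz and cone inequalities
  form a cycle that puts all four points on one antidiagonal.\<close>

lemma before_before:
  assumes C: "curve C" and D: "curve (\<lambda>y x. D x y)"
    and disj: "\<And>x y. C x y \<Longrightarrow> \<not> D x y"
    and 0: "C x0 y0" and 1: "D x1 y1" "\<bar>y0 - y1\<bar> \<le> x1 - x0"
    and 2: "D x2 y2" and 3: "C x3 y3" "\<bar>x2 - x3\<bar> \<le> y3 - y2"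
  shows "x0 - y0 < x2 - y2"
proof (cases "y2 \<le> y1")
  case True
  then show ?thesis using before_before_aux[OF C D disj 0 1 2 3] by blast
next
  case F1: False
  show ?thesis
  proof (cases "x0 \<le> x3")
    case True
    have "y2 - x2 < y0 - x0"
      by (rule before_before_aux[where C = "\<lambda>y x. D x y" and D = "\<lambda>y x. C x y",
            OF D _ _ 2 3 0 1 True]) (use C disj in blast)+
    then show ?thesis by linarith
  next
    case F2: False
    show ?thesis
    proof (rule ccontr)
      assume neg: "\<not> ?thesis"
      have d: "\<bar>x2 - x1\<bar> \<le> y2 - y1" using curve_lip[OF D 2 1(1)] F1 by linarith
      have c: "\<bar>y0 - y3\<bar> \<le> x0 - x3" using curve_lip[OF C 0 3(1)] F2 by linarith
      have e: "x0 + y0 = x2 + y2" "x3 + y3 = x2 + y2" using d c 1(2) 3(2) by linarith+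
      have b: "x3 \<le> x2" "x2 \<le> x0" using e neg 3(2) by linarith+
      then obtain w where w: "C x2 w" using curve_between[OF C 3(1) 0] by blast
      have "w = y2" using curve_lip[OF C w 0] curve_lip[OF C w 3(1)] e b by linarith
      then show False using w 2 disj by blast
    qed
  qed
qed

lemma curve_reflect_x: "curve C \<Longrightarrow> curve (\<lambda>x y. C (- x) y)"
  unfolding curve_def
proof (intro conjI allI impI, goal_cases)
  case (1 x y x' y') then show ?case by (smt (verit))
next
  case (2 x y x' y' z)
  then have "C (-x') y'" "C (-x) y" "-x' \<le> -z" "-z \<le> -x" by auto
  then show ?case using 2 by blast
qed

lemma curve_reflect_y: "curve C \<Longrightarrow> curve (\<lambda>x y. C x (- y))"
  unfolding curve_def
proof (intro conjI allI impI, goal_cases)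
  case (1 x y x' y') then have "\<bar>- y - - y'\<bar> \<le> \<bar>x - x'\<bar>" by blast
  then show ?case by linarith
next
  case (2 x y x' y' z)
  then obtain w where "C z w" by blast
  then have "C z (- (- w))" by simp
  then show ?case by blast
qed

text \<open>Reflecting the second axis leaves points before \<open>D\<close> before it, but
  exchanges lying before \<open>C\<close> with having passed \<open>C\<close>, and turns
  \<open>x - y\<close> into \<open>x + y\<close>. The next two lemmas arise from reflecting the
  first axis.\<close>

lemma before_passed:
  assumes C: "curve C" and D: "curve (\<lambda>y x. D x y)"
    and disj: "\<And>x y. C x y \<Longrightarrow> \<not> D x y"
    and 0: "C x0 y0" and 1: "D x1 y1" "\<bar>y0 - y1\<bar> \<le> x1 - x0"
    and 2: "D x2 y2" and 3: "C x3 y3" "\<bar>x2 - x3\<bar> \<le> y2 - y3"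
  shows "x0 + y0 < x2 + y2"
proof -
  have "x0 - (- y0) < x2 - (- y2)"
    by (rule before_before[of "\<lambda>x y. C x (-y)" "\<lambda>x y. D x (-y)" x0 "-y0" x1 "-y1" x2 "-y2" x3 "-y3",
          OF curve_reflect_y[OF C] curve_reflect_x[OF D]]) (use disj 0 1 2 3 in simp_all)
  then show ?thesis by linarith
qed

lemma passed_before:
  assumes C: "curve C" and D: "curve (\<lambda>y x. D x y)"
    and disj: "\<And>x y. C x y \<Longrightarrow> \<not> D x y"
    and 0: "C x0 y0" and 1: "D x1 y1" "\<bar>y0 - y1\<bar> \<le> x0 - x1"
    and 2: "D x2 y2" and 3: "C x3 y3" "\<bar>x2 - x3\<bar> \<le> y3 - y2"
  shows "x2 + y2 < x0 + y0"
proof -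
  have "(- x0) - y0 < (- x2) - y2"
    by (rule before_before[of "\<lambda>x y. C (-x) y" "\<lambda>x y. D (-x) y" "-x0" y0 "-x1" y1 "-x2" y2 "-x3" y3,
          OF curve_reflect_x[OF C] curve_reflect_y[OF D]]) (use disj 0 1 2 3 in simp_all)
  then show ?thesis by linarith
qed

lemma passed_passed:
  assumes C: "curve C" and D: "curve (\<lambda>y x. D x y)"
    and disj: "\<And>x y. C x y \<Longrightarrow> \<not> D x y"
    and 0: "C x0 y0" and 1: "D x1 y1" "\<bar>y0 - y1\<bar> \<le> x0 - x1"
    and 2: "D x2 y2" and 3: "C x3 y3" "\<bar>x2 - x3\<bar> \<le> y2 - y3"
  shows "x2 - y2 < x0 - y0"
proof -
  have "(- x0) + y0 < (- x2) + y2"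
    by (rule before_passed[of "\<lambda>x y. C (-x) y" "\<lambda>x y. D (-x) y" "-x0" y0 "-x1" y1 "-x2" y2 "-x3" y3,
          OF curve_reflect_x[OF C] curve_reflect_y[OF D]]) (use disj 0 1 2 3 in simp_all)
  then show ?thesis by linarith
qed

text \<open>At height \<open>y0\<close> every point belongs to one of the two horizontal cones at
  \<open>(x0, y0)\<close>. Hence \<open>D\<close> avoids this height and, having no gaps in the
  second coordinate, stays on one side of it.\<close>

lemma neither_side:
  assumes D: "curve (\<lambda>y x. D x y)"
    and n1: "\<And>x1 y1. D x1 y1 \<Longrightarrow> \<not> \<bar>y0 - y1\<bar> \<le> x1 - x0"
    and n2: "\<And>x1 y1. D x1 y1 \<Longrightarrow> \<not> \<bar>y0 - y1\<bar> \<le> x0 - x1"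
  shows "(\<forall>x y. D x y \<longrightarrow> \<bar>x - x0\<bar> < y - y0) \<or> (\<forall>x y. D x y \<longrightarrow> \<bar>x - x0\<bar> < y0 - y)"
proof (rule ccontr)
  assume "\<not> ?thesis"
  then obtain x y x' y' where D1: "D x y" "\<not> \<bar>x - x0\<bar> < y - y0" "D x' y'" "\<not> \<bar>x' - x0\<bar> < y0 - y'"
    by blast
  have "y \<le> y0" using n1[OF D1(1)] n2[OF D1(1)] D1(2) by linarith
  moreover have "y0 \<le> y'" using n1[OF D1(3)] n2[OF D1(3)] D1(4) by linarith
  ultimately obtain w where "D w y0" using curve_between[OF D D1(1) D1(3)] by blast
  from n1[OF this] n2[OF this] show False by linarith
qed

text \<open>\<open>C'\<close> and \<open>D'\<close> are parts so short that lying before, or having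
  passed, the other full curve does not vary along them; the last round of cuts provides this. Each
  combination of statuses yields one separating diagonal by the four lemmas above. If one part has
  neither status, the other curve stays in a vertical (or horizontal) cone on one fixed side of all
  its points, and this also separates.\<close>

lemma curves_separated:
  assumes C: "curve C" and D: "curve (\<lambda>y x. D x y)"
    and disj: "\<And>x y. C x y \<Longrightarrow> \<not> D x y"
    and C': "\<And>x y. C' x y \<Longrightarrow> C x y" and D': "\<And>x y. D' x y \<Longrightarrow> D x y"
    and uC1: "\<And>x y x' y'. C' x y \<Longrightarrow> C' x' y' \<Longrightarrow> (\<exists>x1 y1. D x1 y1 \<and> \<bar>y - y1\<bar> \<le> x1 - x) \<Longrightarrow>
        (\<exists>x1 y1. D x1 y1 \<and> \<bar>y' - y1\<bar> \<le> x1 - x')"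
    and uC2: "\<And>x y x' y'. C' x y \<Longrightarrow> C' x' y' \<Longrightarrow> (\<exists>x1 y1. D x1 y1 \<and> \<bar>y - y1\<bar> \<le> x - x1) \<Longrightarrow>
        (\<exists>x1 y1. D x1 y1 \<and> \<bar>y' - y1\<bar> \<le> x' - x1)"
    and uD1: "\<And>x y x' y'. D' x y \<Longrightarrow> D' x' y' \<Longrightarrow> (\<exists>x1 y1. C x1 y1 \<and> \<bar>x - x1\<bar> \<le> y1 - y) \<Longrightarrow>
        (\<exists>x1 y1. C x1 y1 \<and> \<bar>x' - x1\<bar> \<le> y1 - y')"
    and uD2: "\<And>x y x' y'. D' x y \<Longrightarrow> D' x' y' \<Longrightarrow> (\<exists>x1 y1. C x1 y1 \<and> \<bar>x - x1\<bar> \<le> y - y1) \<Longrightarrow>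
        (\<exists>x1 y1. C x1 y1 \<and> \<bar>x' - x1\<bar> \<le> y' - y1)"
  shows "(\<forall>x y x' y'. C' x y \<longrightarrow> D' x' y' \<longrightarrow> x + y < x' + y') \<or>
         (\<forall>x y x' y'. C' x y \<longrightarrow> D' x' y' \<longrightarrow> x' + y' < x + y) \<or>
         (\<forall>x y x' y'. C' x y \<longrightarrow> D' x' y' \<longrightarrow> x - y < x' - y') \<or>
         (\<forall>x y x' y'. C' x y \<longrightarrow> D' x' y' \<longrightarrow> x' - y' < x - y)"
proof (cases "\<exists>x y x' y'. C' x y \<and> D' x' y'")
  case False
  then show ?thesis by blast
next
  case True
  then obtain p q p' q' where pq: "C' p q" and pq': "D' p' q'" by blast
  let ?bC = "\<lambda>x y. \<exists>x1 y1. D x1 y1 \<and> \<bar>y - y1\<bar> \<le> x1 - x"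
  let ?pC = "\<lambda>x y. \<exists>x1 y1. D x1 y1 \<and> \<bar>y - y1\<bar> \<le> x - x1"
  let ?bD = "\<lambda>x y. \<exists>x1 y1. C x1 y1 \<and> \<bar>x - x1\<bar> \<le> y1 - y"
  let ?pD = "\<lambda>x y. \<exists>x1 y1. C x1 y1 \<and> \<bar>x - x1\<bar> \<le> y - y1"
  note BB = before_before[OF C D disj]
  note BP = before_passed[OF C D disj]
  note PB = passed_before[OF C D disj]
  note PP = passed_passed[OF C D disj]
  consider (bb) "?bC p q" "?bD p' q'" | (bp) "?bC p q" "?pD p' q'" | (pb) "?pC p q" "?bD p' q'"
    | (pp) "?pC p q" "?pD p' q'" | (nC) "\<not> ?bC p q" "\<not> ?pC p q" | (nD) "\<not> ?bD p' q'" "\<not> ?pD p' q'"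
    by argo
  then show ?thesis
  proof cases
    case bb
    have "x - y < x' - y'" if "C' x y" "D' x' y'" for x y x' y'
      using uC1[OF pq that(1) bb(1)] uD1[OF pq' that(2) bb(2)] BB C'[OF that(1)] D'[OF that(2)]
      by (elim exE conjE) blast
    then show ?thesis by blast
  next
    case bp
    have "x + y < x' + y'" if "C' x y" "D' x' y'" for x y x' y'
      using uC1[OF pq that(1) bp(1)] uD2[OF pq' that(2) bp(2)] BP C'[OF that(1)] D'[OF that(2)]
      by (elim exE conjE) blast
    then show ?thesis by blast
  next
    case pb
    have "x' + y' < x + y" if "C' x y" "D' x' y'" for x y x' y'
      using uC2[OF pq that(1) pb(1)] uD1[OF pq' that(2) pb(2)] PB C'[OF that(1)] D'[OF that(2)]
      by (elim exE conjE) blast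
    then show ?thesis by blast
  next
    case pp
    have "x' - y' < x - y" if "C' x y" "D' x' y'" for x y x' y'
      using uC2[OF pq that(1) pp(1)] uD2[OF pq' that(2) pp(2)] PP C'[OF that(1)] D'[OF that(2)]
      by (elim exE conjE) blast
    then show ?thesis by blast
  next
    case nC
    have side: "(\<forall>x' y'. D x' y' \<longrightarrow> \<bar>x' - x\<bar> < y' - y) \<or> (\<forall>x' y'. D x' y' \<longrightarrow> \<bar>x' - x\<bar> < y - y')"
      if "C' x y" for x y
    proof (rule neither_side[OF D])
      show "\<not> \<bar>y - y1\<bar> \<le> x1 - x" if "D x1 y1" for x1 y1 using uC1[OF \<open>C' x y\<close> pq] nC(1) that by blast
      show "\<not> \<bar>y - y1\<bar> \<le> x - x1" if "D x1 y1" for x1 y1 using uC2[OF \<open>C' x y\<close> pq] nC(2) that by blast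
    qed
    show ?thesis
    proof (cases "\<forall>x' y'. D x' y' \<longrightarrow> \<bar>x' - p\<bar> < y' - q")
      case T: True
      have "x + y < x' + y'" if "C' x y" "D' x' y'" for x y x' y'
      proof -
        have "\<bar>p' - p\<bar> < q' - q" using T D'[OF pq'] by blast
        moreover have "\<bar>y - q\<bar> \<le> \<bar>x - p\<bar>" using curve_lip[OF C C'[OF that(1)] C'[OF pq]] .
        \<comment> \<open>Otherwise \<open>(p', q')\<close> would lie in the upper cone of
          \<open>(p, q)\<close> and in the lower cone of \<open>(x, y)\<close>, and \<open>C\<close>
          would be steeper than slope 1 between these two points.\<close>
        ultimately have "\<not> \<bar>p' - x\<bar> < y - q'" by linarith
        then have "\<forall>x' y'. D x' y' \<longrightarrow> \<bar>x' - x\<bar> < y' - y" using side[OF that(1)] D'[OF pq'] by blast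
        then have "\<bar>x' - x\<bar> < y' - y" using D'[OF that(2)] by blast
        then show ?thesis by linarith
      qed
      then show ?thesis by blast
    next
      case False
      then have T: "\<forall>x' y'. D x' y' \<longrightarrow> \<bar>x' - p\<bar> < q - y'" using side[OF pq] by blast
      have "x' + y' < x + y" if "C' x y" "D' x' y'" for x y x' y'
      proof -
        have "\<bar>p' - p\<bar> < q - q'" using T D'[OF pq'] by blast
        moreover have "\<bar>y - q\<bar> \<le> \<bar>x - p\<bar>" using curve_lip[OF C C'[OF that(1)] C'[OF pq]] .
        ultimately have "\<not> \<bar>p' - x\<bar> < q' - y" by linarith
        then have "\<forall>x' y'. D x' y' \<longrightarrow> \<bar>x' - x\<bar> < y - y'" using side[OF that(1)] D'[OF pq'] by blast
        then have "\<bar>x' - x\<bar> < y - y'" using D'[OF that(2)] by blast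
        then show ?thesis by linarith
      qed
      then show ?thesis by blast
    qed
  next
    case nD
    have side: "(\<forall>y' x'. C x' y' \<longrightarrow> \<bar>y' - y\<bar> < x' - x) \<or> (\<forall>y' x'. C x' y' \<longrightarrow> \<bar>y' - y\<bar> < x - x')"
      if "D' x y" for x y
    proof (rule neither_side[of "\<lambda>y x. C x y"])
      show "curve (\<lambda>y x. C y x)" using C .
      show "\<not> \<bar>x - x1\<bar> \<le> y1 - y" if "C x1 y1" for y1 x1 using uD1[OF \<open>D' x y\<close> pq'] nD(1) that by blast
      show "\<not> \<bar>x - x1\<bar> \<le> y - y1" if "C x1 y1" for y1 x1 using uD2[OF \<open>D' x y\<close> pq'] nD(2) that by blast
    qed
    show ?thesis
    proof (cases "\<forall>y' x'. C x' y' \<longrightarrow> \<bar>y' - q'\<bar> < x' - p'")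
      case T: True
      have "x' + y' < x + y" if "C' x y" "D' x' y'" for x y x' y'
      proof -
        have "\<bar>q - q'\<bar> < p - p'" using T C'[OF pq] by blast
        moreover have "\<bar>x' - p'\<bar> \<le> \<bar>y' - q'\<bar>" using curve_lip[OF D D'[OF that(2)] D'[OF pq']] .
        ultimately have "\<not> \<bar>q - y'\<bar> < x' - p" by linarith
        then have "\<forall>y x. C x y \<longrightarrow> \<bar>y - y'\<bar> < x - x'" using side[OF that(2)] C'[OF pq] by blast
        then have "\<bar>y - y'\<bar> < x - x'" using C'[OF that(1)] by blast
        then show ?thesis by linarith
      qed
      then show ?thesis by blast
    next
      case False
      then have T: "\<forall>y' x'. C x' y' \<longrightarrow> \<bar>y' - q'\<bar> < p' - x'" using side[OF pq'] by blast
      have "x + y < x' + y'" if "C' x y" "D' x' y'" for x y x' y'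
      proof -
        have "\<bar>q - q'\<bar> < p' - p" using T C'[OF pq] by blast
        moreover have "\<bar>x' - p'\<bar> \<le> \<bar>y' - q'\<bar>" using curve_lip[OF D D'[OF that(2)] D'[OF pq']] .
        ultimately have "\<not> \<bar>q - y'\<bar> < p - x'" by linarith
        then have "\<forall>y x. C x y \<longrightarrow> \<bar>y - y'\<bar> < x' - x" using side[OF that(2)] C'[OF pq] by blast
        then have "\<bar>y - y'\<bar> < x' - x" using C'[OF that(1)] by blast
        then show ?thesis by linarith
      qed
      then show ?thesis by blast
    qed
  qed
qed

section \<open>Colour classes of blocks\<close>

text \<open>
  \<open>K\<close> contains the levels at which a new block begins, and \<open>blk K h\<close> is the number of the block of \<open>h\<close>.
\<close>

definition blk :: "int set \<Rightarrow> int \<Rightarrow> nat" where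
  "blk K h = card {x \<in> K. x \<le> h}"

lemma blk_mono: "finite K \<Longrightarrow> h \<le> h' \<Longrightarrow> blk K h \<le> blk K h'"
  unfolding blk_def by (rule card_mono) auto

lemma blk_eq_iff:
  assumes "finite K"
  shows "blk K h = blk K h' \<longleftrightarrow> (\<forall>x\<in>K. x \<le> h \<longleftrightarrow> x \<le> h')"
proof
  have *: "\<forall>x\<in>K. x \<le> h \<longleftrightarrow> x \<le> h'" if "blk K h = blk K h'" "h \<le> h'" for h h'
  proof -
    have "{x \<in> K. x \<le> h} = {x \<in> K. x \<le> h'}"
      by (rule card_subset_eq) (use assms that in \<open>auto simp: blk_def\<close>)
    then show ?thesis by blast
  qed
  assume "blk K h = blk K h'"
  then show "\<forall>x\<in>K. x \<le> h \<longleftrightarrow> x \<le> h'"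
    using *[of h h'] *[OF sym, of h h'] linear[of h h'] by blast
next
  assume "\<forall>x\<in>K. x \<le> h \<longleftrightarrow> x \<le> h'"
  then have "{x \<in> K. x \<le> h} = {x \<in> K. x \<le> h'}" by blast
  then show "blk K h = blk K h'" unfolding blk_def by simp
qed

lemma blk_le_card: "finite K \<Longrightarrow> blk K h \<le> card K"
  unfolding blk_def by (rule card_mono) auto

lemma blk_subset: "finite K' \<Longrightarrow> K \<subseteq> K' \<Longrightarrow> blk K' h = blk K' h' \<Longrightarrow> blk K h = blk K h'"
  using blk_eq_iff finite_subset by (metis subsetD)

lemma blk_between:
  "finite K \<Longrightarrow> blk K x = blk K y \<Longrightarrow> x \<le> z \<Longrightarrow> z \<le> y \<Longrightarrow> blk K z = blk K x"
  using blk_mono[of K x z] blk_mono[of K z y] by simp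

lemma convex_int_set:
  fixes J :: "int set"
  assumes "J \<subseteq> {lo..hi}" and "\<And>x y z. x \<in> J \<Longrightarrow> y \<in> J \<Longrightarrow> x \<le> z \<Longrightarrow> z \<le> y \<Longrightarrow> z \<in> J"
  shows "\<exists>p q. \<forall>h. h \<in> J \<longleftrightarrow> p \<le> h \<and> \<not> q \<le> h"
proof (cases "J = {}")
  case True
  then have "\<forall>h. h \<in> J \<longleftrightarrow> 0 \<le> h \<and> \<not> 0 \<le> h" by auto
  then show ?thesis by blast
next
  case False
  have fin: "finite J" using assms(1) finite_subset by blast
  have "h \<in> J \<longleftrightarrow> Min J \<le> h \<and> \<not> Max J + 1 \<le> h" for h
  proof
    assume "h \<in> J"
    then show "Min J \<le> h \<and> \<not> Max J + 1 \<le> h" using Max_ge[OF fin, of h] fin Min_le[OF fin, of h] by linarith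
  next
    assume "Min J \<le> h \<and> \<not> Max J + 1 \<le> h"
    then show "h \<in> J" using assms(2)[of "Min J" "Max J" h] fin False by simp
  qed
  then show ?thesis by blast
qed

text \<open>\<open>blk\<close> sees a level only through comparisons \<open>x \<le> h\<close>, so
  each interval is written in half-open form. Its two thresholds become new cuts, which explains
  \<open>2 * card X\<close>.\<close>

lemma refine_cuts:
  fixes J :: "'x \<Rightarrow> int set"
  assumes K: "finite K" and X: "finite X"
    and J: "\<And>x. x \<in> X \<Longrightarrow> J x \<subseteq> {lo..hi}"
      "\<And>x y z u. u \<in> X \<Longrightarrow> x \<in> J u \<Longrightarrow> y \<in> J u \<Longrightarrow> x \<le> z \<Longrightarrow> z \<le> y \<Longrightarrow> z \<in> J u"
  shows "\<exists>K'. K \<subseteq> K' \<and> finite K' \<and> card K' \<le> card K + 2 * card X \<and>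
     (\<forall>h h' x. blk K' h = blk K' h' \<longrightarrow> x \<in> X \<longrightarrow> (h \<in> J x \<longleftrightarrow> h' \<in> J x))"
proof -
  have "\<forall>x\<in>X. \<exists>p q. \<forall>h. h \<in> J x \<longleftrightarrow> p \<le> h \<and> \<not> q \<le> h"
    using convex_int_set[OF J(1)] J(2) by metis
  then obtain p q where pq: "\<And>x h. x \<in> X \<Longrightarrow> h \<in> J x \<longleftrightarrow> p x \<le> h \<and> \<not> q x \<le> h"
    by metis
  let ?K = "K \<union> (p ` X \<union> q ` X)"
  have "card ?K \<le> card K + (card (p ` X) + card (q ` X))"
    by (meson add_left_mono card_Un_le le_trans)
  also have "\<dots> \<le> card K + 2 * card X"
    using card_image_le[OF X, of p] card_image_le[OF X, of q] by linarith
  finally have c: "card ?K \<le> card K + 2 * card X" .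
  have f: "finite ?K" using K X by simp
  have "h \<in> J x \<longleftrightarrow> h' \<in> J x" if "blk ?K h = blk ?K h'" "x \<in> X" for h h' x
    using that unfolding pq[OF that(2)] blk_eq_iff[OF f] by blast
  then show ?thesis using c f by (intro exI[of _ ?K]) blast
qed

text \<open>\<open>F i d h\<close> is the level in partition \<open>d\<close> of the vertex at which
  path \<open>i\<close> has level \<open>h\<close> in its own partition \<open>c i\<close>, and
  \<open>a i\<close>, \<open>b i\<close> are the own levels of its ends. Vertices and edges are
  forgotten here: the whole cutting argument uses only these functions.\<close>

locale lipschitz_family =
  fixes k l :: nat and c :: "nat \<Rightarrow> nat" and a b :: "nat \<Rightarrow> int"
    and F :: "nat \<Rightarrow> nat \<Rightarrow> int \<Rightarrow> int"
  assumes c_less: "i < l \<Longrightarrow> c i < k"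
    and own: "i < l \<Longrightarrow> a i \<le> h \<Longrightarrow> h \<le> b i \<Longrightarrow> F i (c i) h = h"
    and lip: "i < l \<Longrightarrow> d < k \<Longrightarrow> a i \<le> h \<Longrightarrow> h \<le> b i \<Longrightarrow> a i \<le> h' \<Longrightarrow> h' \<le> b i \<Longrightarrow>
        \<bar>F i d h - F i d h'\<bar> \<le> \<bar>h - h'\<bar>"
begin

definition pt :: "nat \<Rightarrow> int \<Rightarrow> bool" where
  "pt i h \<longleftrightarrow> i < l \<and> a i \<le> h \<and> h \<le> b i"

definition coin :: "nat \<Rightarrow> int \<Rightarrow> nat \<Rightarrow> int \<Rightarrow> nat \<Rightarrow> nat \<Rightarrow> bool" where
  "coin i h i' h' d e \<longleftrightarrow> F i d h = F i' d h' \<and> F i e h = F i' e h'"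

text \<open>\<open>d\<close> is a colour of the first block and \<open>e\<close> one of the second.
  In the plane of \<open>d\<close> and \<open>e\<close> the blocks are therefore graphs over
  different axes, as in \<open>curves_separated\<close>.\<close>

definition sep :: "(nat \<Rightarrow> int set) \<Rightarrow> (nat \<Rightarrow> int \<Rightarrow> nat set) \<Rightarrow> nat \<Rightarrow> int \<Rightarrow> nat \<Rightarrow> int \<Rightarrow> bool" where
  "sep K A i h i' h' \<longleftrightarrow> (\<exists>d\<in>A i h. \<exists>e\<in>A i' h'. d \<noteq> e \<and>
     (\<forall>x y. pt i x \<longrightarrow> pt i' y \<longrightarrow> blk (K i) x = blk (K i) h \<longrightarrow> blk (K i') y = blk (K i') h' \<longrightarrow>
        \<not> coin i x i' y d e))"

lemma sepI:
  assumes "d \<in> A i h" "e \<in> A i' h'" "d \<noteq> e"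
    and "\<And>x y. pt i x \<Longrightarrow> pt i' y \<Longrightarrow> blk (K i) x = blk (K i) h \<Longrightarrow> blk (K i') y = blk (K i') h' \<Longrightarrow>
        \<not> coin i x i' y d e"
  shows "sep K A i h i' h'"
  unfolding sep_def by (intro bexI[OF _ assms(1)] bexI[OF _ assms(2)] conjI allI impI assms)

lemma sepE:
  assumes "sep K A i h i' h'"
  obtains d e where "d \<in> A i h" "e \<in> A i' h'" "d \<noteq> e"
    "\<And>x y. pt i x \<Longrightarrow> pt i' y \<Longrightarrow> blk (K i) x = blk (K i) h \<Longrightarrow> blk (K i') y = blk (K i') h' \<Longrightarrow>
        \<not> coin i x i' y d e"
proof -
  from assms obtain d e where de: "d \<in> A i h" "e \<in> A i' h'" "d \<noteq> e"
    and *: "\<forall>x y. pt i x \<longrightarrow> pt i' y \<longrightarrow> blk (K i) x = blk (K i) h \<longrightarrow> blk (K i') y = blk (K i') h' \<longrightarrow>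
        \<not> coin i x i' y d e"
    unfolding sep_def by (elim bexE conjE)
  show thesis by (rule that[OF de]) (use * in simp)
qed

lemma coin_commute: "coin i x i' y d e \<longleftrightarrow> coin i' y i x e d"
  unfolding coin_def by metis

lemma sep_sym:
  assumes "sep K A i h i' h'"
  shows "sep K A i' h' i h"
  using assms
proof (rule sepE)
  fix d e assume de: "d \<in> A i h" "e \<in> A i' h'" "d \<noteq> e"
    and *: "\<And>x y. pt i x \<Longrightarrow> pt i' y \<Longrightarrow> blk (K i) x = blk (K i) h \<Longrightarrow> blk (K i') y = blk (K i') h' \<Longrightarrow>
        \<not> coin i x i' y d e"
  show ?thesis
    by (rule sepI[of e A i' h' d], rule de, rule de, rule de(3)[symmetric], subst coin_commute, rule *)
qed

text \<open>
  \<open>A i h\<close> is the set of colours found so far for the block of path \<open>i\<close> that contains level \<open>h\<close>.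
\<close>

definition stage :: "nat \<Rightarrow> nat \<Rightarrow> (nat \<Rightarrow> int set) \<Rightarrow> (nat \<Rightarrow> int \<Rightarrow> nat set) \<Rightarrow> bool" where
  "stage j \<kappa> K A \<longleftrightarrow>
     (\<forall>i<l. finite (K i) \<and> card (K i) < \<kappa>) \<and>
     (\<forall>i h. pt i h \<longrightarrow> c i \<in> A i h \<and> A i h \<subseteq> {..<k}) \<and>
     (\<forall>i h h'. pt i h \<longrightarrow> pt i h' \<longrightarrow> blk (K i) h = blk (K i) h' \<longrightarrow>
        A i h = A i h' \<and> (\<forall>d\<in>A i h. \<bar>F i d h - F i d h'\<bar> = \<bar>h - h'\<bar>)) \<and>
     (\<forall>i h i' h'. pt i h \<longrightarrow> pt i' h' \<longrightarrow>
        sep K A i h i' h' \<or> A i h = A i' h' \<or> j < card (A i h) \<and> j < card (A i' h'))"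

lemma stageD:
  assumes "stage j \<kappa> K A"
  shows "i < l \<Longrightarrow> finite (K i)" "i < l \<Longrightarrow> card (K i) < \<kappa>"
    "pt i h \<Longrightarrow> c i \<in> A i h" "pt i h \<Longrightarrow> A i h \<subseteq> {..<k}"
    "pt i h \<Longrightarrow> pt i h' \<Longrightarrow> blk (K i) h = blk (K i) h' \<Longrightarrow> A i h = A i h'"
    "pt i h \<Longrightarrow> pt i h' \<Longrightarrow> blk (K i) h = blk (K i) h' \<Longrightarrow> d \<in> A i h \<Longrightarrow>
       \<bar>F i d h - F i d h'\<bar> = \<bar>h - h'\<bar>"
    "pt i h \<Longrightarrow> pt i' h' \<Longrightarrow>
       sep K A i h i' h' \<or> A i h = A i' h' \<or> j < card (A i h) \<and> j < card (A i' h')"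
  using assms unfolding stage_def by blast+

lemma ptD: "pt i h \<Longrightarrow> i < l" and pt_between: "pt i x \<Longrightarrow> pt i y \<Longrightarrow> x \<le> z \<Longrightarrow> z \<le> y \<Longrightarrow> pt i z"
  unfolding pt_def by auto

lemma lip_pt: "pt i h \<Longrightarrow> pt i h' \<Longrightarrow> d < k \<Longrightarrow> \<bar>F i d h - F i d h'\<bar> \<le> \<bar>h - h'\<bar>"
  unfolding pt_def using lip by blast

text \<open>Without cuts each path is a single block that carries its own colour only. At
  \<open>j = 0\<close> the cardinality alternative holds for singletons, so nothing is yet claimed
  about pairs of blocks.\<close>

lemma stage_0: "stage 0 1 (\<lambda>_. {}) (\<lambda>i _. {c i})"
  unfolding stage_def using c_less own by (auto simp: pt_def)

text \<open>
  The points of block \<open>r\<close> of path \<open>i\<close> that meet block \<open>r'\<close> of path \<open>i'\<close> in the plane \<open>(d, e)\<close>.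
\<close>

definition J :: "(nat \<Rightarrow> int set) \<Rightarrow> (nat \<Rightarrow> int \<Rightarrow> nat set) \<Rightarrow> nat \<Rightarrow> nat \<times> nat \<times> nat \<times> nat \<times> nat \<Rightarrow> int set" where
  "J K A i = (\<lambda>(r, i', r', d, e). {h. pt i h \<and> blk (K i) h = r \<and> d \<in> A i h \<and> d \<noteq> e \<and>
      (\<exists>h'. pt i' h' \<and> blk (K i') h' = r' \<and> e \<in> A i' h' \<and> coin i h i' h' d e)})"

text \<open>A 1-Lipschitz function that attains the full distance between two arguments has no slack
  in between, so it has constant slope 1 or -1 there.\<close>

lemma straight_between:
  assumes st: "\<bar>F i d x - F i d y\<bar> = y - x" and p: "pt i x" "pt i y" "d < k" and z: "x \<le> z" "z \<le> y"
  shows "(F i d y - F i d x = y - x \<and> F i d z = F i d x + (z - x)) \<or>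
         (F i d y - F i d x = - (y - x) \<and> F i d z = F i d x - (z - x))"
  using lip_pt[OF p(1) pt_between[OF p(1,2) z] p(3)] lip_pt[OF pt_between[OF p(1,2) z] p(2,3)] st z
  by linarith

text \<open>The chain closes on itself: the length \<open>\<bar>x - y\<bar>\<close> equals the
  change of level \<open>d\<close>, which both blocks share and which is at most
  \<open>\<bar>x' - y'\<bar>\<close> by the Lipschitz property of the second block. That length
  equals the change of level \<open>e\<close>, again shared, which is at most
  \<open>\<bar>x - y\<bar>\<close>. Hence equality holds throughout.\<close>

lemma coin_straight:
  assumes st: "stage j \<kappa> K A" and p: "pt i x" "pt i y" "pt i' x'" "pt i' y'"
    and blk: "blk (K i) x = blk (K i) y" "blk (K i') x' = blk (K i') y'"
    and d: "d \<in> A i x" "e \<in> A i' x'" and coin: "coin i x i' x' d e" "coin i y i' y' d e"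
  shows "\<bar>F i d x - F i d y\<bar> = \<bar>x - y\<bar>" "\<bar>F i e x - F i e y\<bar> = \<bar>x - y\<bar>"
    "\<bar>F i' d x' - F i' d y'\<bar> = \<bar>x' - y'\<bar>" "\<bar>F i' e x' - F i' e y'\<bar> = \<bar>x' - y'\<bar>" "\<bar>x - y\<bar> = \<bar>x' - y'\<bar>"
proof -
  have dk: "d < k" "e < k" using stageD(4)[OF st] p d by blast+
  note * = stageD(6)[OF st p(1,2) blk(1) d(1)] stageD(6)[OF st p(3,4) blk(2) d(2)]
    lip_pt[OF p(1,2) dk(2)] lip_pt[OF p(3,4) dk(1)]
  show "\<bar>F i d x - F i d y\<bar> = \<bar>x - y\<bar>" "\<bar>F i e x - F i e y\<bar> = \<bar>x - y\<bar>"
    "\<bar>F i' d x' - F i' d y'\<bar> = \<bar>x' - y'\<bar>" "\<bar>F i' e x' - F i' e y'\<bar> = \<bar>x' - y'\<bar>" "\<bar>x - y\<bar> = \<bar>x' - y'\<bar>"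
    using * coin unfolding coin_def by linarith+
qed

text \<open>Between two coincidences, both levels are affine on both blocks by
  \<open>coin_straight\<close>, so the blocks also coincide at corresponding intermediate
  points.\<close>

lemma J_convex:
  assumes st: "stage j \<kappa> K A" and x: "x \<in> J K A i u" and y: "y \<in> J K A i u" and z: "x \<le> z" "z \<le> y"
  shows "z \<in> J K A i u"
proof -
  obtain r i' r' d e where u: "u = (r, i', r', d, e)" by (cases u)
  obtain x' where x': "pt i x" "blk (K i) x = r" "d \<in> A i x" "d \<noteq> e" "pt i' x'" "blk (K i') x' = r'"
      "e \<in> A i' x'" "coin i x i' x' d e"
    using x unfolding J_def u by auto
  obtain y' where y': "pt i y" "blk (K i) y = r" "d \<in> A i y" "pt i' y'" "blk (K i') y' = r'"
      "e \<in> A i' y'" "coin i y i' y' d e"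
    using y unfolding J_def u by auto
  have dk: "d < k" "e < k" using stageD(4)[OF st] x' by blast+
  have cs: "\<bar>F i d x - F i d y\<bar> = \<bar>x - y\<bar>" "\<bar>F i e x - F i e y\<bar> = \<bar>x - y\<bar>"
    "\<bar>F i' d x' - F i' d y'\<bar> = \<bar>x' - y'\<bar>" "\<bar>F i' e x' - F i' e y'\<bar> = \<bar>x' - y'\<bar>" "\<bar>x - y\<bar> = \<bar>x' - y'\<bar>"
    by (rule coin_straight[OF st x'(1) y'(1) x'(5) y'(4) _ _ x'(3,7,8) y'(7)]; use x' y' in simp)+
  have ptz: "pt i z" by (rule pt_between[OF x'(1) y'(1) z])
  have bz: "blk (K i) z = blk (K i) x"
    using blk_between[OF stageD(1)[OF st ptD[OF x'(1)]] _ z] x'(2) y'(2) by simp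
  have Az: "A i z = A i x" using stageD(5)[OF st ptz x'(1) bz] .
  \<comment> \<open>The partner of \<open>z\<close> is as far from \<open>x'\<close> as
    \<open>z\<close> is from \<open>x\<close>. The second path may run in the opposite direction,
    hence the case distinction.\<close>
  define z' where "z' = (if x' \<le> y' then x' + (z - x) else x' - (z - x))"
  have z'b: "x' \<le> z' \<and> z' \<le> y' \<or> y' \<le> z' \<and> z' \<le> x'"
    unfolding z'_def using z cs(5) by auto
  then have ptz': "pt i' z'" and bz': "blk (K i') z' = r'"
    using pt_between[OF x'(5) y'(4)] pt_between[OF y'(4) x'(5)]
      blk_between[OF stageD(1)[OF st ptD[OF x'(5)]]] x'(6) y'(5) by metis+
  have Az': "A i' z' = A i' x'" using stageD(5)[OF st ptz' x'(5)] bz' x'(6) by simp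
  have eq: "F i g z = F i' g z'" if "F i g x = F i' g x'" "F i g y = F i' g y'" "g < k"
      "\<bar>F i g x - F i g y\<bar> = \<bar>x - y\<bar>" for g
  proof -
    have 1: "\<bar>F i g x - F i g z\<bar> \<le> z - x" "\<bar>F i g z - F i g y\<bar> \<le> y - z"
      using lip_pt[OF x'(1) ptz that(3)] lip_pt[OF ptz y'(1) that(3)] z by linarith+
    have zz: "\<bar>x' - z'\<bar> = z - x" "\<bar>z' - y'\<bar> = y - z" using z'b cs(5) z unfolding z'_def by auto
    have 2: "\<bar>F i' g x' - F i' g z'\<bar> \<le> z - x" "\<bar>F i' g z' - F i' g y'\<bar> \<le> y - z"
      using lip_pt[OF x'(5) ptz' that(3)] lip_pt[OF ptz' y'(4) that(3)] zz by linarith+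
    show ?thesis using 1 2 that z by linarith
  qed
  have "coin i z i' z' d e"
    using eq[of d] eq[of e] x'(8) y'(7) dk cs unfolding coin_def by blast
  then show ?thesis unfolding J_def u
    using ptz bz x' Az ptz' bz' Az' by auto
qed

abbreviation idx :: "nat \<Rightarrow> (nat \<times> nat \<times> nat \<times> nat \<times> nat) set" where
  "idx \<kappa> \<equiv> {..<\<kappa>} \<times> {..<l} \<times> {..<\<kappa>} \<times> {..<k} \<times> {..<k}"

lemma card_idx: "card (idx \<kappa>) = \<kappa> * (l * (\<kappa> * (k * k)))"
  by (simp add: card_cartesian_product)

text \<open>Unlike \<open>sep\<close>, this speaks about the single point \<open>h\<close>. A
  meeting is demanded in every admissible plane, and this is what entitles \<open>h\<close> to the
  colours of the other block. Cutting at the ends of the sets \<open>J\<close> makes the property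
  constant along the new blocks.\<close>

definition nb :: "(nat \<Rightarrow> int set) \<Rightarrow> (nat \<Rightarrow> int \<Rightarrow> nat set) \<Rightarrow> nat \<Rightarrow> int \<Rightarrow> nat \<Rightarrow> int \<Rightarrow> bool" where
  "nb K A i h i' h' \<longleftrightarrow> (\<forall>d\<in>A i h. \<forall>e\<in>A i' h'. d \<noteq> e \<longrightarrow>
     (\<exists>y. pt i' y \<and> blk (K i') y = blk (K i') h' \<and> coin i h i' y d e))"

text \<open>A point receives the colours of all old blocks that it meets in the sense of
  \<open>nb\<close>. Take two new blocks that are not separated. If their old colour sets were
  equal, they meet the same old blocks, because a block met by only one of them would yield a
  separating plane; so they receive the same colours. If the old sets differed, the blocks meet each
  other and both receive the union. The union of two different sets with more than \<open>j\<close>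
  elements each has more than \<open>j + 1\<close>.\<close>

lemma stage_Suc:
  assumes st: "stage j \<kappa> K A" and l: "0 < l" and k: "0 < k"
  shows "\<exists>K' A'. stage (Suc j) (5 * k * k * l * (\<kappa> * \<kappa>)) K' A'"
proof -
  let ?X = "idx \<kappa>"
  note fin = stageD(1)[OF st]
  have blk\<kappa>: "blk (K i) h < \<kappa>" if "i < l" for i h
    using blk_le_card[OF fin[OF that], of h] stageD(2)[OF st that] by linarith
  define P where "P i K' \<longleftrightarrow> K i \<subseteq> K' \<and> finite K' \<and> card K' \<le> card (K i) + 2 * card ?X \<and>
     (\<forall>h h' x. blk K' h = blk K' h' \<longrightarrow> x \<in> ?X \<longrightarrow> (h \<in> J K A i x \<longleftrightarrow> h' \<in> J K A i x))" for i K'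
  have "\<exists>K'. P i K'" if "i < l" for i
    unfolding P_def
  proof (rule refine_cuts[OF fin[OF that]])
    show "J K A i x \<subseteq> {a i..b i}" for x unfolding J_def pt_def by auto
    show "finite ?X" by (intro finite_cartesian_product finite_lessThan)
  qed (rule J_convex[OF st])
  then have "\<forall>i\<in>{..<l}. \<exists>K'. P i K'" by blast
  from bchoice[OF this] obtain K' where P: "\<forall>i\<in>{..<l}. P i (K' i)" by blast
  have K': "\<And>i. i < l \<Longrightarrow> K i \<subseteq> K' i" "\<And>i. i < l \<Longrightarrow> finite (K' i)"
    "\<And>i. i < l \<Longrightarrow> card (K' i) \<le> card (K i) + 2 * card ?X"
    "\<And>i h h' x. i < l \<Longrightarrow> blk (K' i) h = blk (K' i) h' \<Longrightarrow> x \<in> ?X \<Longrightarrow> h \<in> J K A i x \<longleftrightarrow> h' \<in> J K A i x"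
    using P unfolding P_def by blast+
  have sub: "blk (K i) h = blk (K i) h'" if "i < l" "blk (K' i) h = blk (K' i) h'" for i h h'
    using blk_subset[OF K'(2)[OF that(1)] K'(1)[OF that(1)] that(2)] .
  have inv: "\<exists>y. pt i' y \<and> blk (K i') y = blk (K i') h' \<and> coin i x i' y d e"
    if p: "pt i h" "pt i x" "blk (K' i) h = blk (K' i) x" "pt i' h'" "d \<in> A i h" "e \<in> A i' h'" "d \<noteq> e"
      and ex: "\<exists>y. pt i' y \<and> blk (K i') y = blk (K i') h' \<and> coin i h i' y d e"
    for i h x i' h' d e
  proof -
    obtain y where y: "pt i' y" "blk (K i') y = blk (K i') h'" "coin i h i' y d e" using ex by blast
    let ?u = "(blk (K i) h, i', blk (K i') h', d, e)"
    have u: "?u \<in> ?X"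
      using blk\<kappa>[OF ptD[OF p(1)]] blk\<kappa>[OF ptD[OF p(4)]] ptD[OF p(4)] p(5,6)
        stageD(4)[OF st p(1)] stageD(4)[OF st p(4)] by auto
    have "A i' y = A i' h'" using stageD(5)[OF st y(1) p(4) y(2)] .
    then have "h \<in> J K A i ?u" unfolding J_def using y p by auto
    then have "x \<in> J K A i ?u" using K'(4)[OF ptD[OF p(1)] p(3) u] by simp
    then show ?thesis unfolding J_def by auto
  qed
  have Aeq: "A i h = A i x" if "pt i h" "pt i x" "blk (K' i) h = blk (K' i) x" for i h x
    using stageD(5)[OF st that(1,2) sub[OF ptD[OF that(1)] that(3)]] .
  have nb_eq: "nb K A i x i' h'" if p: "pt i h" "pt i x" "blk (K' i) h = blk (K' i) x" "pt i' h'"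
    and "nb K A i h i' h'" for i h x i' h'
    using inv[OF p] Aeq[OF p(1,2,3)] that(5) unfolding nb_def by metis
  define A' where "A' i h = A i h \<union> {x. \<exists>i' h'. pt i' h' \<and> nb K A i h i' h' \<and> x \<in> A i' h'}" for i h
  have A'I: "A i' h' \<subseteq> A' i h" if "pt i' h'" "nb K A i h i' h'" for i h i' h'
    unfolding A'_def using that by blast
  have AA': "A i h \<subseteq> A' i h" for i h unfolding A'_def by blast
  have A'eq: "A' i h = A' i x" if p: "pt i h" "pt i x" "blk (K' i) h = blk (K' i) x" for i h x
  proof -
    have "nb K A i h i' h' \<longleftrightarrow> nb K A i x i' h'" if "pt i' h'" for i' h'
      using nb_eq[OF p that] nb_eq[OF p(2,1) p(3)[symmetric] that] by blast
    then show ?thesis unfolding A'_def Aeq[OF p] by (simp cong: conj_cong)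
  qed
  have A'k: "A' i h \<subseteq> {..<k}" if "pt i h" for i h
    unfolding A'_def using stageD(4)[OF st] that by blast
  have card_mono': "card (A i h) \<le> card (A' i h)" if "pt i h" for i h
    using card_mono[OF finite_subset[OF A'k[OF that]] AA'] by simp
  \<comment> \<open>A common point of the two new blocks in the plane of \<open>d\<close> and
    \<open>e\<close> would be shared with the third block as well, since the first block meets the
    latter in that plane everywhere. By \<open>inv\<close> the point \<open>h'\<close> would then
    meet it too.\<close>
  have not_nb_sep: "sep K' A' i h i' h'"
    if p: "pt i h" "pt i' h'" "pt i2 h2" "d \<in> A' i h" "d \<in> A i2 h2" "e \<in> A i' h'" "d \<noteq> e"
      and hit: "\<And>x. pt i x \<Longrightarrow> blk (K' i) x = blk (K' i) h \<Longrightarrow>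
        \<exists>y. pt i2 y \<and> blk (K i2) y = blk (K i2) h2 \<and> coin i x i2 y d e"
      and miss: "\<not> (\<exists>y. pt i2 y \<and> blk (K i2) y = blk (K i2) h2 \<and> coin i' h' i2 y e d)"
    for i h i' h' i2 h2 d e
  proof -
    have "\<not> coin i x i' y d e"
      if q: "pt i x" "pt i' y" "blk (K' i) x = blk (K' i) h" "blk (K' i') y = blk (K' i') h'" for x y
    proof
      assume co: "coin i x i' y d e"
      obtain z where z: "pt i2 z" "blk (K i2) z = blk (K i2) h2" "coin i x i2 z d e"
        using hit[OF q(1,3)] by blast
      have "coin i' y i2 z e d" using z(3) co unfolding coin_def by simp
      then have "\<exists>z. pt i2 z \<and> blk (K i2) z = blk (K i2) h2 \<and> coin i' h' i2 z e d"
        using inv[OF q(2) p(2) q(4) p(3) _ p(5), of e] p(6,7) Aeq[OF q(2) p(2) q(4)] z by blast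
      then show False using miss by blast
    qed
    then show ?thesis using p AA' by (intro sepI[of d A' i h e i' h']) blast+
  qed
  have key: "sep K' A' i h i' h' \<or> A' i h = A' i' h' \<or> Suc j < card (A' i h) \<and> Suc j < card (A' i' h')"
    if p: "pt i h" "pt i' h'" for i h i' h'
  proof (rule ccontr)
    assume neg: "\<not> ?thesis"
    have nsep: "\<not> sep K' A' i h i' h'" and nsep': "\<not> sep K' A' i' h' i h"
      using neg sep_sym by blast+
    have "\<not> sep K A i h i' h'"
    proof
      assume "sep K A i h i' h'"
      then obtain d e where de: "d\<in>A i h" "e\<in>A i' h'" "d \<noteq> e"
        "\<And>x y. pt i x \<Longrightarrow> pt i' y \<Longrightarrow> blk (K i) x = blk (K i) h \<Longrightarrow> blk (K i') y = blk (K i') h' \<Longrightarrow>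
        \<not> coin i x i' y d e" by (rule sepE) metis
      have "sep K' A' i h i' h'"
      proof (rule sepI)
        show "d \<in> A' i h" "e \<in> A' i' h'" "d \<noteq> e" using AA' de(1-3) by blast+
        fix x y assume "pt i x" "pt i' y" "blk (K' i) x = blk (K' i) h" "blk (K' i') y = blk (K' i') h'"
        then show "\<not> coin i x i' y d e" using de(4) sub ptD by metis
      qed
      then show False using nsep by blast
    qed
    then consider "A i h = A i' h'" | "A i h \<noteq> A i' h'" "j < card (A i h)" "j < card (A i' h')"
      using stageD(7)[OF st p] by blast
    then show False
    proof cases
      case 1
      have tr: "nb K A i' h' i2 h2"
        if q: "pt i h" "pt i' h'" "pt i2 h2" "A i h = A i' h'" "nb K A i h i2 h2"
          "\<not> sep K' A' i h i' h'" for i h i' h' i2 h2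
      proof (rule ccontr)
        assume "\<not> ?thesis"
        then obtain e d where ed: "e \<in> A i' h'" "d \<in> A i2 h2" "e \<noteq> d"
          "\<not> (\<exists>y. pt i2 y \<and> blk (K i2) y = blk (K i2) h2 \<and> coin i' h' i2 y e d)"
          unfolding nb_def by blast
        have "sep K' A' i h i' h'"
        proof (rule not_nb_sep[OF q(1,2,3) _ ed(2,1) ed(3)[symmetric] _ ed(4)])
          show "d \<in> A' i h" using A'I[OF q(3,5)] ed by blast
          fix x assume x: "pt i x" "blk (K' i) x = blk (K' i) h"
          then have "nb K A i x i2 h2" using nb_eq[OF q(1) x(1) x(2)[symmetric] q(3,5)] by blast
          moreover have "e \<in> A i x" using ed(1) q(4) Aeq[OF x(1) q(1) x(2)] by simp
          ultimately show "\<exists>y. pt i2 y \<and> blk (K i2) y = blk (K i2) h2 \<and> coin i x i2 y d e"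
            using ed(2,3) unfolding nb_def coin_def by blast
        qed
        then show False using q(6) by blast
      qed
      have "nb K A i h i2 h2 \<longleftrightarrow> nb K A i' h' i2 h2" if "pt i2 h2" for i2 h2
        using tr[OF p that 1 _ nsep] tr[OF p(2,1) that 1[symmetric] _ nsep'] by blast
      then have "A' i h = A' i' h'" unfolding A'_def 1 by (simp cong: conj_cong)
      then show False using neg by blast
    next
      case 2
      have nbI: "nb K A i h i' h'" if q: "pt i h" "pt i' h'" "\<not> sep K' A' i h i' h'" for i h i' h'
      proof (rule ccontr)
        assume "\<not> ?thesis"
        then obtain d e where de: "d \<in> A i h" "e \<in> A i' h'" "d \<noteq> e"
          "\<not> (\<exists>y. pt i' y \<and> blk (K i') y = blk (K i') h' \<and> coin i h i' y d e)"
          unfolding nb_def by blast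
        have "\<not> coin i x i' y d e"
          if r: "pt i x" "pt i' y" "blk (K' i) x = blk (K' i) h" "blk (K' i') y = blk (K' i') h'" for x y
        proof
          assume "coin i x i' y d e"
          then have "\<exists>y. pt i' y \<and> blk (K i') y = blk (K i') h' \<and> coin i h i' y d e"
            using inv[OF r(1) q(1) r(3) q(2) _ de(2,3)] de(1) Aeq[OF r(1) q(1) r(3)]
              r(2) sub[OF ptD[OF q(2)] r(4)] by blast
          then show False using de(4) by blast
        qed
        then have "sep K' A' i h i' h'" using de AA' by (intro sepI[of d A' i h e i' h']) blast+
        then show False using q(3) by blast
      qed
      have "A i h \<union> A i' h' \<subseteq> A' i h" "A i h \<union> A i' h' \<subseteq> A' i' h'"
        using A'I[OF p(2) nbI[OF p nsep]] A'I[OF p(1) nbI[OF p(2,1) nsep']] AA' by blast+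
      then have le: "card (A i h \<union> A i' h') \<le> card (A' i h)" "card (A i h \<union> A i' h') \<le> card (A' i' h')"
        using card_mono[OF finite_subset[OF A'k[OF p(1)]]] card_mono[OF finite_subset[OF A'k[OF p(2)]]] by auto
      have fA: "finite (A i h \<union> A i' h')" using stageD(4)[OF st p(1)] stageD(4)[OF st p(2)]
        by (meson finite_Un finite_lessThan finite_subset)
      have "Suc j < card (A i h \<union> A i' h')"
      proof (rule ccontr)
        assume "\<not> ?thesis"
        then have "card (A i h \<union> A i' h') \<le> card (A i h)" "card (A i h \<union> A i' h') \<le> card (A i' h')"
          using 2 by linarith+
        then have "A i h = A i h \<union> A i' h'" "A i' h' = A i h \<union> A i' h'"
          using card_seteq[OF fA] by blast+
        then show False using 2(1) by simp
      qed
      then show False using le neg by linarith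
    qed
  qed
  \<comment> \<open>An added colour \<open>d\<close> stems from a block that both \<open>h\<close>
    and \<open>x\<close> meet in the plane of \<open>c i\<close> and \<open>d\<close>. Two
    coincidences make \<open>d\<close> straight between them.\<close>
  have straight: "\<bar>F i d h - F i d x\<bar> = \<bar>h - x\<bar>"
    if p: "pt i h" "pt i x" "blk (K' i) h = blk (K' i) x" and d: "d \<in> A' i h" for i h x d
  proof (cases "d \<in> A i h")
    case True
    then show ?thesis using stageD(6)[OF st p(1,2) sub[OF ptD[OF p(1)] p(3)]] by blast
  next
    case False
    then obtain i2 h2 where q: "pt i2 h2" "nb K A i h i2 h2" "d \<in> A i2 h2"
      using d unfolding A'_def by blast
    have ci: "c i \<in> A i h" using stageD(3)[OF st p(1)] .
    then have ne: "c i \<noteq> d" using False by blast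
    have cx: "c i \<in> A i x" using ci Aeq[OF p] by simp
    obtain y where y: "pt i2 y" "blk (K i2) y = blk (K i2) h2" "coin i h i2 y (c i) d"
      using q ci ne unfolding nb_def by blast
    obtain z where z: "pt i2 z" "blk (K i2) z = blk (K i2) h2" "coin i x i2 z (c i) d"
      using nb_eq[OF p q(1,2)] cx ne q(3) unfolding nb_def by blast
    have "d \<in> A i2 y" using stageD(5)[OF st y(1) q(1) y(2)] q(3) by simp
    then show ?thesis
      using coin_straight(2)[OF st p(1,2) y(1) z(1) sub[OF ptD[OF p(1)] p(3)] _ ci _ y(3) z(3)] y(2) z(2)
      by simp
  qed
  have cardK': "card (K' i) < 5 * k * k * l * (\<kappa> * \<kappa>)" if "i < l" for i
  proof -
    have \<kappa>: "0 < \<kappa>" using stageD(2)[OF st that] by linarith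
    define X where "X = k * k * l * (\<kappa> * \<kappa>)"
    have "1 \<le> k * k * l" using k l by (simp add: Suc_leI)
    then have "\<kappa> * \<kappa> \<le> X" unfolding X_def by (metis mult.left_neutral mult_le_mono1)
    moreover have "\<kappa> \<le> \<kappa> * \<kappa>" using \<kappa> by simp
    moreover have "card ?X = X" unfolding card_idx by (simp add: X_def algebra_simps)
    \<comment> \<open>Here \<open>\<kappa> + 2 * X \<le> 3 * X\<close> bounds the number of cuts.
      The factor 5 is dictated by the last round of cuts, whose index set is twice as large.\<close>
    ultimately have "card (K' i) < 5 * X" using K'(3)[OF that] stageD(2)[OF st that] \<kappa> by linarith
    also have "5 * X = 5 * k * k * l * (\<kappa> * \<kappa>)" by (simp add: X_def algebra_simps)
    finally show ?thesis .
  qed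
  have "stage (Suc j) (5 * k * k * l * (\<kappa> * \<kappa>)) K' A'"
    unfolding stage_def
  proof (intro conjI allI impI ballI)
    show "c i \<in> A' i h" if "pt i h" for i h using stageD(3)[OF st that] AA' by blast
  qed (erule K'(2), erule cardK', erule A'k, rule A'eq, assumption+, rule straight, assumption+,
      rule key, assumption+)
  then show ?thesis by blast
qed

end

section \<open>The last round of cuts: disjoint rectangles\<close>

context lipschitz_family
begin

text \<open>A colour \<open>d\<close> of the block changes at unit speed along it and can therefore
  replace the own level as parameter; every other level is 1-Lipschitz in it.\<close>

lemma block_curve:
  assumes st: "stage j \<kappa> K A" and P: "pt i p" "d \<in> A i p" "e < k"
  shows "curve (\<lambda>x y. \<exists>h. pt i h \<and> blk (K i) h = blk (K i) p \<and> x = F i d h \<and> y = F i e h)"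
  unfolding curve_def
proof (intro conjI allI impI; elim exE conjE)
  fix x y x' y' h h'
  assume h: "pt i h" "blk (K i) h = blk (K i) p" "x = F i d h" "y = F i e h"
    and h': "pt i h'" "blk (K i) h' = blk (K i) p" "x' = F i d h'" "y' = F i e h'"
  have d: "d \<in> A i h" using stageD(5)[OF st h(1) P(1) h(2)] P(2) by simp
  show "\<bar>y - y'\<bar> \<le> \<bar>x - x'\<bar>"
    using lip_pt[OF h(1) h'(1) P(3)] stageD(6)[OF st h(1) h'(1) _ d] h h' by simp
next
  fix x y x' y' z h h'
  assume h: "pt i h" "blk (K i) h = blk (K i) p" "x = F i d h" "y = F i e h"
    and h': "pt i h'" "blk (K i) h' = blk (K i) p" "x' = F i d h'" "y' = F i e h'"
    and z: "x \<le> z" "z \<le> x'"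
  have d: "d \<in> A i h" using stageD(5)[OF st h(1) P(1) h(2)] P(2) by simp
  have dk: "d < k" using stageD(4)[OF st P(1)] P(2) by blast
  have str: "\<bar>F i d h - F i d h'\<bar> = \<bar>h - h'\<bar>"
    using stageD(6)[OF st h(1) h'(1) _ d] h h' by simp
  show "\<exists>w g. pt i g \<and> blk (K i) g = blk (K i) p \<and> z = F i d g \<and> w = F i e g"
  proof (cases "h \<le> h'")
    case True
    let ?g = "h + (z - x)"
    have g: "h \<le> ?g" "?g \<le> h'" using z str True h h' by linarith+
    have "F i d ?g = z"
      using straight_between[of i d h h', OF _ h(1) h'(1) dk g] str True z h(3) h'(3) by linarith
    then show ?thesis
      using pt_between[OF h(1) h'(1) g] blk_between[OF stageD(1)[OF st ptD[OF P(1)]] _ g] h(2) h'(2) by metis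
  next
    case False
    let ?g = "h - (z - x)"
    have g: "h' \<le> ?g" "?g \<le> h" using z str False h h' by linarith+
    have "F i d ?g = z"
      using straight_between[of i d h' h, OF _ h'(1) h(1) dk g] str False z h(3) h'(3) by linarith
    then show ?thesis
      using pt_between[OF h'(1) h(1) g] blk_between[OF stageD(1)[OF st ptD[OF P(1)]] _ g] h(2) h'(2) by metis
  qed
qed

text \<open>The statuses of \<open>curves_separated\<close>: with \<open>s\<close> true, these are
  the points of block \<open>r\<close> that lie before block \<open>r'\<close> of path
  \<open>i'\<close> in direction \<open>d\<close>; with \<open>s\<close> false, those that have
  passed it.\<close>

definition G :: "(nat \<Rightarrow> int set) \<Rightarrow> (nat \<Rightarrow> int \<Rightarrow> nat set) \<Rightarrow> nat \<Rightarrow>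
    (nat \<times> nat \<times> nat \<times> nat \<times> nat) \<times> bool \<Rightarrow> int set" where
  "G K A i = (\<lambda>((r, i', r', d, e), s). {h. pt i h \<and> blk (K i) h = r \<and> d \<in> A i h \<and>
      (\<exists>h'. pt i' h' \<and> blk (K i') h' = r' \<and> e \<in> A i' h' \<and>
        \<bar>F i e h - F i' e h'\<bar> \<le> (if s then F i' d h' - F i d h else F i d h - F i' d h'))})"

text \<open>Level \<open>d\<close> moves at full speed along the block, so the cones opening to one
  side are nested. The cone at \<open>z\<close> contains the cone at that one of \<open>x\<close>
  and \<open>y\<close> which lies further in the direction of opening, and the partner of this end
  also serves \<open>z\<close>.\<close>

lemma G_convex:
  assumes st: "stage j \<kappa> K A" and x: "x \<in> G K A i u" and y: "y \<in> G K A i u" and z: "x \<le> z" "z \<le> y"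
  shows "z \<in> G K A i u"
proof -
  obtain r i' r' d e s where u: "u = ((r, i', r', d, e), s)" by (cases u) auto
  obtain x' where x': "pt i x" "blk (K i) x = r" "d \<in> A i x" "pt i' x'" "blk (K i') x' = r'"
      "e \<in> A i' x'" "\<bar>F i e x - F i' e x'\<bar> \<le> (if s then F i' d x' - F i d x else F i d x - F i' d x')"
    using x unfolding G_def u by auto
  obtain y' where y': "pt i y" "blk (K i) y = r" "d \<in> A i y" "pt i' y'" "blk (K i') y' = r'"
      "e \<in> A i' y'" "\<bar>F i e y - F i' e y'\<bar> \<le> (if s then F i' d y' - F i d y else F i d y - F i' d y')"
    using y unfolding G_def u by auto
  have dk: "d < k" "e < k" using stageD(4)[OF st] x' by blast+
  have ptz: "pt i z" by (rule pt_between[OF x'(1) y'(1) z])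
  have bz: "blk (K i) z = blk (K i) x"
    using blk_between[OF stageD(1)[OF st ptD[OF x'(1)]] _ z] x'(2) y'(2) by simp
  have Az: "A i z = A i x" using stageD(5)[OF st ptz x'(1) bz] .
  have str: "\<bar>F i d x - F i d y\<bar> = y - x"
    using stageD(6)[OF st x'(1) y'(1) _ x'(3)] x'(2) y'(2) z by simp
  have L: "\<bar>F i e x - F i e z\<bar> \<le> z - x" "\<bar>F i e z - F i e y\<bar> \<le> y - z"
    using lip_pt[OF x'(1) ptz dk(2)] lip_pt[OF ptz y'(1) dk(2)] z by linarith+
  note S = straight_between[OF str x'(1) y'(1) dk(1) z]
  have "\<bar>F i e z - F i' e x'\<bar> \<le> (if s then F i' d x' - F i d z else F i d z - F i' d x') \<or>
    \<bar>F i e z - F i' e y'\<bar> \<le> (if s then F i' d y' - F i d z else F i d z - F i' d y')"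
  proof (cases s)
    case True
    then have "\<bar>F i e x - F i' e x'\<bar> \<le> F i' d x' - F i d x" "\<bar>F i e y - F i' e y'\<bar> \<le> F i' d y' - F i d y"
      using x'(7) y'(7) by simp_all
    then have "\<bar>F i e z - F i' e x'\<bar> \<le> F i' d x' - F i d z \<or> \<bar>F i e z - F i' e y'\<bar> \<le> F i' d y' - F i d z"
      using S L by linarith
    then show ?thesis using True by simp
  next
    case False
    then have "\<bar>F i e x - F i' e x'\<bar> \<le> F i d x - F i' d x'" "\<bar>F i e y - F i' e y'\<bar> \<le> F i d y - F i' d y'"
      using x'(7) y'(7) by simp_all
    then have "\<bar>F i e z - F i' e x'\<bar> \<le> F i d z - F i' d x' \<or> \<bar>F i e z - F i' e y'\<bar> \<le> F i d z - F i' d y'"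
      using S L by linarith
    then show ?thesis using False by simp
  qed
  then show ?thesis unfolding G_def u using ptz bz x'(2,3) Az x'(4-6) y'(4-6) by auto
qed

text \<open>Separation by a line of slope 1 or -1. It will be demanded for ends of pieces only, as
  sum and difference of the two levels take their extreme values on a rectangle with diagonal sides
  at these corners.\<close>

definition apart :: "nat \<Rightarrow> int set \<Rightarrow> nat \<Rightarrow> int set \<Rightarrow> nat \<Rightarrow> nat \<Rightarrow> bool" where
  "apart i X i' Y d e \<longleftrightarrow>
     (\<forall>x\<in>X. \<forall>y\<in>Y. F i d x + F i e x < F i' d y + F i' e y) \<or>
     (\<forall>x\<in>X. \<forall>y\<in>Y. F i' d y + F i' e y < F i d x + F i e x) \<or>
     (\<forall>x\<in>X. \<forall>y\<in>Y. F i d x - F i e x < F i' d y - F i' e y) \<or>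
     (\<forall>x\<in>X. \<forall>y\<in>Y. F i' d y - F i' e y < F i d x - F i e x)"

text \<open>The solution of the recursion from \<open>\<kappa>\<close> to
  \<open>5 * k * k * l * (\<kappa> * \<kappa>)\<close> with initial value 1.\<close>

lemma stages:
  assumes "0 < l" "0 < k"
  shows "\<exists>K A. stage j ((5 * k * k * l) ^ (2 ^ j - 1)) K A"
proof (induction j)
  case 0
  show ?case using stage_0 by auto
next
  case (Suc j)
  let ?g = "5 * k * k * l"
  have "?g * (?g ^ (2 ^ j - 1) * ?g ^ (2 ^ j - 1)) = ?g ^ Suc ((2 ^ j - 1) + (2 ^ j - 1))"
    by (simp only: power_Suc power_add)
  also have "Suc ((2 ^ j - 1) + (2 ^ j - 1)) = 2 ^ Suc j - (1::nat)"
    using one_le_power[of "2::nat" j] unfolding power_Suc by linarith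
  finally show ?case using Suc stage_Suc[OF _ assms] by metis
qed

text \<open>At stage \<open>k - 1\<close> two blocks with different colour sets must be separated:
  more than \<open>k - 1\<close> colours means all of them, and then the sets would be equal.
  Cutting at the ends of the sets \<open>G\<close> then establishes the uniformity that
  \<open>curves_separated\<close> asks for.\<close>

lemma separated_blocks:
  assumes l: "0 < l" and k: "0 < k"
  shows "\<exists>K lab. (\<forall>i<l. finite (K i) \<and> card (K i) < (5 * k * k * l) ^ (2 ^ k)) \<and>
    (\<forall>i h. pt i h \<longrightarrow> lab i h < k) \<and>
    (\<forall>i h h'. pt i h \<longrightarrow> pt i h' \<longrightarrow> blk (K i) h = blk (K i) h' \<longrightarrow>
       lab i h = lab i h' \<and> \<bar>F i (lab i h) h - F i (lab i h) h'\<bar> = \<bar>h - h'\<bar>) \<and>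
    (\<forall>i i' x y x' y'. pt i x \<longrightarrow> pt i y \<longrightarrow> blk (K i) x = blk (K i) y \<longrightarrow>
       pt i' x' \<longrightarrow> pt i' y' \<longrightarrow> blk (K i') x' = blk (K i') y' \<longrightarrow> lab i x \<noteq> lab i' x' \<longrightarrow>
       (\<exists>d<k. \<exists>e<k. \<bar>F i d x - F i d y\<bar> = \<bar>x - y\<bar> \<and> \<bar>F i' e x' - F i' e y'\<bar> = \<bar>x' - y'\<bar> \<and>
          apart i {x, y} i' {x', y'} d e))"
proof -
  define \<kappa> where "\<kappa> = (5 * k * k * l) ^ (2 ^ (k - 1) - 1)"
  obtain K A where st: "stage (k - 1) \<kappa> K A"
    using stages[OF l k] unfolding \<kappa>_def by blast
  let ?X = "idx \<kappa> \<times> (UNIV :: bool set)"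
  note fin = stageD(1)[OF st]
  have blk\<kappa>: "blk (K i) h < \<kappa>" if "i < l" for i h
    using blk_le_card[OF fin[OF that], of h] stageD(2)[OF st that] by linarith
  define P where "P i K' \<longleftrightarrow> K i \<subseteq> K' \<and> finite K' \<and> card K' \<le> card (K i) + 2 * card ?X \<and>
     (\<forall>h h' x. blk K' h = blk K' h' \<longrightarrow> x \<in> ?X \<longrightarrow> (h \<in> G K A i x \<longleftrightarrow> h' \<in> G K A i x))" for i K'
  have "\<exists>K'. P i K'" if "i < l" for i
    unfolding P_def
  proof (rule refine_cuts[OF fin[OF that]])
    show "G K A i x \<subseteq> {a i..b i}" for x unfolding G_def pt_def by auto
    show "finite ?X" by (intro finite_cartesian_product finite_lessThan finite_UNIV)
  qed (rule G_convex[OF st])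
  then have "\<forall>i\<in>{..<l}. \<exists>K'. P i K'" by blast
  from bchoice[OF this] obtain K' where P: "\<forall>i\<in>{..<l}. P i (K' i)" by blast
  have K': "\<And>i. i < l \<Longrightarrow> K i \<subseteq> K' i" "\<And>i. i < l \<Longrightarrow> finite (K' i)"
    "\<And>i. i < l \<Longrightarrow> card (K' i) \<le> card (K i) + 2 * card ?X"
    "\<And>i h h' x. i < l \<Longrightarrow> blk (K' i) h = blk (K' i) h' \<Longrightarrow> x \<in> ?X \<Longrightarrow> h \<in> G K A i x \<longleftrightarrow> h' \<in> G K A i x"
    using P unfolding P_def by blast+
  have sub: "blk (K i) h = blk (K i) h'" if "i < l" "blk (K' i) h = blk (K' i) h'" for i h h'
    using blk_subset[OF K'(2)[OF that(1)] K'(1)[OF that(1)] that(2)] .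
  have Aeq: "A i h = A i x" if "pt i h" "pt i x" "blk (K' i) h = blk (K' i) x" for i h x
    using stageD(5)[OF st that(1,2) sub[OF ptD[OF that(1)] that(3)]] .
  \<comment> \<open>Any choice that depends on the colour set alone would serve. What matters is
    that different labels come from different sets.\<close>
  define lab where "lab i h = Min (A i h)" for i h
  have labA: "lab i h \<in> A i h" if "pt i h" for i h
    unfolding lab_def using stageD(3,4)[OF st that] by (metis Min_in empty_iff finite_lessThan finite_subset)
  have alt: "sep K A i h i' h'" if p: "pt i h" "pt i' h'" and ne: "A i h \<noteq> A i' h'" for i h i' h'
  proof (rule ccontr)
    assume "\<not> ?thesis"
    then have c: "k \<le> card (A i h)" "k \<le> card (A i' h')" using stageD(7)[OF st p] ne by auto
    have "A i h = {..<k}" "A i' h' = {..<k}"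
      using card_seteq[OF _ stageD(4)[OF st p(1)]] card_seteq[OF _ stageD(4)[OF st p(2)]] c by simp_all
    then show False using ne by simp
  qed
  have cardK': "card (K' i) < (5 * k * k * l) ^ (2 ^ k)" if "i < l" for i
  proof -
    have \<kappa>: "0 < \<kappa>" using stageD(2)[OF st that] by linarith
    define X where "X = k * k * l * (\<kappa> * \<kappa>)"
    have kl: "1 \<le> k * k * l" using k l by (simp add: Suc_leI)
    then have "\<kappa> * \<kappa> \<le> X" unfolding X_def by (metis mult.left_neutral mult_le_mono1)
    moreover have "\<kappa> \<le> \<kappa> * \<kappa>" using \<kappa> by simp
    moreover have "card ?X = 2 * X" unfolding card_cartesian_product[of _ UNIV] card_idx card_UNIV_bool
      by (simp add: X_def algebra_simps)
    \<comment> \<open>The Boolean doubles the index set, and two cuts per index give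
      \<open>\<kappa> + 4 * X \<le> 5 * X\<close>. This is the origin of the factor 5.\<close>
    ultimately have "card (K' i) < 5 * X" using K'(3)[OF that] stageD(2)[OF st that] \<kappa> by linarith
    also have "5 * X = 5 * k * k * l * (\<kappa> * \<kappa>)" by (simp add: X_def algebra_simps)
    also have "\<dots> = (5 * k * k * l) ^ Suc ((2 ^ (k - 1) - 1) + (2 ^ (k - 1) - 1))"
      unfolding \<kappa>_def by (simp only: power_Suc power_add)
    also have "Suc ((2 ^ (k - 1) - 1) + (2 ^ (k - 1) - 1)) = 2 ^ Suc (k - 1) - (1::nat)"
      using one_le_power[of "2::nat" "k - 1"] unfolding power_Suc by linarith
    also have "(5 * k * k * l) ^ (2 ^ Suc (k - 1) - 1) \<le> (5 * k * k * l) ^ (2 ^ k)"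
      using kl k by (intro power_increasing) auto
    finally show ?thesis .
  qed
  have final: "\<exists>d<k. \<exists>e<k. \<bar>F i d x - F i d y\<bar> = \<bar>x - y\<bar> \<and> \<bar>F i' e x' - F i' e y'\<bar> = \<bar>x' - y'\<bar> \<and>
          apart i {x, y} i' {x', y'} d e"
    if p: "pt i x" "pt i y" "blk (K' i) x = blk (K' i) y"
      and p': "pt i' x'" "pt i' y'" "blk (K' i') x' = blk (K' i') y'" and ne: "lab i x \<noteq> lab i' x'"
    for i i' x y x' y'
  proof -
    note il = ptD[OF p(1)] ptD[OF p'(1)]
    have "A i x \<noteq> A i' x'" using ne unfolding lab_def by metis
    from alt[OF p(1) p'(1) this] obtain d e where de: "d \<in> A i x" "e \<in> A i' x'" "d \<noteq> e"
      and nc: "\<And>u v. pt i u \<Longrightarrow> pt i' v \<Longrightarrow> blk (K i) u = blk (K i) x \<Longrightarrow> blk (K i') v = blk (K i') x' \<Longrightarrow>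
        \<not> coin i u i' v d e"
      by (rule sepE) metis
    have dk: "d < k" "e < k" using stageD(4)[OF st] p(1) p'(1) de by blast+
    define C where "C u v \<longleftrightarrow> (\<exists>h. pt i h \<and> blk (K i) h = blk (K i) x \<and> u = F i d h \<and> v = F i e h)" for u v
    define D where "D u v \<longleftrightarrow> (\<exists>h. pt i' h \<and> blk (K i') h = blk (K i') x' \<and> v = F i' e h \<and> u = F i' d h)" for u v
    define C' where "C' u v \<longleftrightarrow> (\<exists>h. pt i h \<and> blk (K' i) h = blk (K' i) x \<and> u = F i d h \<and> v = F i e h)" for u v
    define D' where "D' u v \<longleftrightarrow> (\<exists>h. pt i' h \<and> blk (K' i') h = blk (K' i') x' \<and> v = F i' e h \<and> u = F i' d h)" for u v
    have C: "curve C" unfolding C_def using block_curve[OF st p(1) de(1) dk(2)] .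
    have D: "curve (\<lambda>v u. D u v)" unfolding D_def using block_curve[OF st p'(1) de(2) dk(1)] .
    have disj: "\<not> D u v" if "C u v" for u v
      using that nc unfolding C_def D_def coin_def by metis
    have C'C: "C u v" if "C' u v" for u v
      using that sub[OF il(1)] unfolding C_def C'_def by metis
    have D'D: "D u v" if "D' u v" for u v
      using that sub[OF il(2)] unfolding D_def D'_def by metis
    define uC where "uC s = ((blk (K i) x, i', blk (K i') x', d, e), s)" for s :: bool
    define uD where "uD s = ((blk (K i') x', i, blk (K i) x, e, d), s)" for s :: bool
    have uCX: "uC s \<in> ?X" and uDX: "uD s \<in> ?X" for s
      unfolding uC_def uD_def using blk\<kappa> il dk by auto
    have A1: "d \<in> A i h" if "pt i h" "blk (K i) h = blk (K i) x" for h
      using stageD(5)[OF st that(1) p(1) that(2)] de by simp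
    have A2: "e \<in> A i' h" if "pt i' h" "blk (K i') h = blk (K i') x'" for h
      using stageD(5)[OF st that(1) p'(1) that(2)] de by simp
    have memC: "h \<in> G K A i (uC s) \<longleftrightarrow>
        (\<exists>u v. D u v \<and> \<bar>F i e h - v\<bar> \<le> (if s then u - F i d h else F i d h - u))"
      if "pt i h" "blk (K i) h = blk (K i) x" for h s
      using that A1[OF that] A2 unfolding G_def uC_def D_def by auto
    have memD: "h \<in> G K A i' (uD s) \<longleftrightarrow>
        (\<exists>u v. C u v \<and> \<bar>F i' d h - u\<bar> \<le> (if s then v - F i' e h else F i' e h - v))"
      if "pt i' h" "blk (K i') h = blk (K i') x'" for h s
      using that A2[OF that] A1 unfolding G_def uD_def C_def by auto
    have unC: "\<exists>x1 y1. D x1 y1 \<and> \<bar>v2 - y1\<bar> \<le> (if s then x1 - u2 else u2 - x1)"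
      if m1: "C' u v" and m2: "C' u2 v2" and m3: "\<exists>x1 y1. D x1 y1 \<and> \<bar>v - y1\<bar> \<le> (if s then x1 - u else u - x1)" for u v u2 v2 s
    proof -
      obtain h where h: "pt i h" "blk (K' i) h = blk (K' i) x" "u = F i d h" "v = F i e h"
        using m1 unfolding C'_def by blast
      obtain g where g: "pt i g" "blk (K' i) g = blk (K' i) x" "u2 = F i d g" "v2 = F i e g"
        using m2 unfolding C'_def by blast
      have "h \<in> G K A i (uC s)" using memC[OF h(1) sub[OF il(1) h(2)]] m3 h by blast
      then have "g \<in> G K A i (uC s)" using K'(4)[OF il(1) _ uCX] h(2) g(2) by metis
      then show ?thesis using memC[OF g(1) sub[OF il(1) g(2)]] g by blast
    qed
    have unD: "\<exists>x1 y1. C x1 y1 \<and> \<bar>u2 - x1\<bar> \<le> (if s then y1 - v2 else v2 - y1)"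
      if m1: "D' u v" and m2: "D' u2 v2" and m3: "\<exists>x1 y1. C x1 y1 \<and> \<bar>u - x1\<bar> \<le> (if s then y1 - v else v - y1)" for u v u2 v2 s
    proof -
      obtain h where h: "pt i' h" "blk (K' i') h = blk (K' i') x'" "u = F i' d h" "v = F i' e h"
        using m1 unfolding D'_def by blast
      obtain g where g: "pt i' g" "blk (K' i') g = blk (K' i') x'" "u2 = F i' d g" "v2 = F i' e g"
        using m2 unfolding D'_def by blast
      have "h \<in> G K A i' (uD s)" using memD[OF h(1) sub[OF il(2) h(2)]] m3 h by blast
      then have "g \<in> G K A i' (uD s)" using K'(4)[OF il(2) _ uDX] h(2) g(2) by metis
      then show ?thesis using memD[OF g(1) sub[OF il(2) g(2)]] g by blast
    qed
    have sepd: "(\<forall>x y x' y'. C' x y \<longrightarrow> D' x' y' \<longrightarrow> x + y < x' + y') \<or>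
         (\<forall>x y x' y'. C' x y \<longrightarrow> D' x' y' \<longrightarrow> x' + y' < x + y) \<or>
         (\<forall>x y x' y'. C' x y \<longrightarrow> D' x' y' \<longrightarrow> x - y < x' - y') \<or>
         (\<forall>x y x' y'. C' x y \<longrightarrow> D' x' y' \<longrightarrow> x' - y' < x - y)"
      by (rule curves_separated[of C D C' D', OF C D disj C'C D'D
            unC[where s = True, unfolded if_True] unC[where s = False, unfolded if_False]
            unD[where s = True, unfolded if_True] unD[where s = False, unfolded if_False]])
    have CC: "C' (F i d h) (F i e h)" if "h \<in> {x, y}" for h
      using that p unfolding C'_def by (metis insertE singletonD)
    have DD: "D' (F i' d h) (F i' e h)" if "h \<in> {x', y'}" for h
      using that p' unfolding D'_def by (metis insertE singletonD)
    have "apart i {x, y} i' {x', y'} d e"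
      unfolding apart_def
      by (insert sepd, elim disjE)
        (rule disjI1, use CC DD in blast, rule disjI2, rule disjI1, use CC DD in blast,
          rule disjI2, rule disjI2, rule disjI1, use CC DD in blast,
          rule disjI2, rule disjI2, rule disjI2, use CC DD in blast)
    moreover have "\<bar>F i d x - F i d y\<bar> = \<bar>x - y\<bar>" "\<bar>F i' e x' - F i' e y'\<bar> = \<bar>x' - y'\<bar>"
      using stageD(6)[OF st p(1,2) sub[OF il(1) p(3)] de(1)]
        stageD(6)[OF st p'(1,2) sub[OF il(2) p'(3)] de(2)] .
    ultimately show ?thesis using dk by blast
  qed
  have labk: "lab i h < k" if "pt i h" for i h using labA[OF that] stageD(4)[OF st that] by blast
  have labeq: "lab i h = lab i h' \<and> \<bar>F i (lab i h) h - F i (lab i h) h'\<bar> = \<bar>h - h'\<bar>"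
    if "pt i h" "pt i h'" "blk (K' i) h = blk (K' i) h'" for i h h'
    using Aeq[OF that] stageD(6)[OF st that(1,2) sub[OF ptD[OF that(1)] that(3)] labA[OF that(1)]]
    unfolding lab_def by simp
  show ?thesis
    by (rule exI[of _ K'], rule exI[of _ lab], intro conjI allI impI)
      (use cardK' K'(2) in blast, use cardK' in blast, rule labk, assumption,
        use labeq in blast, use labeq in blast, rule final)
qed

end

section \<open>Certificates\<close>

text \<open>For each cut \<open>y\<close> the sequence goes to \<open>y - 1\<close>, still in the
  old block, and then by a unit step to \<open>y\<close>. This makes two steps per cut; surplus
  steps stay at \<open>q\<close>. Unit steps across a cut are harmless because the corresponding
  pieces have no interior vertex.\<close>

lemma cut_sequence:
  assumes K: "finite K" and "card {y \<in> K. p < y \<and> y \<le> q} < \<kappa>" and "p \<le> q"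
  shows "\<exists>x :: nat \<Rightarrow> int. x 0 = p \<and> x (2 * \<kappa>) = q \<and>
    (\<forall>j<2 * \<kappa>. x j \<le> x (Suc j) \<and> (x (Suc j) \<le> x j + 1 \<or> blk K (x j) = blk K (x (Suc j))))"
  using assms(2,3)
proof (induction \<kappa> arbitrary: p)
  case (Suc \<kappa>)
  let ?Y = "{y \<in> K. p < y \<and> y \<le> q}"
  have fin: "finite ?Y" using K by simp
  show ?case
  proof (cases "?Y = {}")
    case True
    have "x \<le> p \<longleftrightarrow> x \<le> q" if "x \<in> K" for x using True that Suc.prems(2) by force
    then have eq: "blk K p = blk K q" unfolding blk_eq_iff[OF K] by blast
    show ?thesis
      by (rule exI[of _ "\<lambda>j. if j = 0 then p else q"]) (use Suc.prems(2) eq in simp)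
  next
    case False
    define y where "y = Min ?Y"
    have y: "y \<in> ?Y" unfolding y_def using Min_in[OF fin False] .
    have min: "y \<le> z" if "z \<in> ?Y" for z unfolding y_def using Min_le[OF fin that] .
    have "{z \<in> K. y < z \<and> z \<le> q} \<subset> ?Y" using y by auto
    then have "card {z \<in> K. y < z \<and> z \<le> q} < \<kappa>"
      using psubset_card_mono[OF fin] Suc.prems(1) by (meson less_trans_Suc not_less_eq order_less_le_trans less_Suc_eq_le)
    from Suc.IH[OF this] y obtain x' :: "nat \<Rightarrow> int" where x': "x' 0 = y" "x' (2 * \<kappa>) = q"
      "\<And>j. j < 2 * \<kappa> \<Longrightarrow> x' j \<le> x' (Suc j) \<and> (x' (Suc j) \<le> x' j + 1 \<or> blk K (x' j) = blk K (x' (Suc j)))"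
      by auto
    have "x \<le> p \<longleftrightarrow> x \<le> y - 1" if "x \<in> K" for x
      using min[of x] that y by fastforce
    then have eq: "blk K p = blk K (y - 1)" unfolding blk_eq_iff[OF K] by blast
    define x where "x j = (if j = 0 then p else if j = 1 then y - 1 else x' (j - 2))" for j
    have "x j \<le> x (Suc j) \<and> (x (Suc j) \<le> x j + 1 \<or> blk K (x j) = blk K (x (Suc j)))"
      if j: "j < 2 * Suc \<kappa>" for j
    proof -
      consider "j = 0" | "j = 1" | i where "j = Suc (Suc i)" "i < 2 * \<kappa>"
        using j by (metis One_nat_def add_2_eq_Suc' add_less_cancel_right mult_Suc_right not0_implies_Suc add.commute)
      then show ?thesis
      proof cases
        case 1 then show ?thesis using y eq by (simp add: x_def)
      next
        case 2 then show ?thesis using x'(1) by (simp add: x_def)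
      next
        case 3 then show ?thesis using x'(3) by (simp add: x_def)
      qed
    qed
    then show ?thesis by (intro exI[of _ x]) (simp add: x_def x'(2))
  qed
qed simp

text \<open>One of the two truncated differences is zero. In this form the machine can evaluate the
  distance.\<close>

definition absd :: "nat \<Rightarrow> nat \<Rightarrow> nat" where
  "absd x y = (x - y) + (y - x)"

lemma int_absd: "int (absd x y) = \<bar>int x - int y\<bar>"
  unfolding absd_def by linarith

definition between :: "nat \<Rightarrow> nat \<Rightarrow> nat \<Rightarrow> bool" where
  "between h x y \<longleftrightarrow> x < h \<and> h < y \<or> y < h \<and> h < x"

text \<open>Tells whether a piece with label levels \<open>x\<close> and \<open>y\<close> moves
  during the time step from \<open>h\<close> to \<open>Suc h\<close>. Both orders occur, since a
  path may descend in the partition of a label.\<close>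

definition active :: "nat \<Rightarrow> nat \<Rightarrow> nat \<Rightarrow> bool" where
  "active h x y \<longleftrightarrow> x \<le> h \<and> h < y \<or> y \<le> h \<and> h < x"

locale certificate =
  fixes n k l w :: nat and ph :: "nat \<Rightarrow> nat \<Rightarrow> nat" and ad :: "nat \<Rightarrow> nat \<Rightarrow> bool"
    and s t c :: "nat \<Rightarrow> nat"
begin

text \<open>
  The pieces \<open>i * w, \<dots>, i * w + (w - 1)\<close> make up path \<open>i\<close>. Piece \<open>q\<close> has the ends \<open>S z q\<close> and \<open>E z q\<close> and
  the label \<open>L z q\<close>, and \<open>Z z q\<close> is the current vertex on its route. All of them are entries of one
  sequence \<open>z\<close>, the digits of a configuration in base \<open>n + k + 2\<close>.
\<close>

definition S :: "(nat \<Rightarrow> nat) \<Rightarrow> nat \<Rightarrow> nat" where "S z q = z q"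
definition E :: "(nat \<Rightarrow> nat) \<Rightarrow> nat \<Rightarrow> nat" where "E z q = z (l * w + q)"
definition L :: "(nat \<Rightarrow> nat) \<Rightarrow> nat \<Rightarrow> nat" where "L z q = z (l * w + (l * w + q))"
definition Z :: "(nat \<Rightarrow> nat) \<Rightarrow> nat \<Rightarrow> nat" where "Z z q = z (l * w + (l * w + (l * w + q)))"

text \<open>The vertices that unit speed from both ends permits, so every route of the own colour
  stays inside. If level \<open>d\<close> is straight on the piece, the image in a plane of
  \<open>d\<close> and \<open>e\<close> lies in the rectangle with diagonal sides spanned by the
  ends.\<close>

definition diamond :: "(nat \<Rightarrow> nat) \<Rightarrow> nat \<Rightarrow> nat \<Rightarrow> bool" where
  "diamond z q v \<longleftrightarrow>
     ph (c (q div w)) (S z q) < ph (c (q div w)) v \<and> ph (c (q div w)) v < ph (c (q div w)) (E z q) \<and>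
     (\<forall>d<k. absd (ph d v) (ph d (S z q)) \<le> ph (c (q div w)) v - ph (c (q div w)) (S z q) \<and>
        absd (ph d (E z q)) (ph d v) \<le> ph (c (q div w)) (E z q) - ph (c (q div w)) v)"

text \<open>The own level and the level of the label change equally between the ends. Hence a path
  of the own colour and a route along the levels of the label between these ends are the same thing,
  up to direction.\<close>

definition piece_ok :: "(nat \<Rightarrow> nat) \<Rightarrow> nat \<Rightarrow> bool" where
  "piece_ok z q \<longleftrightarrow> S z q < n \<and> E z q < n \<and> L z q < k \<and>
     ph (c (q div w)) (S z q) \<le> ph (c (q div w)) (E z q) \<and>
     absd (ph (L z q) (E z q)) (ph (L z q) (S z q)) = ph (c (q div w)) (E z q) - ph (c (q div w)) (S z q) \<and>
     (q mod w + 1 < w \<longrightarrow> E z q = S z (q + 1))"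

text \<open>Imposed on all ordered pairs. By symmetry, a cut vertex shared by two paths is therefore
  a terminal of both, which internal disjointness allows.\<close>

definition pair_ok :: "(nat \<Rightarrow> nat) \<Rightarrow> nat \<Rightarrow> nat \<Rightarrow> bool" where
  "pair_ok z q q' \<longleftrightarrow>
     (q div w = q' div w \<and> q mod w = 0 \<and> q' mod w + 1 = w \<longrightarrow>
        S z q = s (q div w) \<and> E z q' = t (q div w) \<or> S z q = t (q div w) \<and> E z q' = s (q div w)) \<and>
     (q div w \<noteq> q' div w \<longrightarrow>
        (\<forall>v<n. (v = S z q \<or> v = E z q) \<and> (v = S z q' \<or> v = E z q') \<longrightarrow> v = s (q div w) \<or> v = t (q div w))) \<and>
     (L z q \<noteq> L z q' \<longrightarrow> (\<forall>v<n. \<not> (diamond z q v \<and> diamond z q' v)))"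

text \<open>All routes are swept upwards in the level of their label. A piece thus starts at its
  lower end, which is \<open>E\<close> if the path descends there.\<close>

definition init :: "(nat \<Rightarrow> nat) \<Rightarrow> bool" where
  "init z \<longleftrightarrow> (\<forall>q<l * w. piece_ok z q \<and> (\<forall>q'<l * w. pair_ok z q q') \<and>
     Z z q = (if ph (L z q) (S z q) \<le> ph (L z q) (E z q) then S z q else E z q))"

definition acc :: "(nat \<Rightarrow> nat) \<Rightarrow> bool" where
  "acc z \<longleftrightarrow> (\<forall>q<l * w.
     Z z q = (if ph (L z q) (S z q) \<le> ph (L z q) (E z q) then E z q else S z q))"

text \<open>A route with label \<open>a\<close> visits a vertex at the time given by the level of
  that vertex in partition \<open>a\<close>. Two routes with the same label can therefore share a
  vertex only at the same time, and comparing current positions suffices. No record of earlier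
  positions is kept, which is what bounds the size of a configuration.\<close>

definition step :: "nat \<Rightarrow> (nat \<Rightarrow> nat) \<Rightarrow> (nat \<Rightarrow> nat) \<Rightarrow> bool" where
  "step h z z' \<longleftrightarrow> (\<forall>q<l * w. S z' q = S z q \<and> E z' q = E z q \<and> L z' q = L z q \<and> Z z' q < n \<and>
     (if active h (ph (L z q) (S z q)) (ph (L z q) (E z q))
      then ad (Z z q) (Z z' q) \<and> ph (L z q) (Z z' q) = Suc h else Z z' q = Z z q) \<and>
     (between (Suc h) (ph (L z q) (S z q)) (ph (L z q) (E z q)) \<longrightarrow>
        (\<forall>q'<l * w. Z z' q \<noteq> S z q' \<and> Z z' q \<noteq> E z q' \<and>
           (q \<noteq> q' \<and> L z q = L z q' \<and> between (Suc h) (ph (L z q') (S z q')) (ph (L z q') (E z q')) \<longrightarrow>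
              Z z' q \<noteq> Z z' q'))))"

text \<open>All levels are below \<open>n\<close>, so every route has ended after \<open>n\<close>
  steps.\<close>

definition certified :: bool where
  "certified \<longleftrightarrow> (\<exists>zs. init (zs 0) \<and> (\<forall>h<n. step h (zs h) (zs (Suc h))) \<and> acc (zs n))"

text \<open>
  A path of colour \<open>col\<close>, parametrised by its level in partition \<open>col\<close>.
\<close>

definition lpath :: "nat \<Rightarrow> nat \<Rightarrow> nat \<Rightarrow> (nat \<Rightarrow> nat) \<Rightarrow> bool" where
  "lpath col x y p \<longleftrightarrow> ph col x \<le> ph col y \<and> p (ph col x) = x \<and> p (ph col y) = y \<and>
     (\<forall>h. ph col x \<le> h \<longrightarrow> h \<le> ph col y \<longrightarrow> p h < n \<and> ph col (p h) = h) \<and>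
     (\<forall>h. ph col x \<le> h \<longrightarrow> h < ph col y \<longrightarrow> ad (p h) (p (Suc h)))"

definition solution :: "(nat \<Rightarrow> nat) \<Rightarrow> (nat \<Rightarrow> nat) \<Rightarrow> (nat \<Rightarrow> nat \<Rightarrow> nat) \<Rightarrow> bool" where
  "solution \<sigma> \<tau> \<pi> \<longleftrightarrow>
     (\<forall>i<l. (\<sigma> i = s i \<and> \<tau> i = t i \<or> \<sigma> i = t i \<and> \<tau> i = s i) \<and> lpath (c i) (\<sigma> i) (\<tau> i) (\<pi> i)) \<and>
     (\<forall>i<l. \<forall>j<l. i \<noteq> j \<longrightarrow> (\<forall>h h'. ph (c i) (\<sigma> i) < h \<longrightarrow> h < ph (c i) (\<tau> i) \<longrightarrow>
        ph (c j) (\<sigma> j) \<le> h' \<longrightarrow> h' \<le> ph (c j) (\<tau> j) \<longrightarrow> \<pi> i h \<noteq> \<pi> j h'))"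

lemma lpathD:
  assumes "lpath col x y p"
  shows "ph col x \<le> ph col y" "p (ph col x) = x" "p (ph col y) = y"
    "ph col x \<le> h \<Longrightarrow> h \<le> ph col y \<Longrightarrow> p h < n" "ph col x \<le> h \<Longrightarrow> h \<le> ph col y \<Longrightarrow> ph col (p h) = h"
    "ph col x \<le> h \<Longrightarrow> h < ph col y \<Longrightarrow> ad (p h) (p (Suc h))"
  using assms unfolding lpath_def by blast+

lemma lpath_append:
  assumes p: "lpath col x y p" and r: "lpath col y z r"
  shows "lpath col x z (\<lambda>h. if h \<le> ph col y then p h else r h)"
proof -
  let ?f = "\<lambda>h. if h \<le> ph col y then p h else r h"
  have 1: "?f h < n \<and> ph col (?f h) = h" if "ph col x \<le> h" "h \<le> ph col z" for h
    using lpathD(4,5)[OF p that(1)] lpathD(4,5)[OF r _ that(2)] by simp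
  have 2: "ad (?f h) (?f (Suc h))" if h: "ph col x \<le> h" "h < ph col z" for h
  proof -
    consider "h < ph col y" | "h = ph col y" | "ph col y < h" by linarith
    then show ?thesis
    proof cases
      case 1 then show ?thesis using lpathD(6)[OF p h(1)] by simp
    next
      case 2 then show ?thesis using lpathD(6)[OF r _ h(2)] lpathD(2)[OF r] lpathD(3)[OF p] by simp
    next
      case 3 then show ?thesis using lpathD(6)[OF r _ h(2)] by simp
    qed
  qed
  have 3: "?f (ph col z) = z"
  proof (cases "ph col z \<le> ph col y")
    case True
    then have "ph col z = ph col y" using lpathD(1)[OF r] by simp
    then show ?thesis using lpathD(3)[OF p] lpathD(2,3)[OF r] by simp
  qed (use lpathD(3)[OF r] in simp)
  have 4: "ph col x \<le> ph col z" using lpathD(1)[OF p] lpathD(1)[OF r] by simp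
  have 5: "?f (ph col x) = x" using lpathD(1,2)[OF p] by simp
  show ?thesis unfolding lpath_def
    by (intro conjI allI impI) (rule 4, rule 5, rule 3, use 1 in blast, use 1 in blast, rule 2)
qed

end

locale level_graph = certificate +
  assumes ad_sym: "u < n \<Longrightarrow> v < n \<Longrightarrow> ad u v \<Longrightarrow> ad v u"
    and ad_lip: "u < n \<Longrightarrow> v < n \<Longrightarrow> d < k \<Longrightarrow> ad u v \<Longrightarrow> absd (ph d u) (ph d v) \<le> 1"
    and ph_less: "v < n \<Longrightarrow> d < k \<Longrightarrow> ph d v < n"
    and c_less: "i < l \<Longrightarrow> c i < k"
    and st_less: "i < l \<Longrightarrow> s i < n" "i < l \<Longrightarrow> t i < n"
begin

lemma walk_lip:
  assumes v: "\<And>j. j \<le> D \<Longrightarrow> f j < n" and a: "\<And>j. j < D \<Longrightarrow> ad (f j) (f (Suc j))"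
    and d: "d < k" and ij: "i \<le> j" "j \<le> D"
  shows "absd (ph d (f i)) (ph d (f j)) \<le> j - i"
  using ij
proof (induction j)
  case (Suc j)
  show ?case
  proof (cases "i = Suc j")
    case False
    then have "absd (ph d (f i)) (ph d (f j)) \<le> j - i" using Suc by simp
    moreover have "absd (ph d (f j)) (ph d (f (Suc j))) \<le> 1"
      using ad_lip v a d Suc.prems by simp
    ultimately show ?thesis using False Suc.prems unfolding absd_def by linarith
  qed (simp add: absd_def)
qed (simp add: absd_def)

text \<open>Each edge changes level \<open>d\<close> by at most one, so a rise by \<open>D\<close>
  in \<open>D\<close> steps leaves room for nothing but a rise by one in every step.\<close>

lemma walk_lpath:
  assumes v: "\<And>j. j \<le> D \<Longrightarrow> f j < n" and a: "\<And>j. j < D \<Longrightarrow> ad (f j) (f (Suc j))"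
    and d: "d < k" and e: "f 0 = x" "f D = y" "ph d y = ph d x + D"
  shows "lpath d x y (\<lambda>h. f (h - ph d x))"
proof -
  have lev: "ph d (f j) = ph d x + j" if "j \<le> D" for j
    using walk_lip[of D f, OF v a d, of 0 j] walk_lip[of D f, OF v a d that order.refl] that e
    unfolding absd_def by simp
  show ?thesis unfolding lpath_def
    using lev v a e by (auto simp: Suc_diff_le)
qed

lemma lpath_lip:
  assumes p: "lpath col x y p" and d: "d < k" and h: "ph col x \<le> h" "h \<le> h'" "h' \<le> ph col y"
  shows "absd (ph d (p h)) (ph d (p h')) \<le> h' - h"
proof -
  define b where "b = ph col x"
  define D where "D = ph col y - b"
  have "absd (ph d (p (b + (h - b)))) (ph d (p (b + (h' - b)))) \<le> (h' - b) - (h - b)"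
    by (rule walk_lip[of D "\<lambda>j. p (b + j)"])
      (use lpathD[OF p] h d in \<open>auto simp: b_def D_def\<close>)
  then show ?thesis using h by (simp add: b_def)
qed

end

section \<open>Soundness of certificates\<close>

context level_graph
begin

text \<open>A piece rests outside the interval between its label levels. Its moves form a walk
  between its ends whose number of steps equals the difference of own levels, and
  \<open>walk_lpath\<close> turns this walk into a path of the own colour.\<close>

lemma certificate_pieces:
  assumes i0: "init (zs 0)" and st: "\<And>h. h < n \<Longrightarrow> step h (zs h) (zs (Suc h))" and ac: "acc (zs n)"
  shows "\<exists>\<rho>. \<forall>q<l * w. lpath (c (q div w)) (S (zs 0) q) (E (zs 0) q) (\<rho> q) \<and>
    (\<forall>h. ph (c (q div w)) (S (zs 0) q) < h \<longrightarrow> h < ph (c (q div w)) (E (zs 0) q) \<longrightarrow>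
      (\<forall>q'<l * w. \<rho> q h \<noteq> S (zs 0) q' \<and> \<rho> q h \<noteq> E (zs 0) q' \<and>
        (\<forall>h'. q \<noteq> q' \<longrightarrow> ph (c (q' div w)) (S (zs 0) q') < h' \<longrightarrow> h' < ph (c (q' div w)) (E (zs 0) q') \<longrightarrow>
            \<rho> q h \<noteq> \<rho> q' h')))"
proof -
  define Q where "Q = l * w"
  define z where "z = zs 0"
  define P where "P h q = Z (zs h) q" for h q
  define a where "a q = ph (L z q) (S z q)" for q
  define b where "b q = ph (L z q) (E z q)" for q
  define C where "C q = c (q div w)" for q
  have Cl: "C q < k" if "q < Q" for q
    unfolding C_def using that c_less[of "q div w"] unfolding Q_def
    by (metis less_mult_imp_div_less)
  have const: "S (zs h) q = S z q \<and> E (zs h) q = E z q \<and> L (zs h) q = L z q" if "h \<le> n" "q < Q" for h q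
    using that
  proof (induction h)
    case (Suc h)
    then show ?case using st[of h] unfolding step_def Q_def by simp
  qed (simp add: z_def)
  have ok: "S z q < n" "E z q < n" "L z q < k" "ph (C q) (S z q) \<le> ph (C q) (E z q)"
     "absd (b q) (a q) = ph (C q) (E z q) - ph (C q) (S z q)"
     "P 0 q = (if a q \<le> b q then S z q else E z q)" "pair_ok z q q'" if "q < Q" "q' < Q" for q q'
    using i0 that unfolding init_def piece_ok_def Q_def a_def b_def C_def z_def P_def by auto
  have ab: "a q < n" "b q < n" if "q < Q" for q
    unfolding a_def b_def using ph_less ok(1-3)[OF that that] by auto
  have PS': "\<forall>q<Q. P (Suc h) q < n \<and> (if active h (a q) (b q) then ad (P h q) (P (Suc h) q) \<and> ph (L z q) (P (Suc h) q) = Suc h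
      else P (Suc h) q = P h q) \<and> (between (Suc h) (a q) (b q) \<longrightarrow> (\<forall>q'<Q. P (Suc h) q \<noteq> S z q' \<and> P (Suc h) q \<noteq> E z q' \<and>
      (q \<noteq> q' \<and> L z q = L z q' \<and> between (Suc h) (a q') (b q') \<longrightarrow> P (Suc h) q \<noteq> P (Suc h) q')))"
    if h: "h < n" for h
  proof -
    have "S (zs h) q = S z q \<and> E (zs h) q = E z q \<and> L (zs h) q = L z q" if "q < Q" for q
      using const[of h q] h that by simp
    then show ?thesis
      using st[OF h] unfolding step_def P_def a_def b_def Q_def[symmetric] by (simp cong: if_cong) blast
  qed
  have PS: "P (Suc h) q < n"
    "active h (a q) (b q) \<Longrightarrow> ad (P h q) (P (Suc h) q) \<and> ph (L z q) (P (Suc h) q) = Suc h"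
    "\<not> active h (a q) (b q) \<Longrightarrow> P (Suc h) q = P h q"
    "between (Suc h) (a q) (b q) \<Longrightarrow> q' < Q \<Longrightarrow> P (Suc h) q \<noteq> S z q' \<and> P (Suc h) q \<noteq> E z q' \<and>
      (q \<noteq> q' \<and> L z q = L z q' \<and> between (Suc h) (a q') (b q') \<longrightarrow> P (Suc h) q \<noteq> P (Suc h) q')"
    if "h < n" "q < Q" for h q q'
    using PS'[OF that(1), rule_format, OF that(2)] by simp_all
  have Pn: "P n q = (if a q \<le> b q then E z q else S z q)" if "q < Q" for q
    using ac that const[of n q] unfolding acc_def P_def a_def b_def Q_def by simp
  have Pless: "P h q < n" if "h \<le> n" "q < Q" for h q
    using that PS(1)[of "h - 1" q] ok(1,2,6)[OF that(2) that(2)] by (cases h) auto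
  have before: "P h q = P 0 q" if "h \<le> min (a q) (b q)" "q < Q" for h q
    using that
  proof (induction h)
    case (Suc h)
    then have "\<not> active h (a q) (b q)" "h < n" using ab[OF Suc.prems(2)] by (auto simp: active_def)
    then show ?case using PS(3) Suc by simp
  qed simp
  have after: "P (max (a q) (b q) + j) q = P (max (a q) (b q)) q" if "max (a q) (b q) + j \<le> n" "q < Q" for j q
    using that
  proof (induction j)
    case (Suc j)
    then have "\<not> active (max (a q) (b q) + j) (a q) (b q)" by (auto simp: active_def)
    then show ?case using PS(3)[of "max (a q) (b q) + j" q] Suc by simp
  qed simp
  have Pmax: "P (max (a q) (b q)) q = P n q" if "q < Q" for q
    using after[of q "n - max (a q) (b q)"] ab[OF that] that by simp
  have Pmin: "P (min (a q) (b q)) q = P 0 q" if "q < Q" for q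
    using before[of _ q] that by blast
  have during: "ph (L z q) (P (min (a q) (b q) + j) q) = min (a q) (b q) + j"
    if "min (a q) (b q) + j \<le> max (a q) (b q)" "q < Q" for j q
    using that(1)
  proof (cases j)
    case 0
    then show ?thesis using Pmin[OF that(2)] ok(6)[OF that(2,2)] unfolding a_def b_def by (simp add: min_def)
  next
    case (Suc i)
    have "active (min (a q) (b q) + i) (a q) (b q)" using that(1) Suc by (auto simp: active_def min_def max_def split: if_splits)
    moreover have "min (a q) (b q) + i < n" using that ab[OF that(2)] Suc by simp
    ultimately show ?thesis using PS(2)[OF _ that(2)] Suc by simp
  qed
  define D where "D q = ph (C q) (E z q) - ph (C q) (S z q)" for q
  have Dab: "max (a q) (b q) = min (a q) (b q) + D q" if "q < Q" for q
    using ok(5)[OF that that] unfolding D_def absd_def by linarith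
  \<comment> \<open>The time at which the vertex number \<open>j\<close> of the piece, counted from
    \<open>S\<close>, is occupied. For a piece that descends in its label, time runs against the
    path.\<close>
  define T where "T q j = (if a q \<le> b q then a q + j else a q - j)" for q j
  define f where "f q j = P (T q j) q" for q j
  define \<rho> where "\<rho> q h = f q (h - ph (C q) (S z q))" for q h
  have Trange: "min (a q) (b q) \<le> T q j" "T q j \<le> max (a q) (b q)" "T q j \<le> n" if "q < Q" "j \<le> D q" for q j
    using Dab[OF that(1)] that ab[OF that(1)] unfolding T_def by (auto simp: min_def max_def split: if_splits)
  have levT: "ph (L z q) (f q j) = T q j" if "q < Q" "j \<le> D q" for q j
    using during[of q "T q j - min (a q) (b q)"] Trange[OF that] that unfolding f_def by simp
  have lp: "lpath (C q) (S z q) (E z q) (\<rho> q)" if q: "q < Q" for q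
    unfolding \<rho>_def
  proof (rule walk_lpath)
    show "f q j < n" if "j \<le> D q" for j
      unfolding f_def using Pless Trange[OF q that] q by blast
    show "C q < k" using Cl[OF q] .
    show "f q 0 = S z q"
      using Pmin[OF q] Pmax[OF q] Pn[OF q] ok(6)[OF q q] unfolding f_def T_def by (auto simp: min_def max_def split: if_splits)
    show "f q (D q) = E z q"
      using Pmin[OF q] Pmax[OF q] Pn[OF q] ok(6)[OF q q] Dab[OF q] unfolding f_def T_def by (auto simp: min_def max_def split: if_splits)
    show "ph (C q) (E z q) = ph (C q) (S z q) + D q" unfolding D_def using ok(4)[OF q q] by simp
    show "ad (f q j) (f q (Suc j))" if j: "j < D q" for j
    proof (cases "a q \<le> b q")
      case True
      have "active (a q + j) (a q) (b q)" "a q + j < n"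
        using j Dab[OF q] True ab[OF q] by (auto simp: active_def)
      then show ?thesis using PS(2)[OF _ q] True unfolding f_def T_def by simp
    next
      case False
      have 1: "active (a q - Suc j) (a q) (b q)" "a q - Suc j < n" "Suc (a q - Suc j) = a q - j"
        using j Dab[OF q] False ab[OF q] by (auto simp: active_def min_def max_def)
      then have "ad (P (a q - Suc j) q) (P (a q - j) q)" using PS(2)[OF 1(2) q 1(1)] 1(3) by simp
      moreover have "P (a q - Suc j) q < n" "P (a q - j) q < n" using Pless[of _ q] 1 q ab[OF q] by auto
      ultimately show ?thesis using ad_sym False unfolding f_def T_def by simp
    qed
  qed
  \<comment> \<open>The time is recorded as nonzero because \<open>step\<close> states its
    conditions at times of the form \<open>Suc h\<close>.\<close>
  have inner: "between (T q (h - ph (C q) (S z q))) (a q) (b q) \<and> ph (L z q) (\<rho> q h) = T q (h - ph (C q) (S z q))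
      \<and> \<rho> q h = P (T q (h - ph (C q) (S z q))) q \<and> T q (h - ph (C q) (S z q)) \<noteq> 0 \<and> T q (h - ph (C q) (S z q)) \<le> n"
    if q: "q < Q" and h: "ph (C q) (S z q) < h" "h < ph (C q) (E z q)" for q h
  proof -
    let ?j = "h - ph (C q) (S z q)"
    have j: "0 < ?j" "?j < D q" using h unfolding D_def by auto
    have "between (T q ?j) (a q) (b q)" using j Dab[OF q] unfolding between_def T_def
      by (auto simp: min_def max_def split: if_splits)
    then show ?thesis using levT[OF q less_imp_le[OF j(2)]] Trange(3)[OF q less_imp_le[OF j(2)]]
      unfolding \<rho>_def f_def by (auto simp: between_def)
  qed
  have cuts: "\<rho> q h \<noteq> S z q' \<and> \<rho> q h \<noteq> E z q'"
    if q: "q < Q" "q' < Q" and h: "ph (C q) (S z q) < h" "h < ph (C q) (E z q)" for q q' h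
  proof -
    obtain g where g: "T q (h - ph (C q) (S z q)) = Suc g" using inner[OF q(1) h] not0_implies_Suc by blast
    show ?thesis using PS(4)[of g q q'] inner[OF q(1) h] q unfolding g by auto
  qed
  have dia: "diamond z q (\<rho> q h)" if q: "q < Q" and h: "ph (C q) (S z q) < h" "h < ph (C q) (E z q)" for q h
  proof -
    have "absd (ph d (\<rho> q h)) (ph d (S z q)) \<le> h - ph (C q) (S z q)"
      "absd (ph d (E z q)) (ph d (\<rho> q h)) \<le> ph (C q) (E z q) - h" if "d < k" for d
      using lpath_lip[OF lp[OF q] that, of "ph (C q) (S z q)" h] lpath_lip[OF lp[OF q] that, of h "ph (C q) (E z q)"]
        h lpathD(2,3)[OF lp[OF q]] by (simp_all add: absd_def)
    moreover have "ph (C q) (\<rho> q h) = h" using lpathD(5)[OF lp[OF q]] h by simp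
    ultimately show ?thesis unfolding diamond_def C_def[symmetric] using h by simp
  qed
  \<comment> \<open>A common vertex lies in both diamonds, so the labels agree. Its level in the
    partition of that label is then the time of both visits, and meeting at one time is excluded by
    \<open>step\<close>.\<close>
  have disj: "\<rho> q h \<noteq> \<rho> q' h'"
    if q: "q < Q" "q' < Q" "q \<noteq> q'" and h: "ph (C q) (S z q) < h" "h < ph (C q) (E z q)"
      "ph (C q') (S z q') < h'" "h' < ph (C q') (E z q')" for q q' h h'
  proof
    assume eq: "\<rho> q h = \<rho> q' h'"
    have "\<rho> q h < n" using lpathD(4)[OF lp[OF q(1)]] h by simp
    then have Leq: "L z q = L z q'"
      using ok(7)[OF q(1,2)] dia[OF q(1) h(1,2)] dia[OF q(2) h(3,4)] eq unfolding pair_ok_def by metis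
    obtain g where g: "T q (h - ph (C q) (S z q)) = Suc g" using inner[OF q(1) h(1,2)] not0_implies_Suc by blast
    have g': "T q' (h' - ph (C q') (S z q')) = Suc g"
      using inner[OF q(1) h(1,2)] inner[OF q(2) h(3,4)] Leq eq g by metis
    show False
      using PS(4)[of g q q'] inner[OF q(1) h(1,2)] inner[OF q(2) h(3,4)] q Leq eq unfolding g g' by auto
  qed
  show ?thesis
    by (rule exI[of _ \<rho>], fold Q_def z_def C_def) (use lp cuts disj in blast)
qed

text \<open>The pieces of a path are concatenated, and every vertex of the result is a cut or
  interior to a piece. Interior vertices avoid all cuts and the interiors of other pieces, so paths
  can share only cuts, and these are terminals by \<open>pair_ok\<close>.\<close>

lemma certified_sound:
  assumes "certified" and w: "0 < l \<Longrightarrow> 0 < w"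
  shows "\<exists>\<sigma> \<tau> \<pi>. solution \<sigma> \<tau> \<pi>"
proof -
  from assms(1) obtain zs where i0: "init (zs 0)" and st: "\<And>h. h < n \<Longrightarrow> step h (zs h) (zs (Suc h))" and ac: "acc (zs n)"
    unfolding certified_def by blast
  define z where "z = zs 0"
  from certificate_pieces[OF i0 st ac] obtain \<rho> where
    lp: "\<And>q. q < l * w \<Longrightarrow> lpath (c (q div w)) (S z q) (E z q) (\<rho> q)" and
    cuts: "\<And>q q' h. q < l * w \<Longrightarrow> q' < l * w \<Longrightarrow> ph (c (q div w)) (S z q) < h \<Longrightarrow> h < ph (c (q div w)) (E z q) \<Longrightarrow>
      \<rho> q h \<noteq> S z q' \<and> \<rho> q h \<noteq> E z q'" and
    disj: "\<And>q q' h h'. q < l * w \<Longrightarrow> q' < l * w \<Longrightarrow> ph (c (q div w)) (S z q) < h \<Longrightarrow> h < ph (c (q div w)) (E z q) \<Longrightarrow>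
      q \<noteq> q' \<Longrightarrow> ph (c (q' div w)) (S z q') < h' \<Longrightarrow> h' < ph (c (q' div w)) (E z q') \<Longrightarrow> \<rho> q h \<noteq> \<rho> q' h'"
    unfolding z_def by blast
  define cut where "cut i v \<longleftrightarrow> (\<exists>q<l * w. q div w = i \<and> (v = S z q \<or> v = E z q))" for i v
  define inner where "inner i v \<longleftrightarrow> (\<exists>q<l * w. \<exists>h. q div w = i \<and> ph (c i) (S z q) < h \<and> h < ph (c i) (E z q) \<and> v = \<rho> q h)" for i v
  have idx: "i * w + j < l * w" "(i * w + j) div w = i" "(i * w + j) mod w = j" if "i < l" "j < w" for i j
  proof -
    have "i * w + j < Suc i * w" using that by simp
    also have "\<dots> \<le> l * w" using that by (intro mult_le_mono1) simp
    finally show "i * w + j < l * w" .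
  qed (use that in simp_all)
  have concat: "\<exists>p. lpath (c i) (S z (i * w)) (E z (i * w + j)) p \<and>
      (\<forall>h. ph (c i) (S z (i * w)) \<le> h \<longrightarrow> h \<le> ph (c i) (E z (i * w + j)) \<longrightarrow> cut i (p h) \<or> inner i (p h))"
    if i: "i < l" and "j < w" for i j
    using that(2)
  proof (induction j)
    case 0
    have q: "i * w < l * w" "i * w div w = i" using idx[OF i 0] by simp_all
    have l0: "lpath (c i) (S z (i * w)) (E z (i * w)) (\<rho> (i * w))" using lp[OF q(1)] q(2) by simp
    have "cut i (\<rho> (i * w) h) \<or> inner i (\<rho> (i * w) h)"
      if h: "ph (c i) (S z (i * w)) \<le> h" "h \<le> ph (c i) (E z (i * w))" for h
    proof -
      consider "h = ph (c i) (S z (i * w))" | "h = ph (c i) (E z (i * w))"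
        | "ph (c i) (S z (i * w)) < h" "h < ph (c i) (E z (i * w))" using h by linarith
      then show ?thesis
      proof cases
        case 1 then show ?thesis using lpathD(2)[OF l0] q unfolding cut_def by metis
      next
        case 2 then show ?thesis using lpathD(3)[OF l0] q unfolding cut_def by metis
      next
        case 3 then show ?thesis using q unfolding inner_def by blast
      qed
    qed
    then show ?case using l0 by auto
  next
    case (Suc j)
    let ?q = "i * w + j" and ?q' = "i * w + Suc j"
    have j: "j < w" using Suc by simp
    note q = idx[OF i j] and q' = idx[OF i Suc.prems]
    obtain p where p: "lpath (c i) (S z (i * w)) (E z ?q) p"
      "\<And>h. ph (c i) (S z (i * w)) \<le> h \<Longrightarrow> h \<le> ph (c i) (E z ?q) \<Longrightarrow> cut i (p h) \<or> inner i (p h)"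
      using Suc.IH[OF j] by blast
    have "piece_ok z ?q" using i0 q(1) unfolding init_def z_def by blast
    then have ES: "E z ?q = S z ?q'" using q(3) Suc.prems unfolding piece_ok_def by simp
    have r: "lpath (c i) (E z ?q) (E z ?q') (\<rho> ?q')" using lp[OF q'(1)] unfolding q'(2) ES .
    let ?f = "\<lambda>h. if h \<le> ph (c i) (E z ?q) then p h else \<rho> ?q' h"
    have "cut i (?f h) \<or> inner i (?f h)"
      if h: "ph (c i) (S z (i * w)) \<le> h" "h \<le> ph (c i) (E z ?q')" for h
    proof (cases "h \<le> ph (c i) (E z ?q)")
      case True
      then show ?thesis using p(2)[OF h(1)] by simp
    next
      case False
      show ?thesis
      proof (cases "h = ph (c i) (E z ?q')")
        case True
        then have "\<rho> ?q' h = E z ?q'" using lpathD(3)[OF r] by simp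
        then show ?thesis using False q' unfolding cut_def by auto
      next
        case F: False
        then have "ph (c i) (S z ?q') < h" "h < ph (c i) (E z ?q')" using False h ES by auto
        then have "inner i (\<rho> ?q' h)" unfolding inner_def using q' by blast
        then show ?thesis using False by simp
      qed
    qed
    then show ?case using lpath_append[OF p(1) r] by blast
  qed
  have "\<forall>i\<in>{..<l}. \<exists>p. lpath (c i) (S z (i * w)) (E z (i * w + (w - 1))) p \<and>
      (\<forall>h. ph (c i) (S z (i * w)) \<le> h \<longrightarrow> h \<le> ph (c i) (E z (i * w + (w - 1))) \<longrightarrow> cut i (p h) \<or> inner i (p h))"
    using concat w by auto
  from bchoice[OF this] obtain \<pi> where \<pi>: "\<And>i. i < l \<Longrightarrow> lpath (c i) (S z (i * w)) (E z (i * w + (w - 1))) (\<pi> i)"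
    "\<And>i h. i < l \<Longrightarrow> ph (c i) (S z (i * w)) \<le> h \<Longrightarrow> h \<le> ph (c i) (E z (i * w + (w - 1))) \<Longrightarrow> cut i (\<pi> i h) \<or> inner i (\<pi> i h)"
    by blast
  define \<sigma> where "\<sigma> i = S z (i * w)" for i
  define \<tau> where "\<tau> i = E z (i * w + (w - 1))" for i
  have pair: "pair_ok z q q'" if "q < l * w" "q' < l * w" for q q'
    using i0 that unfolding init_def z_def by blast
  have ends: "\<sigma> i = s i \<and> \<tau> i = t i \<or> \<sigma> i = t i \<and> \<tau> i = s i" if "i < l" for i
  proof -
    have w': "0 < w" "w - 1 < w" using w that by auto
    note A = idx[OF that w'(1)] and B = idx[OF that w'(2)]
    have w1: "w - 1 + 1 = w" using w' by simp
    have "pair_ok z (i * w) (i * w + (w - 1))" using pair A(1) B(1) by simp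
    then show ?thesis using A B w1 unfolding pair_ok_def \<sigma>_def \<tau>_def by simp
  qed
  have "\<pi> i h \<noteq> \<pi> j h'"
    if ij: "i < l" "j < l" "i \<noteq> j" and h: "ph (c i) (\<sigma> i) < h" "h < ph (c i) (\<tau> i)"
      "ph (c j) (\<sigma> j) \<le> h'" "h' \<le> ph (c j) (\<tau> j)" for i j h h'
  proof
    assume eq: "\<pi> i h = \<pi> j h'"
    let ?v = "\<pi> i h"
    have lev: "ph (c i) ?v = h" and vn: "?v < n"
      using lpathD(4,5)[OF \<pi>(1)[OF ij(1)]] h unfolding \<sigma>_def \<tau>_def by simp_all
    \<comment> \<open>The own level of this vertex lies strictly between those of the terminals, so
      it cannot be one of the permitted common cuts.\<close>
    have ne: "?v \<noteq> s i" "?v \<noteq> t i" using lev h ends[OF ij(1)] by auto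
    have 1: "cut i ?v \<or> inner i ?v" using \<pi>(2)[OF ij(1)] h unfolding \<sigma>_def \<tau>_def by simp
    have 2: "cut j ?v \<or> inner j ?v" using \<pi>(2)[OF ij(2)] h unfolding \<sigma>_def \<tau>_def eq by simp
    have "\<not> (inner i v \<and> cut j v)" for i j v
      using cuts unfolding inner_def cut_def by blast
    moreover have "\<not> (inner i ?v \<and> inner j ?v)"
    proof
      assume "inner i ?v \<and> inner j ?v"
      then obtain q g q' g' where *: "q < l * w" "q div w = i" "ph (c i) (S z q) < g" "g < ph (c i) (E z q)" "?v = \<rho> q g"
        "q' < l * w" "q' div w = j" "ph (c j) (S z q') < g'" "g' < ph (c j) (E z q')" "?v = \<rho> q' g'"
        unfolding inner_def by blast
      then show False using disj[OF *(1,6), of g g'] ij(3) by auto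
    qed
    moreover have "\<not> (cut i ?v \<and> cut j ?v)"
    proof
      assume "cut i ?v \<and> cut j ?v"
      then obtain q q' where *: "q < l * w" "q div w = i" "?v = S z q \<or> ?v = E z q"
        "q' < l * w" "q' div w = j" "?v = S z q' \<or> ?v = E z q'"
        unfolding cut_def by blast
      then show False using pair[OF *(1,4)] ij(3) ne vn unfolding pair_ok_def by auto
    qed
    ultimately show False using 1 2 by blast
  qed
  then have "solution \<sigma> \<tau> \<pi>" unfolding solution_def
    using ends \<pi>(1) unfolding \<sigma>_def \<tau>_def by blast
  then show ?thesis by blast
qed

end

text \<open>The equation for \<open>dS\<close> and \<open>dE\<close> fixes \<open>D\<close> at
  distance exactly \<open>r\<close> from \<open>dS\<close> and \<open>r'\<close> from
  \<open>dE\<close>, in a common direction. As \<open>G\<close> moves no faster, the sum and the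
  difference of \<open>D\<close> and \<open>G\<close> lie between their values at the two
  ends.\<close>

lemma diamond_corner:
  fixes D dS dE G eS eE r r' :: int
  assumes "\<bar>D - dS\<bar> \<le> r" "\<bar>dE - D\<bar> \<le> r'" "\<bar>dS - dE\<bar> = r + r'" "\<bar>G - eS\<bar> \<le> r" "\<bar>eE - G\<bar> \<le> r'"
  shows "D + G \<le> dS + eS \<or> D + G \<le> dE + eE" "dS + eS \<le> D + G \<or> dE + eE \<le> D + G"
    "D - G \<le> dS - eS \<or> D - G \<le> dE - eE" "dS - eS \<le> D - G \<or> dE - eE \<le> D - G"
  using assms by linarith+

section \<open>Completeness of certificates\<close>

context level_graph
begin

text \<open>The paths of the solution are cut by \<open>cut_sequence\<close> at the blocks of
  \<open>separated_blocks\<close>; \<open>w\<close> is twice the bound on the number of cuts because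
  each cut costs two steps. The given paths themselves then serve as routes.\<close>

lemma certified_complete:
  assumes sol: "solution \<sigma> \<tau> \<pi>" and k: "0 < k" and w: "w = 2 * (5 * k * k * l) ^ (2 ^ k)"
  shows certified
proof (cases "l = 0")
  case True
  then show ?thesis unfolding certified_def init_def step_def acc_def by simp
next
  case False
  then have l: "0 < l" by simp
  define A where "A i = ph (c i) (\<sigma> i)" for i
  define B where "B i = ph (c i) (\<tau> i)" for i
  define F where "F i d h = int (ph d (\<pi> i (nat h)))" for i d h
  have ends: "\<sigma> i = s i \<and> \<tau> i = t i \<or> \<sigma> i = t i \<and> \<tau> i = s i" and lp: "lpath (c i) (\<sigma> i) (\<tau> i) (\<pi> i)"
    if "i < l" for i
    using sol that unfolding solution_def by blast+
  have disj: "\<pi> i h \<noteq> \<pi> j h'"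
    if "i < l" "j < l" "i \<noteq> j" "A i < h" "h < B i" "A j \<le> h'" "h' \<le> B j" for i j h h'
    using sol that unfolding solution_def A_def B_def by blast
  have lev: "ph (c i) (\<pi> i h) = h" and vn: "\<pi> i h < n" if "i < l" "A i \<le> h" "h \<le> B i" for i h
    using lpathD(4,5)[OF lp[OF that(1)]] that(2,3) unfolding A_def B_def by simp_all
  have lipn: "absd (ph d (\<pi> i h)) (ph d (\<pi> i h')) \<le> h' - h"
    if "i < l" "d < k" "A i \<le> h" "h \<le> h'" "h' \<le> B i" for i d h h'
    using lpath_lip[OF lp[OF that(1)] that(2)] that(3-) unfolding A_def B_def by simp
  have lipi: "\<bar>F i d h - F i d h'\<bar> \<le> h' - h"
    if "i < l" "d < k" "int (A i) \<le> h" "h \<le> h'" "h' \<le> int (B i)" for i d h h'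
    using lipn[OF that(1,2), of "nat h" "nat h'"] that unfolding F_def int_absd[symmetric] by linarith
  interpret lipschitz_family k l c "\<lambda>i. int (A i)" "\<lambda>i. int (B i)" F
  proof
    show "i < l \<Longrightarrow> c i < k" for i by (rule c_less)
    show "F i (c i) h = h" if "i < l" "int (A i) \<le> h" "h \<le> int (B i)" for i h
      using lev[OF that(1), of "nat h"] that unfolding F_def by simp
    show "\<bar>F i d h - F i d h'\<bar> \<le> \<bar>h - h'\<bar>"
      if "i < l" "d < k" "int (A i) \<le> h" "h \<le> int (B i)" "int (A i) \<le> h'" "h' \<le> int (B i)" for i d h h'
      using lipi[OF that(1,2), of h h'] lipi[OF that(1,2), of h' h] that by linarith
  qed
  define \<kappa> where "\<kappa> = (5 * k * k * l) ^ (2 ^ k)"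
  obtain K lab where K: "\<And>i. i < l \<Longrightarrow> finite (K i) \<and> card (K i) < \<kappa>"
    and lab: "\<And>i h. pt i h \<Longrightarrow> lab i h < k"
    and str: "\<And>i h h'. pt i h \<Longrightarrow> pt i h' \<Longrightarrow> blk (K i) h = blk (K i) h' \<Longrightarrow>
       \<bar>F i (lab i h) h - F i (lab i h) h'\<bar> = \<bar>h - h'\<bar>"
    and apt: "\<And>i i' x y x' y'. pt i x \<Longrightarrow> pt i y \<Longrightarrow> blk (K i) x = blk (K i) y \<Longrightarrow>
       pt i' x' \<Longrightarrow> pt i' y' \<Longrightarrow> blk (K i') x' = blk (K i') y' \<Longrightarrow> lab i x \<noteq> lab i' x' \<Longrightarrow>
       (\<exists>d<k. \<exists>e<k. \<bar>F i d x - F i d y\<bar> = \<bar>x - y\<bar> \<and> \<bar>F i' e x' - F i' e y'\<bar> = \<bar>x' - y'\<bar> \<and>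
          apart i {x, y} i' {x', y'} d e)"
  proof -
    have "\<exists>K lab. (\<forall>i<l. finite (K i) \<and> card (K i) < \<kappa>) \<and> (\<forall>i h. pt i h \<longrightarrow> lab i h < k) \<and>
      (\<forall>i h h'. pt i h \<longrightarrow> pt i h' \<longrightarrow> blk (K i) h = blk (K i) h' \<longrightarrow>
       lab i h = lab i h' \<and> \<bar>F i (lab i h) h - F i (lab i h) h'\<bar> = \<bar>h - h'\<bar>) \<and>
      (\<forall>i i' x y x' y'. pt i x \<longrightarrow> pt i y \<longrightarrow> blk (K i) x = blk (K i) y \<longrightarrow>
       pt i' x' \<longrightarrow> pt i' y' \<longrightarrow> blk (K i') x' = blk (K i') y' \<longrightarrow> lab i x \<noteq> lab i' x' \<longrightarrow>
       (\<exists>d<k. \<exists>e<k. \<bar>F i d x - F i d y\<bar> = \<bar>x - y\<bar> \<and> \<bar>F i' e x' - F i' e y'\<bar> = \<bar>x' - y'\<bar> \<and>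
          apart i {x, y} i' {x', y'} d e))"
      unfolding \<kappa>_def by (rule separated_blocks[OF l k])
    then show thesis
    proof (elim exE conjE)
      fix K lab
      assume 1: "\<forall>i<l. finite (K i) \<and> card (K i) < \<kappa>" and 2: "\<forall>i h. pt i h \<longrightarrow> lab i h < k"
        and 3: "\<forall>i h h'. pt i h \<longrightarrow> pt i h' \<longrightarrow> blk (K i) h = blk (K i) h' \<longrightarrow>
           lab i h = lab i h' \<and> \<bar>F i (lab i h) h - F i (lab i h) h'\<bar> = \<bar>h - h'\<bar>"
        and 4: "\<forall>i i' x y x' y'. pt i x \<longrightarrow> pt i y \<longrightarrow> blk (K i) x = blk (K i) y \<longrightarrow>
           pt i' x' \<longrightarrow> pt i' y' \<longrightarrow> blk (K i') x' = blk (K i') y' \<longrightarrow> lab i x \<noteq> lab i' x' \<longrightarrow>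
           (\<exists>d<k. \<exists>e<k. \<bar>F i d x - F i d y\<bar> = \<bar>x - y\<bar> \<and> \<bar>F i' e x' - F i' e y'\<bar> = \<bar>x' - y'\<bar> \<and>
              apart i {x, y} i' {x', y'} d e)"
      show thesis
        by (rule that[of K lab, OF 1[rule_format] 2[rule_format] 3[rule_format, THEN conjunct2] 4[rule_format]])
    qed
  qed
  have w\<kappa>: "w = 2 * \<kappa>" using w unfolding \<kappa>_def .
  have wpos: "0 < w" using K[OF l] w\<kappa> by linarith
  have "\<forall>i\<in>{..<l}. \<exists>x :: nat \<Rightarrow> int. x 0 = int (A i) \<and> x w = int (B i) \<and>
    (\<forall>j<w. x j \<le> x (Suc j) \<and> (x (Suc j) \<le> x j + 1 \<or> blk (K i) (x j) = blk (K i) (x (Suc j))))"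
  proof
    fix i assume "i \<in> {..<l}"
    then have i: "i < l" by simp
    have "card {y \<in> K i. int (A i) < y \<and> y \<le> int (B i)} \<le> card (K i)"
      using K[OF i] by (intro card_mono) auto
    then have "card {y \<in> K i. int (A i) < y \<and> y \<le> int (B i)} < \<kappa>" using K[OF i] by linarith
    moreover have "int (A i) \<le> int (B i)" using lpathD(1)[OF lp[OF i]] unfolding A_def B_def by simp
    ultimately show "\<exists>x :: nat \<Rightarrow> int. x 0 = int (A i) \<and> x w = int (B i) \<and>
      (\<forall>j<w. x j \<le> x (Suc j) \<and> (x (Suc j) \<le> x j + 1 \<or> blk (K i) (x j) = blk (K i) (x (Suc j))))"
      unfolding w\<kappa> using cut_sequence K[OF i] by blast
  qed
  from bchoice[OF this] obtain x :: "nat \<Rightarrow> nat \<Rightarrow> int" where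
    x: "\<And>i. i < l \<Longrightarrow> x i 0 = int (A i)" "\<And>i. i < l \<Longrightarrow> x i w = int (B i)"
      "\<And>i j. i < l \<Longrightarrow> j < w \<Longrightarrow> x i j \<le> x i (Suc j)"
      "\<And>i j. i < l \<Longrightarrow> j < w \<Longrightarrow> x i (Suc j) \<le> x i j + 1 \<or> blk (K i) (x i j) = blk (K i) (x i (Suc j))"
    by auto
  have xmono: "x i j \<le> x i j'" if "i < l" "j \<le> j'" "j' \<le> w" for i j j'
    using that(2,3)
  proof (induction j')
    case (Suc j')
    then show ?case using x(3)[OF that(1), of j'] by (cases "j = Suc j'") auto
  qed simp
  define X where "X i j = nat (x i j)" for i j
  have xX: "x i j = int (X i j)" if "i < l" "j \<le> w" for i j
    using xmono[OF that(1) _ that(2), of 0] x(1)[OF that(1)] unfolding X_def by simp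
  have X0: "X i 0 = A i" "X i w = B i" if "i < l" for i using x(1,2)[OF that] unfolding X_def by simp_all
  have Xmono: "X i j \<le> X i j'" if "i < l" "j \<le> j'" "j' \<le> w" for i j j'
    using xmono[OF that] unfolding X_def by simp
  have XR: "A i \<le> X i j" "X i j \<le> B i" if "i < l" "j \<le> w" for i j
    using Xmono[OF that(1) _ that(2), of 0] Xmono[OF that order.refl] X0[OF that(1)] by simp_all
  have Xpt: "pt i (x i j)" if "i < l" "j \<le> w" for i j
    using XR[OF that] xX[OF that] that unfolding pt_def by simp
  have FX: "F i d (x i j) = int (ph d (\<pi> i (X i j)))" for i j d
    unfolding F_def X_def ..
  \<comment> \<open>A piece of length at most one may straddle two blocks, so it takes its own
    colour, in which it is certainly straight. Having an empty diamond, it conflicts with no other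
    label.\<close>
  define LL where "LL i j = (if X i (Suc j) \<le> X i j + 1 then c i else lab i (x i j))" for i j
  have LLk: "LL i j < k" if "i < l" "j < w" for i j
    unfolding LL_def using c_less[OF that(1)] lab Xpt that by simp
  have blkX: "blk (K i) (x i j) = blk (K i) (x i (Suc j))"
    if "i < l" "j < w" "\<not> X i (Suc j) \<le> X i j + 1" for i j
    using x(4)[OF that(1,2)] xX[OF that(1), of j] xX[OF that(1), of "Suc j"] that by linarith
  have strX: "absd (ph (LL i j) (\<pi> i (X i (Suc j)))) (ph (LL i j) (\<pi> i (X i j))) = X i (Suc j) - X i j"
    if ij: "i < l" "j < w" for i j
  proof (cases "X i (Suc j) \<le> X i j + 1")
    case True
    then show ?thesis using lev XR ij Xmono[OF ij(1), of j "Suc j"] unfolding LL_def by (simp add: absd_def)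
  next
    case False
    have "\<bar>F i (lab i (x i j)) (x i j) - F i (lab i (x i j)) (x i (Suc j))\<bar> = \<bar>x i j - x i (Suc j)\<bar>"
      using str[OF Xpt Xpt blkX[OF ij False]] ij by simp
    then have "int (absd (ph (LL i j) (\<pi> i (X i (Suc j)))) (ph (LL i j) (\<pi> i (X i j)))) = int (X i (Suc j) - X i j)"
      using False xX[OF ij(1), of j] xX[OF ij(1), of "Suc j"] ij Xmono[OF ij(1), of j "Suc j"]
      unfolding FX int_absd LL_def by simp
    then show ?thesis by simp
  qed
  define Q where "Q = l * w"
  define I where "I q = q div w" for q
  define J where "J q = q mod w" for q
  have I: "I q < l" and J: "J q < w" "J q \<le> w" "Suc (J q) \<le> w" if "q < Q" for q
    using that wpos unfolding I_def J_def Q_def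
    by (simp_all add: less_mult_imp_div_less less_imp_le Suc_leI)
  have IJ: "q = q'" if "I q = I q'" "J q = J q'" for q q'
    using that unfolding I_def J_def by (metis div_mult_mod_eq)
  define sS where "sS q = \<pi> (I q) (X (I q) (J q))" for q
  define sE where "sE q = \<pi> (I q) (X (I q) (Suc (J q)))" for q
  define sL where "sL q = LL (I q) (J q)" for q
  define a where "a q = ph (sL q) (sS q)" for q
  define b where "b q = ph (sL q) (sE q)" for q
  define len where "len q = X (I q) (Suc (J q)) - X (I q) (J q)" for q
  \<comment> \<open>The number of steps past \<open>S\<close> at time \<open>h\<close>, clamped so
    that the piece waits before and after its active period. In a descending piece the count starts
    at the full length and falls to zero.\<close>
  define r where "r h q = (if a q \<le> b q then min (h - a q) (b q - a q) else (a q - b q) - min (h - b q) (a q - b q))" for h q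
  define sZ where "sZ h q = \<pi> (I q) (X (I q) (J q) + r h q)" for h q
  define zs where "zs h m = (if m < Q then sS m else if m < Q + Q then sE (m - Q)
      else if m < Q + (Q + Q) then sL (m - (Q + Q)) else sZ h (m - (Q + (Q + Q))))" for h m
  have zS: "S (zs h) q = sS q" and zE: "E (zs h) q = sE q" and zL: "L (zs h) q = sL q" and zZ: "Z (zs h) q = sZ h q"
    if "q < Q" for h q
    using that unfolding S_def E_def L_def Z_def zs_def Q_def[symmetric] by simp_all
  have Xstep: "X (I q) (Suc (J q)) = X (I q) (J q) + len q" if "q < Q" for q
    using Xmono[OF I[OF that], of "J q" "Suc (J q)"] J[OF that] unfolding len_def by simp
  have range: "A (I q) \<le> X (I q) (J q)" "X (I q) (J q) + len q \<le> B (I q)" if "q < Q" for q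
    using XR[OF I[OF that]] J[OF that] Xstep[OF that] by metis+
  have lS: "ph (c (I q)) (sS q) = X (I q) (J q)" and lE: "ph (c (I q)) (sE q) = X (I q) (J q) + len q"
    and SEn: "sS q < n" "sE q < n" if "q < Q" for q
    unfolding sS_def sE_def using lev[OF I[OF that]] vn[OF I[OF that]] range[OF that] Xstep[OF that] by simp_all
  have ab: "absd (b q) (a q) = len q" if "q < Q" for q
    unfolding a_def b_def len_def sL_def sS_def sE_def using strX[OF I[OF that] J(1)[OF that]] .
  have sLk: "sL q < k" if "q < Q" for q unfolding sL_def using LLk[OF I[OF that] J(1)[OF that]] .
  have abn: "a q < n" "b q < n" if "q < Q" for q
    unfolding a_def b_def using ph_less SEn[OF that] sLk[OF that] by blast+
  have rlen: "r h q \<le> len q" if "q < Q" for h q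
    using ab[OF that] unfolding r_def absd_def by (auto simp: min_def split: if_splits)
  \<comment> \<open>The level is within \<open>m\<close> of one end and within
    \<open>len q - m\<close> of the other, while the ends are \<open>len q\<close> apart; this
    determines it.\<close>
  have linear: "ph (sL q) (\<pi> (I q) (X (I q) (J q) + m)) = (if a q \<le> b q then a q + m else a q - m)"
    if q: "q < Q" and m: "m \<le> len q" for q m
  proof -
    have "absd (a q) (ph (sL q) (\<pi> (I q) (X (I q) (J q) + m))) \<le> m"
      using lipn[OF I[OF q] sLk[OF q], of "X (I q) (J q)" "X (I q) (J q) + m"] range[OF q] m
      unfolding a_def sS_def by simp
    moreover have "absd (ph (sL q) (\<pi> (I q) (X (I q) (J q) + m))) (b q) \<le> len q - m"
      using lipn[OF I[OF q] sLk[OF q], of "X (I q) (J q) + m" "X (I q) (J q) + len q"] range[OF q] m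
      unfolding b_def sE_def Xstep[OF q] by simp
    ultimately show ?thesis using ab[OF q] m unfolding absd_def by (auto split: if_splits)
  qed
  have mid: "r h q < len q \<and> 0 < r h q \<and> A (I q) < X (I q) (J q) + r h q \<and> X (I q) (J q) + r h q < B (I q)"
    if q: "q < Q" and "between h (a q) (b q)" for h q
  proof -
    have "0 < r h q" "r h q < len q"
      using that(2) ab[OF q] unfolding r_def between_def absd_def by (auto simp: min_def)
    then show ?thesis using range[OF q] by simp
  qed
  \<comment> \<open>An interior vertex of a piece is internal to its path and hence on no other path
    of the solution. On the same path, vertices are told apart by their own level.\<close>
  have avoid: "sZ h q \<noteq> \<pi> (I q') y"
    if q: "q < Q" "q' < Q" and bt: "between h (a q) (b q)"
      and y: "A (I q') \<le> y" "y \<le> B (I q')" "I q = I q' \<Longrightarrow> y \<le> X (I q) (J q) \<or> X (I q) (J q) + len q \<le> y" for q q' h y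
  proof (cases "I q = I q'")
    case False
    then show ?thesis unfolding sZ_def using disj[OF I[OF q(1)] I[OF q(2)] False] mid[OF q(1) bt] y by simp
  next
    case True
    have "ph (c (I q)) (sZ h q) = X (I q) (J q) + r h q"
      unfolding sZ_def using lev[OF I[OF q(1)]] mid[OF q(1) bt] by simp
    moreover have "ph (c (I q)) (\<pi> (I q') y) = y" using lev[OF I[OF q(2)] y(1,2)] True by simp
    ultimately show ?thesis using y(3)[OF True] mid[OF q(1) bt] by auto
  qed
  have cutpos: "X (I q') j \<le> X (I q) (J q) \<or> X (I q) (J q) + len q \<le> X (I q') j"
    if q: "q < Q" and "I q = I q'" "j \<le> w" for q q' j
  proof (cases "j \<le> J q")
    case True
    then show ?thesis using Xmono[OF I[OF q] True] J[OF q] that(2) by simp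
  next
    case False
    then have "Suc (J q) \<le> j" by simp
    then show ?thesis using Xmono[OF I[OF q] _ that(3), of "Suc (J q)"] that(2) Xstep[OF q] by simp
  qed
  have avoid_cuts: "sZ h q \<noteq> sS q' \<and> sZ h q \<noteq> sE q'"
    if q: "q < Q" "q' < Q" and bt: "between h (a q) (b q)" for q q' h
    unfolding sS_def sE_def
    using avoid[OF q bt XR[OF I[OF q(2)] J(2)[OF q(2)]] cutpos[OF q(1) _ J(2)[OF q(2)]]]
      avoid[OF q bt XR[OF I[OF q(2)] J(3)[OF q(2)]] cutpos[OF q(1) _ J(3)[OF q(2)]]] by simp
  have avoid_pos: "sZ h q \<noteq> sZ h q'"
    if q: "q < Q" "q' < Q" "q \<noteq> q'" and bt: "between h (a q) (b q)" "between h (a q') (b q')" for q q' h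
  proof -
    have "X (I q') (J q') + r h q' \<le> X (I q) (J q) \<or> X (I q) (J q) + len q \<le> X (I q') (J q') + r h q'"
      if II: "I q = I q'"
    proof -
      have "J q \<noteq> J q'" using IJ[OF II] q(3) by blast
      then consider "Suc (J q) \<le> J q'" | "Suc (J q') \<le> J q" by linarith
      then show ?thesis
      proof cases
        case 1
        then have "X (I q) (Suc (J q)) \<le> X (I q) (J q')" using Xmono[OF I[OF q(1)]] J[OF q(2)] by blast
        then show ?thesis using Xstep[OF q(1)] II by simp
      next
        case 2
        then have "X (I q) (Suc (J q')) \<le> X (I q) (J q)" using Xmono[OF I[OF q(1)]] J[OF q(1)] by blast
        then show ?thesis using Xstep[OF q(2)] II rlen[OF q(2), of h] by simp
      qed
    qed
    then show ?thesis using avoid[OF q(1,2) bt(1), of "X (I q') (J q') + r h q'"] mid[OF q(2) bt(2)]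
      unfolding sZ_def[of h q'] by simp
  qed
  have diaD: "X (I q) (J q) < ph (c (I q)) v" "ph (c (I q)) v < X (I q) (J q) + len q"
     "d < k \<Longrightarrow> \<bar>int (ph d v) - F (I q) d (x (I q) (J q))\<bar> \<le> int (ph (c (I q)) v) - int (X (I q) (J q))"
     "d < k \<Longrightarrow> \<bar>F (I q) d (x (I q) (Suc (J q))) - int (ph d v)\<bar> \<le> int (X (I q) (Suc (J q))) - int (ph (c (I q)) v)"
    if q: "q < Q" and dia: "diamond (zs h) q v" for q v h d
  proof -
    have *: "X (I q) (J q) < ph (c (I q)) v" "ph (c (I q)) v < X (I q) (J q) + len q"
      "d < k \<Longrightarrow> absd (ph d v) (ph d (sS q)) \<le> ph (c (I q)) v - X (I q) (J q)"
      "d < k \<Longrightarrow> absd (ph d (sE q)) (ph d v) \<le> X (I q) (J q) + len q - ph (c (I q)) v"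
      using dia unfolding diamond_def I_def[symmetric] zS[OF q] zE[OF q] lS[OF q] lE[OF q] by blast+
    show "X (I q) (J q) < ph (c (I q)) v" "ph (c (I q)) v < X (I q) (J q) + len q" by (fact *)+
    show "d < k \<Longrightarrow> \<bar>int (ph d v) - F (I q) d (x (I q) (J q))\<bar> \<le> int (ph (c (I q)) v) - int (X (I q) (J q))"
      using *(1,3) unfolding FX sS_def int_absd[symmetric] by linarith
    show "d < k \<Longrightarrow> \<bar>F (I q) d (x (I q) (Suc (J q))) - int (ph d v)\<bar> \<le> int (X (I q) (Suc (J q))) - int (ph (c (I q)) v)"
      using *(2,4) unfolding FX sE_def int_absd[symmetric] Xstep[OF q] by linarith
  qed
  \<comment> \<open>The levels \<open>dd\<close> and \<open>e\<close> of a common vertex would lie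
    in both rectangles, by \<open>diamond_corner\<close> with either level as the straight one. This
    contradicts the separation of the corners.\<close>
  have no_common: "\<not> (diamond (zs h) q v \<and> diamond (zs h) q' v)"
    if q: "q < Q" "q' < Q" and ne: "sL q \<noteq> sL q'" for q q' v h
  proof
    assume d2: "diamond (zs h) q v \<and> diamond (zs h) q' v"
    then have d: "diamond (zs h) q v" and d': "diamond (zs h) q' v" by simp_all
    \<comment> \<open>A nonempty diamond forces length at least two, so the piece lies within one
      block and carries the label of that block.\<close>
    have long: "\<not> X (I q) (Suc (J q)) \<le> X (I q) (J q) + 1"
      using diaD(1,2)[OF q(1) d] unfolding Xstep[OF q(1)] by simp
    have long': "\<not> X (I q') (Suc (J q')) \<le> X (I q') (J q') + 1"
      using diaD(1,2)[OF q(2) d'] unfolding Xstep[OF q(2)] by simp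
    have ln: "lab (I q) (x (I q) (J q)) \<noteq> lab (I q') (x (I q') (J q'))"
      using ne long long' unfolding sL_def LL_def by simp
    obtain dd e where de: "dd < k" "e < k"
      "\<bar>F (I q) dd (x (I q) (J q)) - F (I q) dd (x (I q) (Suc (J q)))\<bar> = \<bar>x (I q) (J q) - x (I q) (Suc (J q))\<bar>"
      "\<bar>F (I q') e (x (I q') (J q')) - F (I q') e (x (I q') (Suc (J q')))\<bar> = \<bar>x (I q') (J q') - x (I q') (Suc (J q'))\<bar>"
      "apart (I q) {x (I q) (J q), x (I q) (Suc (J q))} (I q') {x (I q') (J q'), x (I q') (Suc (J q'))} dd e"
      using apt[OF Xpt[OF I[OF q(1)] J(2)[OF q(1)]] Xpt[OF I[OF q(1)] J(3)[OF q(1)]] blkX[OF I[OF q(1)] J(1)[OF q(1)] long]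
          Xpt[OF I[OF q(2)] J(2)[OF q(2)]] Xpt[OF I[OF q(2)] J(3)[OF q(2)]] blkX[OF I[OF q(2)] J(1)[OF q(2)] long'] ln]
      by blast
    have xs: "\<bar>x (I q) (J q) - x (I q) (Suc (J q))\<bar> =
        (int (ph (c (I q)) v) - int (X (I q) (J q))) + (int (X (I q) (Suc (J q))) - int (ph (c (I q)) v))"
      if "q < Q" for q
      using xX[OF I[OF that]] J[OF that] Xstep[OF that] by simp
    note e1 = de(3)[unfolded xs[OF q(1)]] and e2 = de(4)[unfolded xs[OF q(2)]]
    note c1 = diamond_corner[OF diaD(3,4)[OF q(1) d de(1) ] e1 diaD(3,4)[OF q(1) d de(2)]]
    note c2 = diamond_corner[OF diaD(3,4)[OF q(2) d' de(2)] e2 diaD(3,4)[OF q(2) d' de(1)]]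
    let ?i = "I q" and ?i' = "I q'"
    let ?x = "x (I q) (J q)" and ?x1 = "x (I q) (Suc (J q))" and ?y = "x (I q') (J q')" and ?y1 = "x (I q') (Suc (J q'))"
    show False using de(5) unfolding apart_def
    proof (elim disjE)
      assume "\<forall>u\<in>{?x, ?x1}. \<forall>v\<in>{?y, ?y1}. F ?i dd u + F ?i e u < F ?i' dd v + F ?i' e v"
      then have "F ?i dd ?x + F ?i e ?x < F ?i' dd ?y + F ?i' e ?y" "F ?i dd ?x + F ?i e ?x < F ?i' dd ?y1 + F ?i' e ?y1" "F ?i dd ?x1 + F ?i e ?x1 < F ?i' dd ?y + F ?i' e ?y" "F ?i dd ?x1 + F ?i e ?x1 < F ?i' dd ?y1 + F ?i' e ?y1" by blast+
      then show False using c1(1) c2(2) by linarith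
    next
      assume "\<forall>u\<in>{?x, ?x1}. \<forall>v\<in>{?y, ?y1}. F ?i' dd v + F ?i' e v < F ?i dd u + F ?i e u"
      then have "F ?i' dd ?y + F ?i' e ?y < F ?i dd ?x + F ?i e ?x" "F ?i' dd ?y1 + F ?i' e ?y1 < F ?i dd ?x + F ?i e ?x" "F ?i' dd ?y + F ?i' e ?y < F ?i dd ?x1 + F ?i e ?x1" "F ?i' dd ?y1 + F ?i' e ?y1 < F ?i dd ?x1 + F ?i e ?x1" by blast+
      then show False using c1(2) c2(1) by linarith
    next
      assume "\<forall>u\<in>{?x, ?x1}. \<forall>v\<in>{?y, ?y1}. F ?i dd u - F ?i e u < F ?i' dd v - F ?i' e v"
      then have "F ?i dd ?x - F ?i e ?x < F ?i' dd ?y - F ?i' e ?y" "F ?i dd ?x - F ?i e ?x < F ?i' dd ?y1 - F ?i' e ?y1" "F ?i dd ?x1 - F ?i e ?x1 < F ?i' dd ?y - F ?i' e ?y" "F ?i dd ?x1 - F ?i e ?x1 < F ?i' dd ?y1 - F ?i' e ?y1" by blast+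
      then show False using c1(3) c2(3) by linarith
    next
      assume "\<forall>u\<in>{?x, ?x1}. \<forall>v\<in>{?y, ?y1}. F ?i' dd v - F ?i' e v < F ?i dd u - F ?i e u"
      then have "F ?i' dd ?y - F ?i' e ?y < F ?i dd ?x - F ?i e ?x" "F ?i' dd ?y1 - F ?i' e ?y1 < F ?i dd ?x - F ?i e ?x" "F ?i' dd ?y - F ?i' e ?y < F ?i dd ?x1 - F ?i e ?x1" "F ?i' dd ?y1 - F ?i' e ?y1 < F ?i dd ?x1 - F ?i e ?x1" by blast+
      then show False using c1(4) c2(4) by linarith
    qed
  qed
  have ok: "piece_ok (zs 0) q" if q: "q < Q" for q
  proof -
    have "sE q = sS (q + 1)" if "q mod w + 1 < w"
    proof -
      have "Suc q mod w = Suc (q mod w)" "Suc q div w = q div w"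
        using that by (simp_all add: mod_Suc div_Suc)
      then show ?thesis unfolding sE_def sS_def I_def J_def by simp
    qed
    moreover have "q + 1 < Q" if "q mod w + 1 < w"
    proof -
      have "q div w < l" using I[OF q] unfolding I_def .
      then have "(q div w + 1) * w \<le> Q" unfolding Q_def by (intro mult_le_mono1) simp
      moreover have "q = q div w * w + q mod w" by simp
      moreover have "(q div w + 1) * w = q div w * w + w" by simp
      ultimately show ?thesis using that by linarith
    qed
    ultimately show ?thesis
      unfolding piece_ok_def zS[OF q] zE[OF q] zL[OF q] I_def[symmetric] lS[OF q] lE[OF q]
      using SEn[OF q] sLk[OF q] ab[OF q] zS[of "q + 1" 0] unfolding a_def b_def by auto
  qed
  have pok: "pair_ok (zs 0) q q'" if q: "q < Q" "q' < Q" for q q'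
  proof -
    have 1: "sS q = s (I q) \<and> sE q' = t (I q) \<or> sS q = t (I q) \<and> sE q' = s (I q)"
      if "I q = I q'" "J q = 0" "J q' + 1 = w"
    proof -
      have "sS q = \<sigma> (I q)" unfolding sS_def that X0(1)[OF I[OF q(1)], unfolded that]
        using lpathD(2)[OF lp[OF I[OF q(2)]]] X0(1)[OF I[OF q(2)]] that unfolding A_def by simp
      moreover have "sE q' = \<tau> (I q)" unfolding sE_def
        using lpathD(3)[OF lp[OF I[OF q(2)]]] X0(2)[OF I[OF q(2)]] that unfolding B_def by simp
      ultimately show ?thesis using ends[OF I[OF q(1)]] by auto
    qed
    have 2: "v = s (I q) \<or> v = t (I q)"
      if ne: "I q \<noteq> I q'" and v: "v = sS q \<or> v = sE q" "v = sS q' \<or> v = sE q'" for v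
    proof -
      obtain y where y: "v = \<pi> (I q) y" "A (I q) \<le> y" "y \<le> B (I q)"
        using v(1) XR[OF I[OF q(1)] J(2)[OF q(1)]] XR[OF I[OF q(1)] J(3)[OF q(1)]] unfolding sS_def sE_def by blast
      obtain y' where y': "v = \<pi> (I q') y'" "A (I q') \<le> y'" "y' \<le> B (I q')"
        using v(2) XR[OF I[OF q(2)] J(2)[OF q(2)]] XR[OF I[OF q(2)] J(3)[OF q(2)]] unfolding sS_def sE_def by blast
      have "y = A (I q) \<or> y = B (I q)"
        using disj[OF I[OF q(1)] I[OF q(2)] ne, of y y'] y y' by fastforce
      then have "v = \<sigma> (I q) \<or> v = \<tau> (I q)"
        using lpathD(2,3)[OF lp[OF I[OF q(1)]]] y(1) unfolding A_def B_def by metis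
      then show ?thesis using ends[OF I[OF q(1)]] by auto
    qed
    show ?thesis
      unfolding pair_ok_def zS[OF q(1)] zS[OF q(2)] zE[OF q(1)] zE[OF q(2)] zL[OF q(1)] zL[OF q(2)]
        I_def[symmetric] J_def[symmetric]
      using 1 2 no_common[OF q] by blast
  qed
  have r0: "r 0 q = (if a q \<le> b q then 0 else len q)" and rn: "r n q = (if a q \<le> b q then len q else 0)"
    if "q < Q" for q
    using ab[OF that] abn[OF that] unfolding r_def absd_def by (auto simp: min_def)
  have "init (zs 0)" unfolding init_def Q_def[symmetric]
  proof (intro allI impI conjI)
    fix q assume q: "q < Q"
    show "piece_ok (zs 0) q" by (rule ok[OF q])
    show "pair_ok (zs 0) q q'" if "q' < Q" for q' by (rule pok[OF q that])
    show "Z (zs 0) q = (if ph (L (zs 0) q) (S (zs 0) q) \<le> ph (L (zs 0) q) (E (zs 0) q) then S (zs 0) q else E (zs 0) q)"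
      unfolding zS[OF q] zE[OF q] zL[OF q] zZ[OF q] a_def[symmetric] b_def[symmetric] sZ_def r0[OF q]
      by (simp add: sS_def sE_def Xstep[OF q])
  qed
  moreover have "acc (zs n)" unfolding acc_def Q_def[symmetric]
  proof (intro allI impI)
    fix q assume q: "q < Q"
    show "Z (zs n) q = (if ph (L (zs n) q) (S (zs n) q) \<le> ph (L (zs n) q) (E (zs n) q) then E (zs n) q else S (zs n) q)"
      unfolding zS[OF q] zE[OF q] zL[OF q] zZ[OF q] a_def[symmetric] b_def[symmetric] sZ_def rn[OF q]
      by (simp add: sS_def sE_def Xstep[OF q])
  qed
  moreover have "step h (zs h) (zs (Suc h))" if h: "h < n" for h
    unfolding step_def Q_def[symmetric]
  proof (intro allI impI conjI)
    fix q assume q: "q < Q"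
    show "S (zs (Suc h)) q = S (zs h) q" "E (zs (Suc h)) q = E (zs h) q" "L (zs (Suc h)) q = L (zs h) q"
      by (simp_all only: zS[OF q] zE[OF q] zL[OF q])
    have sZn: "sZ g q < n" for g
      unfolding sZ_def using vn[OF I[OF q]] range[OF q] rlen[OF q, of g] by simp
    then show "Z (zs (Suc h)) q < n" by (simp only: zZ[OF q])
    show "if active h (ph (L (zs h) q) (S (zs h) q)) (ph (L (zs h) q) (E (zs h) q))
         then ad (Z (zs h) q) (Z (zs (Suc h)) q) \<and> ph (L (zs h) q) (Z (zs (Suc h)) q) = Suc h
         else Z (zs (Suc h)) q = Z (zs h) q"
      unfolding zS[OF q] zE[OF q] zL[OF q] zZ[OF q] a_def[symmetric] b_def[symmetric]
    proof (cases "active h (a q) (b q)")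
      case False
      then have "r (Suc h) q = r h q" unfolding r_def active_def by (auto simp: min_def)
      then show "if active h (a q) (b q) then ad (sZ h q) (sZ (Suc h) q) \<and> ph (sL q) (sZ (Suc h) q) = Suc h
         else sZ (Suc h) q = sZ h q" using False unfolding sZ_def by simp
    next
      case True
      have adl: "ad (\<pi> (I q) (X (I q) (J q) + m)) (\<pi> (I q) (X (I q) (J q) + Suc m))" if "m < len q" for m
        using lpathD(6)[OF lp[OF I[OF q]], of "X (I q) (J q) + m"] range[OF q] that unfolding A_def B_def by simp
      have lv: "ph (sL q) (sZ (Suc h) q) = Suc h"
        using linear[OF q rlen[OF q, of "Suc h"]] True unfolding sZ_def r_def active_def
        by (auto simp: min_def split: if_splits)
      have "ad (sZ h q) (sZ (Suc h) q)"
      proof (cases "a q \<le> b q")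
        case le: True
        have "r (Suc h) q = Suc (r h q)" "r h q < len q"
          using True le ab[OF q] unfolding r_def active_def absd_def by (auto simp: min_def)
        then show ?thesis using adl unfolding sZ_def by simp
      next
        case le: False
        have "r h q = Suc (r (Suc h) q)" "r (Suc h) q < len q"
          using True le ab[OF q] unfolding r_def active_def absd_def by (auto simp: min_def)
        then have "ad (sZ (Suc h) q) (sZ h q)" using adl unfolding sZ_def by simp
        then show ?thesis using ad_sym sZn by blast
      qed
      then show "if active h (a q) (b q) then ad (sZ h q) (sZ (Suc h) q) \<and> ph (sL q) (sZ (Suc h) q) = Suc h
         else sZ (Suc h) q = sZ h q" using True lv by simp
    qed
    fix q' assume bt: "between (Suc h) (ph (L (zs h) q) (S (zs h) q)) (ph (L (zs h) q) (E (zs h) q))" and q': "q' < Q"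
    then have bt': "between (Suc h) (a q) (b q)"
      unfolding zS[OF q] zE[OF q] zL[OF q] a_def[symmetric] b_def[symmetric] by simp
    show "Z (zs (Suc h)) q \<noteq> S (zs h) q'" "Z (zs (Suc h)) q \<noteq> E (zs h) q'"
      unfolding zS[OF q'] zE[OF q'] zZ[OF q] using avoid_cuts[OF q q' bt'] by blast+
    assume *: "q \<noteq> q' \<and> L (zs h) q = L (zs h) q' \<and>
        between (Suc h) (ph (L (zs h) q') (S (zs h) q')) (ph (L (zs h) q') (E (zs h) q'))"
    then have "between (Suc h) (a q') (b q')"
      unfolding zS[OF q'] zE[OF q'] zL[OF q'] a_def[symmetric] b_def[symmetric] by simp
    then show "Z (zs (Suc h)) q \<noteq> Z (zs (Suc h)) q'"
      unfolding zZ[OF q] zZ[OF q'] using avoid_pos[OF q q' _ bt'] * by blast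
  qed
  ultimately show ?thesis unfolding certified_def by blast
qed

end

section \<open>Configurations as numbers\<close>

lemma digits_exist:
  fixes f :: "nat \<Rightarrow> nat"
  assumes "\<And>j. j < D \<Longrightarrow> f j < B"
  shows "\<exists>e < B ^ D. \<forall>j<D. e div B ^ j mod B = f j"
  using assms
proof (induction D)
  case (Suc D)
  then obtain e where e: "e < B ^ D" "\<And>j. j < D \<Longrightarrow> e div B ^ j mod B = f j" by auto
  have fD: "f D < B" using Suc.prems by simp
  have B: "0 < B" using fD by simp
  let ?e = "e + f D * B ^ D"
  have "?e < Suc (f D) * B ^ D" using e(1) by simp
  also have "\<dots> \<le> B * B ^ D" using fD by (intro mult_le_mono1) simp
  finally have 1: "?e < B ^ Suc D" by simp
  have "?e div B ^ j mod B = f j" if "j < Suc D" for j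
  proof (cases "j = D")
    case True
    have "?e div B ^ D = f D" using e(1) B by simp
    then show ?thesis using True fD by simp
  next
    case False
    then have j: "j < D" using that by simp
    have "D = (D - Suc j) + 1 + j" using j by simp
    then have "B ^ D = B ^ (D - Suc j) * B * B ^ j" by (metis power_add power_one_right)
    then have "?e = e + (f D * B ^ (D - Suc j) * B) * B ^ j" by (simp only: mult.assoc)
    moreover have "(e + m * B ^ j) div B ^ j = e div B ^ j + m" for m using B by simp
    ultimately have "?e div B ^ j = e div B ^ j + f D * B ^ (D - Suc j) * B" by metis
    then show ?thesis using e(2)[OF j] by simp
  qed
  then show ?case using 1 by blast
qed simp

context certificate
begin

text \<open>One base for all fields: it exceeds every vertex and every label, and the summand 2
  keeps it positive in degenerate instances.\<close>

definition base :: nat where "base = n + k + 2"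
definition width :: nat where "width = l * w + (l * w + (l * w + l * w))"
definition codes :: nat where "codes = base ^ width"
definition dig :: "nat \<Rightarrow> nat \<Rightarrow> nat" where "dig e j = e div base ^ j mod base"

primrec tab :: "nat \<Rightarrow> nat \<Rightarrow> bool" where
  "tab 0 e \<longleftrightarrow> init (dig e)"
| "tab (Suc h) e' \<longleftrightarrow> (\<exists>e<codes. tab h e \<and> step h (dig e) (dig e'))"

lemma agree_fields:
  assumes "\<And>j. j < width \<Longrightarrow> z j = z' j" "q < l * w"
  shows "S z q = S z' q" "E z q = E z' q" "L z q = L z' q" "Z z q = Z z' q"
  unfolding S_def E_def L_def Z_def using assms unfolding width_def by simp_all

lemma next_piece:
  assumes "q < l * w" "q mod w + 1 < w"
  shows "q + 1 < l * w"
proof -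
  have "q div w < l" using assms(1) by (simp add: less_mult_imp_div_less)
  then have "(q div w + 1) * w \<le> l * w" by (intro mult_le_mono1) simp
  moreover have "q = q div w * w + q mod w" by simp
  moreover have "(q div w + 1) * w = q div w * w + w" by simp
  ultimately show ?thesis using assms(2) by linarith
qed

text \<open>A number encodes a sequence only in its first \<open>width\<close> entries, so each
  predicate has to be insensitive to the others. The same is done for \<open>acc\<close> and
  \<open>step\<close> below.\<close>

lemma init_agree:
  assumes "init z" and eq: "\<And>j. j < width \<Longrightarrow> z j = z' j"
  shows "init z'"
proof -
  note f = agree_fields[of z z', OF eq]
  have d: "diamond z' q = diamond z q" if "q < l * w" for q
    using f[OF _ that] unfolding diamond_def by (intro ext) simp
  have p: "piece_ok z' q = piece_ok z q" if "q < l * w" for q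
    using f[OF _ that] f(1)[OF _ next_piece[OF that]] unfolding piece_ok_def by (simp cong: conj_cong imp_cong)
  have pp: "pair_ok z' q q' = pair_ok z q q'" if "q < l * w" "q' < l * w" for q q'
    using f[OF _ that(1)] f[OF _ that(2)] d[OF that(1)] d[OF that(2)] unfolding pair_ok_def by simp
  show ?thesis using assms(1) unfolding init_def by (simp add: p pp f[symmetric] cong: if_cong)
qed

lemma acc_agree: "acc z \<Longrightarrow> (\<And>j. j < width \<Longrightarrow> z j = z' j) \<Longrightarrow> acc z'"
  using agree_fields[of z z'] unfolding acc_def by (simp cong: if_cong)

lemma step_agree:
  assumes "step h z y" and eq: "\<And>j. j < width \<Longrightarrow> z j = z' j" and eq': "\<And>j. j < width \<Longrightarrow> y j = y' j"
  shows "step h z' y'"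
  using assms(1) agree_fields[of z z', OF eq] agree_fields[of y y', OF eq'] unfolding step_def
  by (simp cong: if_cong) blast

lemma init_digits:
  assumes "init z" "j < width"
  shows "z j < base"
proof -
  have *: "S z q < n" "E z q < n" "L z q < k" "Z z q < n" if "q < l * w" for q
    using assms(1) that unfolding init_def piece_ok_def by auto
  consider q where "q < l * w" "j = q" | q where "q < l * w" "j = l * w + q"
    | q where "q < l * w" "j = l * w + (l * w + q)" | q where "q < l * w" "j = l * w + (l * w + (l * w + q))"
    using assms(2) unfolding width_def
    by (metis add_less_cancel_left le_add_diff_inverse not_le)
  then show ?thesis
    using * unfolding base_def S_def E_def L_def Z_def
    by cases (simp_all add: add.assoc trans_less_add1 trans_less_add2 less_SucI)
qed

lemma step_digits:
  assumes "step h z y" and zb: "\<And>j. j < width \<Longrightarrow> z j < base" and j: "j < width"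
  shows "y j < base"
proof -
  have *: "y q = z q" "y (l * w + q) = z (l * w + q)" "y (l * w + (l * w + q)) = z (l * w + (l * w + q))"
    "y (l * w + (l * w + (l * w + q))) < n" if "q < l * w" for q
    using assms(1) that unfolding step_def S_def E_def L_def Z_def by blast+
  consider q where "q < l * w" "j = q" | q where "q < l * w" "j = l * w + q"
    | q where "q < l * w" "j = l * w + (l * w + q)" | q where "q < l * w" "j = l * w + (l * w + (l * w + q))"
    using j unfolding width_def
    by (metis add_less_cancel_left le_add_diff_inverse not_le)
  then show ?thesis
    using * zb j unfolding base_def by cases (fastforce simp: less_SucI trans_less_add1)+
qed

lemma tab_chain:
  assumes "tab h e"
  shows "\<exists>zs. init (zs 0) \<and> (\<forall>i<h. step i (zs i) (zs (Suc i))) \<and> zs h = dig e"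
  using assms
proof (induction h arbitrary: e)
  case 0
  then show ?case by (intro exI[of _ "\<lambda>_. dig e"]) simp
next
  case (Suc h)
  then obtain e0 where e0: "tab h e0" "step h (dig e0) (dig e)" by auto
  from Suc.IH[OF e0(1)] obtain zs where zs: "init (zs 0)" "\<And>i. i < h \<Longrightarrow> step i (zs i) (zs (Suc i))" "zs h = dig e0"
    by blast
  show ?case
    by (rule exI[of _ "zs(Suc h := dig e)"]) (use zs e0(2) in \<open>auto simp: less_Suc_eq\<close>)
qed

lemma certified_iff_tab: "certified \<longleftrightarrow> (\<exists>e<codes. tab n e \<and> acc (dig e))"
proof
  assume certified
  then obtain zs where zs: "init (zs 0)" "\<And>h. h < n \<Longrightarrow> step h (zs h) (zs (Suc h))" "acc (zs n)"
    unfolding certified_def by blast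
  have "\<forall>j<width. zs h j < base" if "h \<le> n" for h
    using that
  proof (induction h)
    case 0
    then show ?case using init_digits[OF zs(1)] by blast
  next
    case (Suc h)
    then show ?case using step_digits[OF zs(2)] by simp
  qed
  then have "\<exists>e<codes. \<forall>j<width. dig e j = zs h j" if "h \<le> n" for h
    using digits_exist[of width "zs h" base] that unfolding codes_def dig_def by blast
  then have "\<forall>h\<in>{..n}. \<exists>e. e < codes \<and> (\<forall>j<width. dig e j = zs h j)" by blast
  from bchoice[OF this] obtain e where e: "\<And>h. h \<le> n \<Longrightarrow> e h < codes" "\<And>h j. h \<le> n \<Longrightarrow> j < width \<Longrightarrow> dig (e h) j = zs h j"
    by auto
  have "tab h (e h)" if "h \<le> n" for h
    using that
  proof (induction h)
    case 0
    then show ?case using init_agree[OF zs(1)] e(2) by simp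
  next
    case (Suc h)
    then have "step h (dig (e h)) (dig (e (Suc h)))" using step_agree[OF zs(2)] e(2) by simp
    then show ?case using Suc e(1)[of h] by auto
  qed
  moreover have "acc (dig (e n))" using acc_agree[OF zs(3)] e(2) by simp
  ultimately show "\<exists>e<codes. tab n e \<and> acc (dig e)" using e(1) by blast
next
  assume "\<exists>e<codes. tab n e \<and> acc (dig e)"
  then show certified using tab_chain unfolding certified_def by metis
qed

end

section \<open>From k-shortest graphs to level graphs\<close>

lemma set_vwalk_arcs: "set (vwalk_arcs p) = {(p ! j, p ! Suc j) | j. Suc j < length p}"
proof (induction p rule: vwalk_arcs.induct)
  case (3 x y xs)
  show ?case unfolding vwalk_arcs.simps list.set(2) 3
  proof (intro set_eqI iffI)
    fix e assume "e \<in> insert (x, y) {((y # xs) ! j, (y # xs) ! Suc j) | j. Suc j < length (y # xs)}"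
    then consider "e = (x, y)" | j where "Suc j < length (y # xs)" "e = ((y # xs) ! j, (y # xs) ! Suc j)" by blast
    then show "e \<in> {((x # y # xs) ! j, (x # y # xs) ! Suc j) | j. Suc j < length (x # y # xs)}"
    proof cases
      case 1 then show ?thesis by (intro CollectI exI[of _ 0]) simp
    next
      case 2 then show ?thesis by (intro CollectI exI[of _ "Suc j"]) simp
    qed
  next
    fix e assume "e \<in> {((x # y # xs) ! j, (x # y # xs) ! Suc j) | j. Suc j < length (x # y # xs)}"
    then obtain j where j: "Suc j < length (x # y # xs)" "e = ((x # y # xs) ! j, (x # y # xs) ! Suc j)" by blast
    then show "e \<in> insert (x, y) {((y # xs) ! j, (y # xs) ! Suc j) | j. Suc j < length (y # xs)}"
      by (cases j) auto
  qed
qed auto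

lemma internal_verts_map_upt:
  assumes "x \<le> y"
  shows "internal_verts (map p [x..<Suc y]) = p ` {x<..<y}"
proof -
  have t: "tl [x..<Suc y] = [Suc x..<Suc y]" using assms by (metis le_imp_less_Suc tl_upt)
  have b: "butlast [Suc x..<Suc y] = [Suc x..<y]"
  proof (cases "Suc x \<le> y")
    case True
    then show ?thesis by (simp only: upt_Suc if_True butlast_snoc)
  qed simp
  have "butlast (tl (map p [x..<Suc y])) = map p [Suc x..<y]"
    unfolding map_tl[symmetric] map_butlast[symmetric] t b ..
  then show ?thesis unfolding internal_verts_def by (simp only: set_map set_upt) (auto intro!: image_cong)
qed

text \<open>Parts are nonempty and disjoint. The bound keeps all levels below \<open>n\<close>, and
  so \<open>n\<close> time steps suffice.\<close>

lemma partition_length_le: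
  assumes "finite A" "partition_on A (set Ps)" "distinct Ps"
  shows "length Ps \<le> card A"
proof -
  have fin: "finite p" if "p \<in> set Ps" for p
    using assms(1,2) that unfolding partition_on_def by (metis Sup_upper finite_subset)
  have pos: "1 \<le> card p" if "p \<in> set Ps" for p
    using fin[OF that] that assms(2) unfolding partition_on_def by (metis One_nat_def Suc_leI card_gt_0_iff)
  have "length Ps = (\<Sum>p\<in>set Ps. 1)" using distinct_card[OF assms(3)] by simp
  also have "\<dots> \<le> (\<Sum>p\<in>set Ps. card p)" using pos by (rule sum_mono)
  also have "\<dots> = card (\<Union> (set Ps))"
    using assms(2) fin unfolding partition_on_def by (intro card_Union_disjoint[symmetric]) auto
  also have "\<dots> = card A" using assms(2) unfolding partition_on_def by simp
  finally show ?thesis .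
qed

lemma part_index_eq:
  assumes "partition_on A (set Ps)" "distinct Ps" "j < length Ps" "v \<in> Ps ! j"
  shows "part_index Ps v = j"
  unfolding part_index_def
proof (rule the_equality)
  fix i assume i: "i < length Ps \<and> v \<in> Ps ! i"
  have "Ps ! i = Ps ! j"
    using assms(1,3,4) i unfolding partition_on_def disjoint_def by (metis IntI empty_iff nth_mem)
  then show "i = j" using assms(2,3) i nth_eq_iff_index_eq by blast
qed (use assms in simp)

lemma part_index_props:
  assumes "partition_on A (set Ps)" "distinct Ps" "v \<in> A"
  shows "part_index Ps v < length Ps" "v \<in> Ps ! part_index Ps v"
proof -
  obtain j where j: "j < length Ps" "v \<in> Ps ! j"
    using assms(1,3) unfolding partition_on_def by (metis UnionE in_set_conv_nth)
  then show "part_index Ps v < length Ps" "v \<in> Ps ! part_index Ps v"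
    using part_index_eq[OF assms(1,2) j] by simp_all
qed

locale dsp_instance =
  fixes k n :: nat and G :: "nat pair_pre_digraph" and Vs :: "nat set list list"
    and sts :: "(nat \<times> nat) list" and c :: "nat \<Rightarrow> nat" and w :: nat
  assumes pv: "pverts G = {..<n}" and inst: "kdsp_instance k G Vs sts c"
begin

definition inp :: memory where "inp = input_memory G Vs sts c"
text \<open>Levels and adjacency are taken from the very memory cells that the program reads. They
  are therefore also defined for meaningless arguments, on which program and specification must
  agree as well.\<close>

definition lvl :: "nat \<Rightarrow> nat \<Rightarrow> nat" where "lvl d v = inp ''part'' (d * n + v)"
definition adj :: "nat \<Rightarrow> nat \<Rightarrow> bool" where "adj u v \<longleftrightarrow> inp ''adj'' (u * n + v) \<noteq> 0"

lemma inp_simps: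
  "inp ''n'' 0 = n" "inp ''l'' 0 = length sts"
  "i < length sts \<Longrightarrow> inp ''s'' i = fst (sts ! i)" "i < length sts \<Longrightarrow> inp ''t'' i = snd (sts ! i)"
  "i < length sts \<Longrightarrow> inp ''c'' i = c i"
  unfolding inp_def input_memory_def Let_def by (simp_all add: pv)

lemma ks: "k_shortest_graph k G Vs" and sts_sub: "set sts \<subseteq> {..<n} \<times> {..<n}" and c_lt: "i < length sts \<Longrightarrow> c i < k"
  using inst pv unfolding kdsp_instance_def by auto

lemma part: "d < k \<Longrightarrow> distinct (Vs ! d)" "d < k \<Longrightarrow> partition_on {..<n} (set (Vs ! d))" and len: "length Vs = k"
  using ks pv unfolding k_shortest_graph_def by auto

lemma pg: "pair_graph G" using ks unfolding k_shortest_graph_def by blast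

lemma mul_add_less: "d < (k::nat) \<Longrightarrow> v < n \<Longrightarrow> d * n + v < k * n"
proof -
  assume "d < k" "v < n"
  then have "d * n + v < Suc d * n" by simp
  also have "\<dots> \<le> k * n" using \<open>d < k\<close> by (intro mult_le_mono1) simp
  finally show ?thesis .
qed

lemma lvl_eq: "d < k \<Longrightarrow> v < n \<Longrightarrow> lvl d v = part_index (Vs ! d) v"
  using mul_add_less[of d v] unfolding lvl_def inp_def input_memory_def Let_def by (simp add: pv len)

lemma adj_iff: "u < n \<Longrightarrow> v < n \<Longrightarrow> adj u v \<longleftrightarrow> (u, v) \<in> parcs G"
proof -
  assume uv: "u < n" "v < n"
  have "u * n + v < Suc u * n" using uv by simp
  also have "\<dots> \<le> n * n" using uv by (intro mult_le_mono1) simp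
  finally show ?thesis using uv unfolding adj_def inp_def input_memory_def Let_def by (simp add: pv)
qed

lemma arc_less: "(u, v) \<in> parcs G \<Longrightarrow> u < n" "(u, v) \<in> parcs G \<Longrightarrow> v < n"
  using pair_wf_digraph.in_arcsD1[of G u v] pair_wf_digraph.in_arcsD2[of G u v] pg pv
  unfolding pair_graph_def pair_digraph_def pair_fin_digraph_def by auto

lemma arc_sym: "(u, v) \<in> parcs G \<Longrightarrow> (v, u) \<in> parcs G"
proof -
  have "symmetric (with_proj G)" using pg
    unfolding pair_graph_def pair_pseudo_graph_def pair_sym_digraph_def pair_sym_digraph_axioms_def by blast
  then show "(u, v) \<in> parcs G \<Longrightarrow> (v, u) \<in> parcs G" unfolding symmetric_def by (auto elim: symE)
qed

lemma mem_part: "d < k \<Longrightarrow> j < length (Vs ! d) \<Longrightarrow> v \<in> Vs ! d ! j \<Longrightarrow> lvl d v = j"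
proof -
  assume *: "d < k" "j < length (Vs ! d)" "v \<in> Vs ! d ! j"
  then have "v < n" using part(2)[OF *(1)] unfolding partition_on_def by (metis UnionI lessThan_iff nth_mem)
  then show "lvl d v = j" using part_index_eq[OF part(2,1) *(2,3)] * lvl_eq by simp
qed

lemma lvl_mem: "d < k \<Longrightarrow> v < n \<Longrightarrow> lvl d v < length (Vs ! d)" "d < k \<Longrightarrow> v < n \<Longrightarrow> v \<in> Vs ! d ! lvl d v"
  using part_index_props[OF part(2,1), of d v] lvl_eq by auto

sublocale level_graph n k "length sts" w lvl adj "inp ''s''" "inp ''t''" c
proof
  show "adj v u" if "u < n" "v < n" "adj u v" for u v
    using that arc_sym adj_iff by blast
  show "absd (lvl d u) (lvl d v) \<le> 1" if "u < n" "v < n" "d < k" "adj u v" for u v d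
  proof -
    have a: "(u, v) \<in> parcs G" using that adj_iff by blast
    have "\<forall>i<k. \<forall>j<length (Vs ! i). \<forall>r<length (Vs ! i). \<forall>x \<in> Vs ! i ! j. \<forall>y \<in> Vs ! i ! r.
        \<bar>int j - int r\<bar> > 1 \<longrightarrow> (x, y) \<notin> parcs G" using ks unfolding k_shortest_graph_def by blast
    then have "\<not> \<bar>int (lvl d u) - int (lvl d v)\<bar> > 1"
      using lvl_mem[OF that(3,1)] lvl_mem[OF that(3,2)] that(3) a by blast
    then show ?thesis unfolding absd_def by linarith
  qed
  show "lvl d v < n" if "v < n" "d < k" for v d
    using lvl_mem(1)[OF that(2,1)] partition_length_le[OF _ part(2,1)[OF that(2)]] by simp
  show "c i < k" if "i < length sts" for i using c_lt[OF that] .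
  show "inp ''s'' i < n" "inp ''t'' i < n" if "i < length sts" for i
    using subsetD[OF sts_sub nth_mem[OF that]] that by (auto simp: inp_simps mem_Times_iff)
qed

text \<open>Parts are disjoint, so the index of the part is determined by the vertex, and the order
  condition selects the upward direction of the edge.\<close>

lemma col_edge_le_iff:
  assumes i: "i < k"
  shows "col_edge G Vs i x y \<and> le_col Vs i x y \<longleftrightarrow> (x, y) \<in> parcs G \<and> lvl i y = Suc (lvl i x)"
proof
  assume "col_edge G Vs i x y \<and> le_col Vs i x y"
  then obtain j j' r where *: "(x, y) \<in> parcs G" "Suc j < length (Vs ! i)"
    "x \<in> Vs ! i ! j \<and> y \<in> Vs ! i ! Suc j \<or> y \<in> Vs ! i ! j \<and> x \<in> Vs ! i ! Suc j"
    "j' \<le> r" "r < length (Vs ! i)" "x \<in> Vs ! i ! j'" "y \<in> Vs ! i ! r"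
    unfolding col_edge_def le_col_def by blast
  then show "(x, y) \<in> parcs G \<and> lvl i y = Suc (lvl i x)"
    using mem_part[OF i, of j] mem_part[OF i, of "Suc j"] mem_part[OF i, of j'] mem_part[OF i, of r] by force
next
  assume *: "(x, y) \<in> parcs G \<and> lvl i y = Suc (lvl i x)"
  then have "x < n" "y < n" using arc_less by blast+
  then have "Suc (lvl i x) < length (Vs ! i)" "x \<in> Vs ! i ! lvl i x" "y \<in> Vs ! i ! Suc (lvl i x)"
    using lvl_mem[OF i] * by metis+
  then show "col_edge G Vs i x y \<and> le_col Vs i x y"
    unfolding col_edge_def le_col_def using * by (meson Suc_lessD le_SucI order.refl)
qed

lemma col_path_iff:
  assumes i: "i < k"
  shows "col_path G Vs i xs \<longleftrightarrow> xs \<noteq> [] \<and> set xs \<subseteq> {..<n} \<and>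
     (\<forall>j. Suc j < length xs \<longrightarrow> (xs ! j, xs ! Suc j) \<in> parcs G \<and> lvl i (xs ! Suc j) = Suc (lvl i (xs ! j)))"
    (is "?l \<longleftrightarrow> ?r")
proof
  assume ?l
  then show ?r unfolding col_path_def vpath_def vwalk_def col_edge_le_iff[OF i] pv by (simp add: pv)
next
  assume r: ?r
  have lev: "lvl i (xs ! j) = lvl i (xs ! 0) + j" if "j < length xs" for j
    using that
  proof (induction j)
    case (Suc j) then show ?case using r by simp
  qed simp
  \<comment> \<open>The level rises along the list, so vertices cannot repeat and the path condition
    comes for free.\<close>
  have "distinct xs" unfolding distinct_conv_nth using lev by (metis add_left_cancel)
  moreover have "set (vwalk_arcs xs) \<subseteq> parcs G" unfolding set_vwalk_arcs using r by blast
  ultimately show ?l using r unfolding col_path_def vpath_def vwalk_def col_edge_le_iff[OF i] by (simp add: pv)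
qed

lemma col_path_lpath:
  assumes i: "i < k" and xs: "col_path G Vs i xs"
  defines "p \<equiv> \<lambda>h. xs ! (h - lvl i (hd xs))"
  shows "lpath i (hd xs) (last xs) p" "xs = map p [lvl i (hd xs)..<Suc (lvl i (last xs))]"
proof -
  note r = xs[unfolded col_path_iff[OF i]]
  have lev: "lvl i (xs ! j) = lvl i (hd xs) + j" if "j < length xs" for j
    using that
  proof (induction j)
    case 0 then show ?case by (simp add: hd_conv_nth)
  next
    case (Suc j) then show ?case using r by simp
  qed
  have last: "lvl i (last xs) = lvl i (hd xs) + (length xs - 1)"
    using lev[of "length xs - 1"] r by (simp add: last_conv_nth)
  have pos: "0 < length xs" using r by simp
  show "xs = map p [lvl i (hd xs)..<Suc (lvl i (last xs))]"
    by (rule nth_equalityI) (use last pos in \<open>auto simp: p_def nth_append simp del: upt_Suc\<close>)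
  have in_n: "xs ! j < n" if "j < length xs" for j using r nth_mem[OF that] by blast
  show "lpath i (hd xs) (last xs) p" unfolding lpath_def
  proof (intro conjI allI impI)
    show "lvl i (hd xs) \<le> lvl i (last xs)" using last by simp
    show "p (lvl i (hd xs)) = hd xs" unfolding p_def using pos by (simp add: hd_conv_nth)
    show "p (lvl i (last xs)) = last xs" unfolding p_def last using pos by (simp add: last_conv_nth)
    fix h assume h: "lvl i (hd xs) \<le> h"
    have "h - lvl i (hd xs) < length xs" if "h \<le> lvl i (last xs)" using last that h pos by linarith
    then show "p h < n" "lvl i (p h) = h" if "h \<le> lvl i (last xs)"
      unfolding p_def using lev[of "h - lvl i (hd xs)"] in_n[of "h - lvl i (hd xs)"] that h by simp_all
    show "adj (p h) (p (Suc h))" if "h < lvl i (last xs)"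
    proof -
      let ?j = "h - lvl i (hd xs)"
      have j: "Suc ?j < length xs" using last that h by linarith
      then have "(xs ! ?j, xs ! Suc ?j) \<in> parcs G" using r by blast
      then show ?thesis unfolding p_def using adj_iff in_n j h by (simp add: Suc_diff_le)
    qed
  qed
qed

lemma lpath_col_path:
  assumes i: "i < k" and p: "lpath i x y p"
  shows "col_path G Vs i (map p [lvl i x..<Suc (lvl i y)])" "hd (map p [lvl i x..<Suc (lvl i y)]) = x"
    "last (map p [lvl i x..<Suc (lvl i y)]) = y"
proof -
  note d = lpathD[OF p]
  let ?xs = "map p [lvl i x..<Suc (lvl i y)]"
  have nth: "?xs ! j = p (lvl i x + j)" if "j < Suc (lvl i y) - lvl i x" for j
    using that by (simp del: upt_Suc)
  have nlen: "length ?xs = Suc (lvl i y) - lvl i x" by (simp del: upt_Suc)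
  show "hd ?xs = x" using d(1,2) by (simp add: hd_map del: upt_Suc)
  show "last ?xs = y" using d(1,3) by simp
  show "col_path G Vs i ?xs" unfolding col_path_iff[OF i]
  proof (intro conjI allI impI)
    show "?xs \<noteq> []" using d(1) by simp
    show "set ?xs \<subseteq> {..<n}" using d(4) by (auto simp del: upt_Suc)
    fix j assume j: "Suc j < length ?xs"
    then have b: "lvl i x + j < lvl i y" unfolding nlen by linarith
    have e: "?xs ! j = p (lvl i x + j)" "?xs ! Suc j = p (Suc (lvl i x + j))"
      using nth[of j] nth[of "Suc j"] b by simp_all
    show "(?xs ! j, ?xs ! Suc j) \<in> parcs G"
      unfolding e using adj_iff[OF d(4) d(4), of "lvl i x + j" "Suc (lvl i x + j)"] d(6)[OF _ b] b by simp
    show "lvl i (?xs ! Suc j) = Suc (lvl i (?xs ! j))"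
      unfolding e using d(5)[of "lvl i x + j"] d(5)[of "Suc (lvl i x + j)"] b by simp
  qed
qed

lemma solvable_iff_solution: "kdsp_solvable G Vs sts c \<longleftrightarrow> (\<exists>\<sigma> \<tau> \<pi>. solution \<sigma> \<tau> \<pi>)"
proof
  assume "kdsp_solvable G Vs sts c"
  then obtain P where P: "\<And>i. i < length sts \<Longrightarrow> col_path_between G Vs (c i) (fst (sts ! i)) (snd (sts ! i)) (P i)"
    and dj: "\<And>i j. i < length sts \<Longrightarrow> j < length sts \<Longrightarrow> i \<noteq> j \<Longrightarrow> internally_disjoint (P i) (P j)"
    unfolding kdsp_solvable_def by blast
  define \<pi> where "\<pi> i h = P i ! (h - lvl (c i) (hd (P i)))" for i h
  have cp: "col_path G Vs (c i) (P i)" if "i < length sts" for i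
    using P[OF that] unfolding col_path_between_def by blast
  have lp: "lpath (c i) (hd (P i)) (last (P i)) (\<pi> i)"
    and eq: "P i = map (\<pi> i) [lvl (c i) (hd (P i))..<Suc (lvl (c i) (last (P i)))]" if "i < length sts" for i
    using col_path_lpath[OF c_lt[OF that] cp[OF that]] unfolding \<pi>_def[abs_def] by blast+
  have sol: "\<pi> i h \<noteq> \<pi> j h'" if ij: "i < length sts" "j < length sts" "i \<noteq> j"
    and h: "lvl (c i) (hd (P i)) < h" "h < lvl (c i) (last (P i))"
      "lvl (c j) (hd (P j)) \<le> h'" "h' \<le> lvl (c j) (last (P j))" for i j h h'
  proof -
    have 1: "\<pi> i h \<in> internal_verts (P i)"
      using internal_verts_map_upt[OF lpathD(1)[OF lp[OF ij(1)]], of "\<pi> i"] h eq[OF ij(1)] by (metis greaterThanLessThan_iff imageI)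
    have "\<pi> j h' \<in> \<pi> j ` set [lvl (c j) (hd (P j))..<Suc (lvl (c j) (last (P j)))]"
      using h(3,4) by (intro imageI) (simp del: upt_Suc)
    then have 2: "\<pi> j h' \<in> set (P j)" using eq[OF ij(2)] by (metis set_map)
    show ?thesis using 1 2 dj[OF ij] unfolding internally_disjoint_def by auto
  qed
  have ends: "hd (P i) = inp ''s'' i \<and> last (P i) = inp ''t'' i \<or> hd (P i) = inp ''t'' i \<and> last (P i) = inp ''s'' i"
    if "i < length sts" for i
    using P[OF that] that unfolding col_path_between_def by (simp add: inp_simps)
  have "solution (\<lambda>i. hd (P i)) (\<lambda>i. last (P i)) \<pi>"
    unfolding solution_def using ends lp sol by blast
  then show "\<exists>\<sigma> \<tau> \<pi>. solution \<sigma> \<tau> \<pi>" by blast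
next
  assume "\<exists>\<sigma> \<tau> \<pi>. solution \<sigma> \<tau> \<pi>"
  then obtain \<sigma> \<tau> \<pi> where sol: "solution \<sigma> \<tau> \<pi>" by blast
  have ends: "\<sigma> i = fst (sts ! i) \<and> \<tau> i = snd (sts ! i) \<or> \<sigma> i = snd (sts ! i) \<and> \<tau> i = fst (sts ! i)"
    and lp: "lpath (c i) (\<sigma> i) (\<tau> i) (\<pi> i)" if "i < length sts" for i
    using sol that unfolding solution_def by (auto simp: inp_simps)
  have dj: "\<pi> i h \<noteq> \<pi> j h'" if "i < length sts" "j < length sts" "i \<noteq> j"
    "lvl (c i) (\<sigma> i) < h" "h < lvl (c i) (\<tau> i)" "lvl (c j) (\<sigma> j) \<le> h'" "h' \<le> lvl (c j) (\<tau> j)" for i j h h'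
    using sol that unfolding solution_def by blast
  define P where "P i = map (\<pi> i) [lvl (c i) (\<sigma> i)..<Suc (lvl (c i) (\<tau> i))]" for i
  have "col_path_between G Vs (c i) (fst (sts ! i)) (snd (sts ! i)) (P i)" if "i < length sts" for i
    using lpath_col_path[OF c_lt[OF that] lp[OF that]] ends[OF that]
    unfolding col_path_between_def P_def[symmetric] by auto
  moreover have "internal_verts (P i) \<inter> set (P j) = {}" if "i < length sts" "j < length sts" "i \<noteq> j" for i j
  proof -
    have "internal_verts (P i) = \<pi> i ` {lvl (c i) (\<sigma> i)<..<lvl (c i) (\<tau> i)}"
      unfolding P_def using internal_verts_map_upt[OF lpathD(1)[OF lp[OF that(1)]]] .
    moreover have "set (P j) = \<pi> j ` {lvl (c j) (\<sigma> j)..lvl (c j) (\<tau> j)}"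
      unfolding P_def set_map set_upt by (simp add: atLeastLessThanSuc_atLeastAtMost)
    ultimately show ?thesis using dj[OF that] by auto
  qed
  ultimately show "kdsp_solvable G Vs sts c"
    unfolding kdsp_solvable_def internally_disjoint_def by (intro exI[of _ P]) blast
qed

theorem solvable_iff_tab:
  assumes "0 < k" "w = 2 * (5 * k * k * length sts) ^ (2 ^ k)"
  shows "kdsp_solvable G Vs sts c \<longleftrightarrow> (\<exists>e<codes. tab n e \<and> acc (dig e))"
proof -
  have "0 < length sts \<Longrightarrow> 0 < w" using assms by simp
  then show ?thesis
    unfolding solvable_iff_solution certified_iff_tab[symmetric]
    using certified_sound certified_complete assms by blast
qed

end

section \<open>Evaluation of bounded formulas by programs\<close>

text \<open>The shift by 2 keeps the base of the power above 1 also at \<open>B = 0\<close>, so that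
  powers may be compared by their exponents.\<close>

definition poly_bounded :: "(nat \<Rightarrow> nat) \<Rightarrow> bool" where
  "poly_bounded T \<longleftrightarrow> (\<exists>K d. \<forall>B. T B \<le> K * (B + 2) ^ d)"

lemma poly_bounded_const: "poly_bounded (\<lambda>_. m)"
  unfolding poly_bounded_def by (rule exI[of _ m], rule exI[of _ 0]) simp

lemma poly_bounded_id: "poly_bounded (\<lambda>B. B)"
  unfolding poly_bounded_def by (rule exI[of _ 1], rule exI[of _ 1]) simp

lemma poly_bounded_add:
  assumes "poly_bounded S" "poly_bounded T"
  shows "poly_bounded (\<lambda>B. S B + T B)"
proof -
  obtain K d K' d' where *: "\<And>B. S B \<le> K * (B + 2) ^ d" "\<And>B. T B \<le> K' * (B + 2) ^ d'"
    using assms unfolding poly_bounded_def by blast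
  have "S B + T B \<le> (K + K') * (B + 2) ^ (d + d')" for B
  proof -
    have "K * (B + 2) ^ d \<le> K * (B + 2) ^ (d + d')" "K' * (B + 2) ^ d' \<le> K' * (B + 2) ^ (d + d')"
      by (intro mult_le_mono2 power_increasing; simp)+
    then show ?thesis using *[of B] unfolding add_mult_distrib by linarith
  qed
  then show ?thesis unfolding poly_bounded_def by blast
qed

lemma poly_bounded_mult:
  assumes "poly_bounded S" "poly_bounded T"
  shows "poly_bounded (\<lambda>B. S B * T B)"
proof -
  obtain K d K' d' where *: "\<And>B. S B \<le> K * (B + 2) ^ d" "\<And>B. T B \<le> K' * (B + 2) ^ d'"
    using assms unfolding poly_bounded_def by blast
  have "S B * T B \<le> (K * K') * (B + 2) ^ (d + d')" for B
    using mult_le_mono[OF *[of B]] by (simp only: power_add ac_simps)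
  then show ?thesis unfolding poly_bounded_def by blast
qed

lemmas poly_bounded_intros = poly_bounded_add poly_bounded_mult poly_bounded_id poly_bounded_const

abbreviation V :: "nat \<Rightarrow> exp" where "V x \<equiv> Read ''v'' (Const x)"
abbreviation Flag :: exp where "Flag \<equiv> Read ''f'' (Const 0)"
abbreviation Scalar :: "string \<Rightarrow> exp" where "Scalar a \<equiv> Read a (Const 0)"

text \<open>
  Bounded first-order formulas over the memory. The variable bound at quantifier depth \<open>x\<close> lives in
  cell \<open>x\<close> of the array \<open>v\<close>, and the array \<open>f\<close> receives the truth value; the side conditions
  \<open>exp_ok\<close> and \<open>fm_ok\<close> express that a formula at depth \<open>d\<close> depends on the cells below \<open>d\<close> only.
\<close>

datatype fm = Tst exp | Neg fm | Conj fm fm | Exi nat string fm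

definition setv :: "nat \<Rightarrow> nat \<Rightarrow> memory \<Rightarrow> memory" where
  "setv x u M = M(''v'' := (M ''v'')(x := u))"

primrec fval :: "fm \<Rightarrow> memory \<Rightarrow> bool" where
  "fval (Tst e) M \<longleftrightarrow> exp_val e M \<noteq> 0"
| "fval (Neg p) M \<longleftrightarrow> \<not> fval p M"
| "fval (Conj p q) M \<longleftrightarrow> fval p M \<and> fval q M"
| "fval (Exi x b p) M \<longleftrightarrow> (\<exists>u<M b 0. fval p (setv x u M))"

primrec exp_ok :: "nat \<Rightarrow> exp \<Rightarrow> bool" where
  "exp_ok d (Const m) \<longleftrightarrow> True"
| "exp_ok d (Read a e) \<longleftrightarrow> (if a = ''v'' then (\<exists>i<d. e = Const i) else a \<noteq> ''f'' \<and> exp_ok d e)"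
| "exp_ok d (Plus e1 e2) \<longleftrightarrow> exp_ok d e1 \<and> exp_ok d e2"
| "exp_ok d (Minus e1 e2) \<longleftrightarrow> exp_ok d e1 \<and> exp_ok d e2"

primrec fm_ok :: "nat \<Rightarrow> fm \<Rightarrow> bool" where
  "fm_ok d (Tst e) \<longleftrightarrow> exp_ok d e"
| "fm_ok d (Neg p) \<longleftrightarrow> fm_ok d p"
| "fm_ok d (Conj p q) \<longleftrightarrow> fm_ok d p \<and> fm_ok d q"
| "fm_ok d (Exi x b p) \<longleftrightarrow> x = d \<and> b \<noteq> ''v'' \<and> b \<noteq> ''f'' \<and> fm_ok (Suc d) p"

primrec bounds :: "fm \<Rightarrow> string set" where
  "bounds (Tst e) = {}"
| "bounds (Neg p) = bounds p"
| "bounds (Conj p q) = bounds p \<union> bounds q"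
| "bounds (Exi x b p) = insert b (bounds p)"

text \<open>In the loop for \<open>Exi\<close>, a success moves the counter to the bound, which ends
  the loop with the flag still set; after a failure the flag is 0 from the last evaluation of the
  body. The initial reset of the flag serves the empty range.\<close>

primrec eval_fm :: "fm \<Rightarrow> com" where
  "eval_fm (Tst e) = If e (Write ''f'' (Const 0) (Const 1)) (Write ''f'' (Const 0) (Const 0))"
| "eval_fm (Neg p) = Seq (eval_fm p) (Write ''f'' (Const 0) (Minus (Const 1) Flag))"
| "eval_fm (Conj p q) = Seq (eval_fm p) (If Flag (eval_fm q) Skip)"
| "eval_fm (Exi x b p) = Seq (Write ''f'' (Const 0) (Const 0)) (Seq (Write ''v'' (Const x) (Const 0))
     (While (Minus (Scalar b) (V x)) (Seq (eval_fm p)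
        (If Flag (Write ''v'' (Const x) (Scalar b)) (Write ''v'' (Const x) (Plus (V x) (Const 1)))))))"

primrec fm_time :: "fm \<Rightarrow> nat \<Rightarrow> nat" where
  "fm_time (Tst e) B = exp_time e + 10"
| "fm_time (Neg p) B = fm_time p B + 10"
| "fm_time (Conj p q) B = fm_time p B + fm_time q B + 10"
| "fm_time (Exi x b p) B = B * (fm_time p B + 20) + 40"

lemma poly_bounded_fm_time: "poly_bounded (fm_time p)"
proof (induction p)
  case (Tst e)
  show ?case unfolding fm_time.simps by (intro poly_bounded_intros)
next
  case (Neg p)
  show ?case unfolding fm_time.simps by (intro poly_bounded_intros Neg)
next
  case (Conj p q)
  show ?case unfolding fm_time.simps by (intro poly_bounded_intros Conj)
next
  case (Exi x b p)
  show ?case unfolding fm_time.simps by (intro poly_bounded_intros Exi)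
qed

definition agree :: "nat \<Rightarrow> memory \<Rightarrow> memory \<Rightarrow> bool" where
  "agree d M M' \<longleftrightarrow> (\<forall>a. a \<noteq> ''v'' \<longrightarrow> a \<noteq> ''f'' \<longrightarrow> M' a = M a) \<and> (\<forall>i<d. M' ''v'' i = M ''v'' i)"

lemma agree_array: "agree d M M' \<Longrightarrow> a \<noteq> ''v'' \<Longrightarrow> a \<noteq> ''f'' \<Longrightarrow> M' a = M a"
  unfolding agree_def by blast

lemma agree_trans: "agree d M M' \<Longrightarrow> agree d M' M'' \<Longrightarrow> agree d M M''"
  unfolding agree_def by simp

lemma agree_mono: "agree d M M' \<Longrightarrow> d' \<le> d \<Longrightarrow> agree d' M M'"
  unfolding agree_def by simp

lemma agree_flag: "agree d M (M(''f'' := g))"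
  unfolding agree_def by simp

lemma agree_v: "d \<le> x \<Longrightarrow> agree d M (M(''v'' := (M ''v'')(x := u)))"
  unfolding agree_def by simp

lemma agree_setv: "agree d M M' \<Longrightarrow> M' ''v'' d = u \<Longrightarrow> agree (Suc d) (setv d u M) M'"
  unfolding agree_def setv_def by (auto simp: less_Suc_eq)

lemma agree_setv2: "agree d M M' \<Longrightarrow> agree (Suc d) (setv d u M) (setv d u M')"
  unfolding agree_def setv_def by (auto simp: less_Suc_eq)

lemma exp_agree: "agree d M M' \<Longrightarrow> exp_ok d e \<Longrightarrow> exp_val e M' = exp_val e M"
proof (induction e)
  case (Read a e)
  show ?case
  proof (cases "a = ''v''")
    case True
    then obtain i where "i < d" "e = Const i" using Read.prems(2) by auto
    then show ?thesis using Read.prems(1) True unfolding agree_def by simp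
  next
    case False
    then have "a \<noteq> ''f''" "exp_val e M' = exp_val e M" using Read by auto
    then show ?thesis using Read.prems(1) False unfolding agree_def by simp
  qed
qed simp_all

lemma fm_agree: "agree d M M' \<Longrightarrow> fm_ok d p \<Longrightarrow> fval p M' \<longleftrightarrow> fval p M"
proof (induction p arbitrary: d M M')
  case (Tst e)
  then show ?case using exp_agree by simp
next
  case (Exi x b p)
  have "fval p (setv x u M') = fval p (setv x u M)" for u
    using Exi.IH[OF agree_setv2[OF Exi.prems(1)]] Exi.prems(2) by simp
  moreover have "M' b 0 = M b 0" using Exi.prems unfolding agree_def by simp
  ultimately show ?case by simp
next
  case (Conj p q)
  then show ?case using Conj.IH[OF Conj.prems(1)] by simp
next
  case (Neg p)
  then show ?case using Neg.IH[OF Neg.prems(1)] by simp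
qed

lemma bounds_ok: "fm_ok d p \<Longrightarrow> b \<in> bounds p \<Longrightarrow> b \<noteq> ''v'' \<and> b \<noteq> ''f''"
  by (induction p arbitrary: d) auto

lemma exec_eval_fm:
  assumes "fm_ok d p" and "\<And>b. b \<in> bounds p \<Longrightarrow> M b 0 \<le> B"
  shows "\<exists>t M'. exec (eval_fm p) M t M' \<and> t \<le> fm_time p B \<and> agree d M M' \<and>
    M' ''f'' 0 = (if fval p M then 1 else 0)"
  using assms
proof (induction p arbitrary: d M)
  case (Tst e)
  show ?case
  proof (cases "exp_val e M = 0")
    case True
    show ?thesis
      by (intro exI conjI, unfold eval_fm.simps, rule exec.IfFalse[OF True], rule exec.Write)
        (use True in \<open>auto simp: agree_def\<close>)
  next
    case False
    show ?thesis
      by (intro exI conjI, unfold eval_fm.simps, rule exec.IfTrue[OF False], rule exec.Write)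
        (use False in \<open>auto simp: agree_def\<close>)
  qed
next
  case (Neg p)
  have ok: "fm_ok d p" and bb: "\<And>b. b \<in> bounds p \<Longrightarrow> M b 0 \<le> B" using Neg.prems by simp_all
  obtain t M' where IH: "exec (eval_fm p) M t M'" "t \<le> fm_time p B" "agree d M M'"
    "M' ''f'' 0 = (if fval p M then 1 else 0)" using Neg.IH[of d M, OF ok bb] by blast
  show ?case
    by (intro exI conjI, unfold eval_fm.simps, rule exec.Seq[OF IH(1)], rule exec.Write)
      (use IH(2-) in \<open>auto simp: agree_def\<close>)
next
  case (Conj p q)
  have ok: "fm_ok d p" and bb: "\<And>b. b \<in> bounds p \<Longrightarrow> M b 0 \<le> B" using Conj.prems by simp_all
  obtain t M' where IH: "exec (eval_fm p) M t M'" "t \<le> fm_time p B" "agree d M M'"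
    "M' ''f'' 0 = (if fval p M then 1 else 0)" using Conj.IH(1)[of d M, OF ok bb] by blast
  show ?case
  proof (cases "fval p M")
    case False
    show ?thesis
      by (intro exI conjI, unfold eval_fm.simps, rule exec.Seq[OF IH(1)], rule exec.IfFalse[OF _ exec.Skip])
        (use False IH(2-) in auto)
  next
    case True
    have okq: "fm_ok d q" using Conj.prems(1) by simp
    have bq: "M' b 0 \<le> B" if "b \<in> bounds q" for b
    proof -
      have "M' b 0 = M b 0" using agree_array[OF IH(3)] bounds_ok[OF okq that] by simp
      then show ?thesis using Conj.prems(2)[of b] that by simp
    qed
    obtain u M'' where IH': "exec (eval_fm q) M' u M''" "u \<le> fm_time q B" "agree d M' M''"
      "M'' ''f'' 0 = (if fval q M' then 1 else 0)" using Conj.IH(2)[of d M', OF okq bq] by blast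
    have "fval q M' = fval q M" using fm_agree[OF IH(3)] Conj.prems(1) by simp
    moreover have "exec (eval_fm (Conj p q)) M (t + (exp_time Flag + u + 1)) M''"
      unfolding eval_fm.simps by (rule exec.Seq[OF IH(1) exec.IfTrue[OF _ IH'(1)]]) (use IH(4) True in simp)
    ultimately show ?thesis
      using True IH(2) IH'(2,4) agree_trans[OF IH(3) IH'(3)]
      by (intro exI[of _ "t + (exp_time Flag + u + 1)"] exI[of _ M'']) simp
  qed
next
  case (Exi x b p)
  have x: "x = d" and b: "b \<noteq> ''v''" "b \<noteq> ''f''" and ok: "fm_ok (Suc d) p" using Exi.prems(1) by auto
  let ?m = "M b 0"
  let ?W = "While (Minus (Scalar b) (V x)) (Seq (eval_fm p)
        (If Flag (Write ''v'' (Const x) (Scalar b)) (Write ''v'' (Const x) (Plus (V x) (Const 1)))))"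
  note bnd = bounds_ok[OF ok]
  \<comment> \<open>\<open>r\<close> counts the candidates still to be tried, and the cleared flag
    records that the earlier ones have failed.\<close>
  have loop: "\<exists>t M'. exec ?W N t M' \<and> t \<le> r * (fm_time p B + 20) + 10 \<and> agree d M M' \<and>
      M' ''f'' 0 = (if \<exists>u<?m. ?m - r \<le> u \<and> fval p (setv d u M) then 1 else 0)"
    if "agree d M N" "N ''v'' d = ?m - r" "r \<le> ?m" "N ''f'' 0 = 0" for r N
    using that
  proof (induction r arbitrary: N)
    case 0
    have Nb: "N b 0 = ?m" using agree_array[OF 0(1) b] by simp
    have "exp_val (Minus (Scalar b) (V x)) N = 0" using 0 Nb x by simp
    from exec.WhileFalse[OF this] show ?case using 0
      by (intro exI[of _ "exp_time (Minus (Scalar b) (V x)) + 1"] exI[of _ N]) simp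
  next
    case (Suc r)
    let ?i = "?m - Suc r"
    have Nb: "N b 0 = ?m" using agree_array[OF Suc.prems(1) b] by simp
    have ne: "exp_val (Minus (Scalar b) (V x)) N \<noteq> 0" using Suc.prems Nb x by simp
    have "\<And>c. c \<in> bounds p \<Longrightarrow> N c 0 \<le> B"
      using agree_array[OF Suc.prems(1)] bnd Exi.prems(2) by simp
    from Exi.IH[of "Suc d" N, OF ok this] obtain t M' where IH: "exec (eval_fm p) N t M'" "t \<le> fm_time p B"
      "agree (Suc d) N M'" "M' ''f'' 0 = (if fval p N then 1 else 0)" by blast
    have feq: "fval p N = fval p (setv d ?i M)"
      using fm_agree[OF agree_setv[OF Suc.prems(1,2)] ok] .
    have Mv: "M' ''v'' d = ?i" using IH(3) Suc.prems(2) unfolding agree_def by simp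
    have ag: "agree d M M'" using agree_trans[OF Suc.prems(1) agree_mono[OF IH(3)]] by simp
    have M'b: "M' b 0 = ?m" using agree_array[OF ag b] by simp
    show ?case
    proof (cases "fval p N")
      case True
      let ?M2 = "M'(''v'' := (M' ''v'')(x := ?m))"
      have w: "exec (Write ''v'' (Const x) (Scalar b)) M' 4 ?M2"
        using exec.Write[of "''v''" "Const x" "Scalar b" M'] M'b by (simp add: eval_nat_numeral)
      have body: "exec (Seq (eval_fm p) (If Flag (Write ''v'' (Const x) (Scalar b))
          (Write ''v'' (Const x) (Plus (V x) (Const 1))))) N (t + (exp_time Flag + 4 + 1)) ?M2"
        using True IH(4) by (intro exec.Seq[OF IH(1)] exec.IfTrue[OF _ w]) simp
      have z: "exp_val (Minus (Scalar b) (V x)) ?M2 = 0" using M'b b by simp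
      have "exec ?W N (exp_time (Minus (Scalar b) (V x)) + (t + (exp_time Flag + 4 + 1)) + (exp_time (Minus (Scalar b) (V x)) + 1) + 1) ?M2"
        by (rule exec.WhileTrue[OF ne body exec.WhileFalse[OF z]])
      moreover have "agree d M ?M2" by (rule agree_trans[OF ag agree_v]) (simp add: x)
      moreover have "\<exists>u<?m. ?i \<le> u \<and> fval p (setv d u M)" using True feq Suc.prems(3) by (intro exI[of _ ?i]) simp
      moreover have "?M2 ''f'' 0 = 1" using IH(4) True by simp
      ultimately show ?thesis using IH(2)
        by (intro exI[of _ "exp_time (Minus (Scalar b) (V x)) + (t + (exp_time Flag + 4 + 1)) + (exp_time (Minus (Scalar b) (V x)) + 1) + 1"]
            exI[of _ ?M2]) (simp del: fun_upd_apply)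
    next
      case False
      let ?M2 = "M'(''v'' := (M' ''v'')(x := ?m - r))"
      have w: "exec (Write ''v'' (Const x) (Plus (V x) (Const 1))) M' 6 ?M2"
        using exec.Write[of "''v''" "Const x" "Plus (V x) (Const 1)" M'] Mv x Suc.prems(3)
        by (simp add: Suc_diff_Suc eval_nat_numeral)
      have body: "exec (Seq (eval_fm p) (If Flag (Write ''v'' (Const x) (Scalar b))
          (Write ''v'' (Const x) (Plus (V x) (Const 1))))) N (t + (exp_time Flag + 6 + 1)) ?M2"
        using False IH(4) by (intro exec.Seq[OF IH(1)] exec.IfFalse[OF _ w]) simp
      have "agree d M ?M2" by (rule agree_trans[OF ag agree_v]) (simp add: x)
      moreover have "?M2 ''v'' d = ?m - r" using x by simp
      moreover have "?M2 ''f'' 0 = 0" using IH(4) False by simp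
      ultimately obtain u M3 where u: "exec ?W ?M2 u M3" "u \<le> r * (fm_time p B + 20) + 10" "agree d M M3"
        "M3 ''f'' 0 = (if \<exists>u<?m. ?m - r \<le> u \<and> fval p (setv d u M) then 1 else 0)"
        using Suc.IH[of ?M2] Suc_leD[OF Suc.prems(3)] by blast
      have "exec ?W N (exp_time (Minus (Scalar b) (V x)) + (t + (exp_time Flag + 6 + 1)) + u + 1) M3"
        by (rule exec.WhileTrue[OF ne body u(1)])
      moreover have "(\<exists>u<?m. ?m - r \<le> u \<and> fval p (setv d u M)) \<longleftrightarrow> (\<exists>u<?m. ?i \<le> u \<and> fval p (setv d u M))"
      proof -
        have "?i \<le> u \<and> fval p (setv d u M) \<longleftrightarrow> ?m - r \<le> u \<and> fval p (setv d u M)" for u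
          using False feq Suc.prems(3) by (cases "u = ?i") auto
        then show ?thesis by simp
      qed
      ultimately show ?thesis using IH(2) u(2-)
        by (intro exI[of _ "exp_time (Minus (Scalar b) (V x)) + (t + (exp_time Flag + 6 + 1)) + u + 1"] exI[of _ M3]) simp
    qed
  qed
  let ?N1 = "M(''f'' := (M ''f'')(0 := 0))"
  let ?N2 = "?N1(''v'' := (?N1 ''v'')(x := 0))"
  have w1: "exec (Write ''f'' (Const 0) (Const 0)) M 3 ?N1"
    using exec.Write[of "''f''" "Const 0" "Const 0" M] by (simp add: eval_nat_numeral)
  have w2: "exec (Write ''v'' (Const x) (Const 0)) ?N1 3 ?N2"
    using exec.Write[of "''v''" "Const x" "Const 0" ?N1] by (simp add: eval_nat_numeral)
  have "agree d M ?N2" by (rule agree_trans[OF agree_flag agree_v]) (simp add: x)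
  moreover have "?N2 ''v'' d = ?m - ?m" "?N2 ''f'' 0 = 0" using x by simp_all
  ultimately obtain t M' where t: "exec ?W ?N2 t M'" "t \<le> ?m * (fm_time p B + 20) + 10" "agree d M M'"
      "M' ''f'' 0 = (if \<exists>u<?m. ?m - ?m \<le> u \<and> fval p (setv d u M) then 1 else 0)"
    using loop[of ?N2 ?m] by auto
  have "?m * (fm_time p B + 20) \<le> B * (fm_time p B + 20)"
    using Exi.prems(2)[of b] by (intro mult_le_mono1) simp
  then have "3 + (3 + t) \<le> fm_time (Exi x b p) B" using t(2) unfolding fm_time.simps by linarith
  moreover have "exec (eval_fm (Exi x b p)) M (3 + (3 + t)) M'"
    unfolding eval_fm.simps by (rule exec.Seq[OF w1 exec.Seq[OF w2 t(1)]])
  ultimately show ?case using t(3,4) x by (intro exI[of _ "3 + (3 + t)"] exI[of _ M']) simp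
qed

text \<open>Entries are written in increasing order, so \<open>p\<close>, \<open>e1\<close> and
  \<open>e2\<close> may read the entries of \<open>A\<close> below the current one. All recursions
  of the program, including the dynamic programming, have this shape.\<close>

definition fill :: "string \<Rightarrow> string \<Rightarrow> fm \<Rightarrow> exp \<Rightarrow> exp \<Rightarrow> com" where
  "fill A b p e1 e2 = Seq (Write ''v'' (Const 0) (Const 0)) (While (Minus (Scalar b) (V 0))
     (Seq (eval_fm p) (Seq (If Flag (Write A (V 0) e1) (Write A (V 0) e2))
        (Write ''v'' (Const 0) (Plus (V 0) (Const 1))))))"

definition fill_time :: "fm \<Rightarrow> exp \<Rightarrow> exp \<Rightarrow> nat \<Rightarrow> nat" where
  "fill_time p e1 e2 B = B * (fm_time p B + exp_time e1 + exp_time e2 + 30) + 20"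

lemma poly_bounded_fill_time: "poly_bounded (fill_time p e1 e2)"
  unfolding fill_time_def by (intro poly_bounded_intros poly_bounded_fm_time)

lemma exec_fill:
  assumes ok: "fm_ok 1 p" "exp_ok 1 e1" "exp_ok 1 e2"
    and A: "A \<noteq> ''v''" "A \<noteq> ''f''" "A \<noteq> b" "A \<notin> bounds p" and b: "b \<noteq> ''v''" "b \<noteq> ''f''"
    and B: "M b 0 \<le> B" "\<And>c. c \<in> bounds p \<Longrightarrow> M c 0 \<le> B"
    and g: "\<And>x N. x < M b 0 \<Longrightarrow> (\<And>a. a \<noteq> ''v'' \<Longrightarrow> a \<noteq> ''f'' \<Longrightarrow> a \<noteq> A \<Longrightarrow> N a = M a) \<Longrightarrow>
        (\<And>y. y < x \<Longrightarrow> N A y = g y) \<Longrightarrow> N ''v'' 0 = x \<Longrightarrow>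
        (if fval p N then exp_val e1 N else exp_val e2 N) = g x"
  shows "\<exists>t M'. exec (fill A b p e1 e2) M t M' \<and> t \<le> fill_time p e1 e2 B \<and>
    (\<forall>a. a \<noteq> ''v'' \<longrightarrow> a \<noteq> ''f'' \<longrightarrow> a \<noteq> A \<longrightarrow> M' a = M a) \<and> (\<forall>x<M b 0. M' A x = g x)"
proof -
  let ?m = "M b 0"
  let ?c = "fm_time p B + exp_time e1 + exp_time e2 + 30"
  let ?body = "Seq (eval_fm p) (Seq (If Flag (Write A (V 0) e1) (Write A (V 0) e2))
        (Write ''v'' (Const 0) (Plus (V 0) (Const 1))))"
  let ?W = "While (Minus (Scalar b) (V 0)) ?body"
  let ?fr = "\<lambda>N. \<forall>a. a \<noteq> ''v'' \<longrightarrow> a \<noteq> ''f'' \<longrightarrow> a \<noteq> A \<longrightarrow> N a = M a"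
  have loop: "\<exists>t M'. exec ?W N t M' \<and> t \<le> r * ?c + 10 \<and> ?fr M' \<and> (\<forall>x<?m. M' A x = g x)"
    if "?fr N" "\<And>y. y < ?m - r \<Longrightarrow> N A y = g y" "N ''v'' 0 = ?m - r" "r \<le> ?m" for r N
    using that
  proof (induction r arbitrary: N)
    case 0
    have "N b 0 = ?m" using 0(1) A(3) b by metis
    then have "exp_val (Minus (Scalar b) (V 0)) N = 0" using 0(3) by simp
    from exec.WhileFalse[OF this] show ?case using 0
      by (intro exI[of _ "exp_time (Minus (Scalar b) (V 0)) + 1"] exI[of _ N]) simp
  next
    case (Suc r)
    let ?i = "?m - Suc r"
    have i: "?i < ?m" "Suc ?i = ?m - r" using Suc.prems(4) by simp_all
    have Nb: "N b 0 = ?m" using Suc.prems(1) A(3) b by metis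
    have ne: "exp_val (Minus (Scalar b) (V 0)) N \<noteq> 0" using Suc.prems(3) Nb i by simp
    have "N c 0 \<le> B" if "c \<in> bounds p" for c
    proof -
      have "N c = M c" using Suc.prems(1) bounds_ok[OF ok(1) that] A(4) that by metis
      then show ?thesis using B(2)[OF that] by simp
    qed
    from exec_eval_fm[of 1 p N B, OF ok(1) this] obtain t N1 where N1: "exec (eval_fm p) N t N1" "t \<le> fm_time p B"
      "agree 1 N N1" "N1 ''f'' 0 = (if fval p N then 1 else 0)" by blast
    have v0: "N1 ''v'' 0 = ?i" using N1(3) Suc.prems(3) unfolding agree_def by simp
    have val: "(if fval p N then exp_val e1 N else exp_val e2 N) = g ?i"
      by (rule g[OF i(1) _ Suc.prems(2) Suc.prems(3)]) (use Suc.prems(1) in blast)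
    have ev: "exp_val e1 N1 = exp_val e1 N" "exp_val e2 N1 = exp_val e2 N"
      using exp_agree[OF N1(3)] ok by blast+
    define N2 where "N2 = N1(A := (N1 A)(?i := g ?i))"
    define N3 where "N3 = N2(''v'' := (N2 ''v'')(0 := ?m - r))"
    have "\<exists>u. u \<le> exp_time e1 + exp_time e2 + 10 \<and> exec (If Flag (Write A (V 0) e1) (Write A (V 0) e2)) N1 u N2"
    proof (cases "fval p N")
      case True
      have "exec (If Flag (Write A (V 0) e1) (Write A (V 0) e2)) N1
          (exp_time Flag + (exp_time (V 0) + exp_time e1 + 1) + 1) (N1(A := (N1 A)(exp_val (V 0) N1 := exp_val e1 N1)))"
        by (rule exec.IfTrue[OF _ exec.Write]) (use N1(4) True in simp)
      then have "exec (If Flag (Write A (V 0) e1) (Write A (V 0) e2)) N1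
          (exp_time Flag + (exp_time (V 0) + exp_time e1 + 1) + 1) N2"
        using val True v0 ev unfolding N2_def by simp
      then show ?thesis by (intro exI[of _ "exp_time Flag + (exp_time (V 0) + exp_time e1 + 1) + 1"]) simp
    next
      case False
      have "exec (If Flag (Write A (V 0) e1) (Write A (V 0) e2)) N1
          (exp_time Flag + (exp_time (V 0) + exp_time e2 + 1) + 1) (N1(A := (N1 A)(exp_val (V 0) N1 := exp_val e2 N1)))"
        by (rule exec.IfFalse[OF _ exec.Write]) (use N1(4) False in simp)
      then have "exec (If Flag (Write A (V 0) e1) (Write A (V 0) e2)) N1
          (exp_time Flag + (exp_time (V 0) + exp_time e2 + 1) + 1) N2"
        using val False v0 ev unfolding N2_def by simp
      then show ?thesis by (intro exI[of _ "exp_time Flag + (exp_time (V 0) + exp_time e2 + 1) + 1"]) simp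
    qed
    then obtain u where u: "u \<le> exp_time e1 + exp_time e2 + 10"
      "exec (If Flag (Write A (V 0) e1) (Write A (V 0) e2)) N1 u N2" by blast
    have N2v: "N2 ''v'' 0 = ?i" unfolding N2_def using v0 A(1) by simp
    have w: "exec (Write ''v'' (Const 0) (Plus (V 0) (Const 1))) N2 6 N3"
      using exec.Write[of "''v''" "Const 0" "Plus (V 0) (Const 1)" N2] N2v i(2)
      unfolding N3_def by (simp add: eval_nat_numeral)
    have fr3: "?fr N3"
      using Suc.prems(1) agree_array[OF N1(3)] unfolding N3_def N2_def by simp
    have "N1 A y = N A y" for y using agree_array[OF N1(3) A(1,2)] by simp
    then have g3: "N3 A y = g y" if "y < ?m - r" for y
      using that Suc.prems(2)[of y] i(2) A(1) unfolding N3_def N2_def by (cases "y = ?i") auto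
    have v3: "N3 ''v'' 0 = ?m - r" unfolding N3_def by simp
    from Suc.IH[OF fr3 g3 v3] Suc.prems(4) obtain t' M' where r: "exec ?W N3 t' M'" "t' \<le> r * ?c + 10"
      "?fr M'" "\<forall>x<?m. M' A x = g x" by auto
    have "exec ?W N (exp_time (Minus (Scalar b) (V 0)) + (t + (u + 6)) + t' + 1) M'"
      by (rule exec.WhileTrue[OF ne exec.Seq[OF N1(1) exec.Seq[OF u(2) w]] r(1)])
    moreover have "exp_time (Minus (Scalar b) (V 0)) + (t + (u + 6)) + t' + 1 \<le> Suc r * ?c + 10"
      using N1(2) u(1) r(2) by simp
    ultimately show ?case using r(3,4) by blast
  qed
  let ?N = "M(''v'' := (M ''v'')(0 := 0))"
  have w: "exec (Write ''v'' (Const 0) (Const 0)) M 3 ?N"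
    using exec.Write[of "''v''" "Const 0" "Const 0" M] by (simp add: eval_nat_numeral)
  obtain t M' where t: "exec ?W ?N t M'" "t \<le> ?m * ?c + 10" "?fr M'" "\<forall>x<?m. M' A x = g x"
    using loop[of ?N ?m] by auto
  have "?m * ?c \<le> B * ?c" using B(1) by (rule mult_le_mono1)
  then have "3 + t \<le> fill_time p e1 e2 B" using t(2) unfolding fill_time_def by linarith
  moreover have "exec (fill A b p e1 e2) M (3 + t) M'" unfolding fill_def by (rule exec.Seq[OF w t(1)])
  ultimately show ?thesis using t(3,4) by blast
qed

section \<open>Timed Hoare triples and arithmetic without multiplication\<close>

type_synonym facts = "(string \<times> nat \<times> (nat \<Rightarrow> nat)) list"

definition holds :: "facts \<Rightarrow> memory \<Rightarrow> bool" where
  "holds L M \<longleftrightarrow> (\<forall>(a, m, g) \<in> set L. \<forall>x<m. M a x = g x)"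

definition names :: "facts \<Rightarrow> string set" where
  "names L = fst ` set L"

definition temps :: "string set" where
  "temps = {''v'', ''f'', ''b1'', ''mt'', ''ctr''}"

lemma holdsD: "holds L M \<Longrightarrow> (a, m, g) \<in> set L \<Longrightarrow> x < m \<Longrightarrow> M a x = g x"
  unfolding holds_def by blast

lemma holds_frame:
  assumes "holds L M" "\<And>a. a \<in> names L \<Longrightarrow> M' a = M a"
  shows "holds L M'"
  unfolding holds_def
proof (clarify)
  fix a m g x assume *: "(a, m, g) \<in> set L" "x < (m :: nat)"
  then have "a \<in> names L" unfolding names_def by force
  then show "M' a x = g x" using assms(2) holdsD[OF assms(1) *] by simp
qed

lemma holds_Cons: "holds ((a, m, g) # L) M \<longleftrightarrow> (\<forall>x<m. M a x = g x) \<and> holds L M"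
  unfolding holds_def by simp

definition triple :: "facts \<Rightarrow> com \<Rightarrow> nat \<Rightarrow> facts \<Rightarrow> bool" where
  "triple L p T L' \<longleftrightarrow> (\<forall>M. holds L M \<longrightarrow> (\<exists>t M'. exec p M t M' \<and> t \<le> T \<and> holds L' M'))"

lemma triple_Seq:
  assumes "triple L p T L'" "triple L' q T' L''"
  shows "triple L (Seq p q) (T + T') L''"
  unfolding triple_def
proof (intro allI impI)
  fix M assume "holds L M"
  then obtain t M' where 1: "exec p M t M'" "t \<le> T" "holds L' M'" using assms(1) unfolding triple_def by blast
  then obtain u M'' where 2: "exec q M' u M''" "u \<le> T'" "holds L'' M''" using assms(2) unfolding triple_def by blast
  have "exec (Seq p q) M (t + u) M''" by (rule exec.Seq[OF 1(1) 2(1)])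
  then show "\<exists>t M'. exec (Seq p q) M t M' \<and> t \<le> T + T' \<and> holds L'' M'"
    using 1(2) 2(2,3) by (intro exI[of _ "t + u"] exI[of _ M'']) simp
qed

lemma triple_scalar:
  assumes "z \<notin> names L" and "\<And>M. holds L M \<Longrightarrow> exp_val e M = u"
  shows "triple L (Write z (Const 0) e) (exp_time e + 2) ((z, 1, \<lambda>_. u) # L)"
  unfolding triple_def
proof (intro allI impI)
  fix M assume M: "holds L M"
  let ?M = "M(z := (M z)(0 := u))"
  have "holds L ?M" by (rule holds_frame[OF M]) (use assms(1) in auto)
  then have "holds ((z, 1, \<lambda>_. u) # L) ?M" unfolding holds_Cons by simp
  moreover have "exec (Write z (Const 0) e) M (exp_time e + 2) ?M"
    using exec.Write[of z "Const 0" e M] assms(2)[OF M] by simp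
  ultimately show "\<exists>t M'. exec (Write z (Const 0) e) M t M' \<and> t \<le> exp_time e + 2 \<and> holds ((z, 1, \<lambda>_. u) # L) M'"
    by blast
qed

lemma triple_fill:
  assumes ok: "fm_ok 1 p" "exp_ok 1 e1" "exp_ok 1 e2"
    and A: "A \<notin> names L" "A \<notin> temps" and L: "names L \<inter> temps = {}"
    and b: "(b, 1, \<lambda>_. m) \<in> set L" "m \<le> B"
    and bd: "\<And>c. c \<in> bounds p \<Longrightarrow> \<exists>u. (c, 1, \<lambda>_. u) \<in> set L \<and> u \<le> B"
    and g: "\<And>x N. x < m \<Longrightarrow> holds L N \<Longrightarrow> (\<And>y. y < x \<Longrightarrow> N A y = g y) \<Longrightarrow> N ''v'' 0 = x \<Longrightarrow>
        (if fval p N then exp_val e1 N else exp_val e2 N) = g x"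
  shows "triple L (fill A b p e1 e2) (fill_time p e1 e2 B) ((A, m, g) # L)"
  unfolding triple_def
proof (intro allI impI)
  fix M assume M: "holds L M"
  have in_names: "a \<in> names L" if "(a, u) \<in> set L" for a u using that unfolding names_def by force
  have Mb: "M b 0 = m" using holdsD[OF M b(1), of 0] by simp
  have bn: "b \<in> names L" using in_names[OF b(1)] .
  have frame: "holds L N" if "\<And>a. a \<noteq> ''v'' \<Longrightarrow> a \<noteq> ''f'' \<Longrightarrow> a \<noteq> A \<Longrightarrow> N a = M a" for N
  proof (rule holds_frame[OF M])
    fix a assume a: "a \<in> names L"
    then have "a \<notin> temps" "a \<noteq> A" using L A(1) by blast+
    then show "N a = M a" using that[of a] unfolding temps_def by simp
  qed
  have "\<exists>t M'. exec (fill A b p e1 e2) M t M' \<and> t \<le> fill_time p e1 e2 B \<and>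
    (\<forall>a. a \<noteq> ''v'' \<longrightarrow> a \<noteq> ''f'' \<longrightarrow> a \<noteq> A \<longrightarrow> M' a = M a) \<and> (\<forall>x<M b 0. M' A x = g x)"
  proof (rule exec_fill[OF ok])
    show "A \<noteq> ''v''" "A \<noteq> ''f''" using A(2) unfolding temps_def by blast+
    show "b \<noteq> ''v''" "b \<noteq> ''f''" using bn L unfolding temps_def by blast+
    show "A \<noteq> b" using bn A(1) by blast
    show "A \<notin> bounds p" using bd A(1) in_names by blast
    show "M b 0 \<le> B" using Mb b(2) by simp
    show "M c 0 \<le> B" if cb: "c \<in> bounds p" for c
    proof -
      obtain u where u: "(c, 1, \<lambda>_. u) \<in> set L" "u \<le> B" using bd[OF cb] by blast
      show ?thesis using holdsD[OF M u(1), of 0] u(2) by simp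
    qed
    fix x N assume *: "x < M b 0" "\<And>a. a \<noteq> ''v'' \<Longrightarrow> a \<noteq> ''f'' \<Longrightarrow> a \<noteq> A \<Longrightarrow> N a = M a"
      "\<And>y. y < x \<Longrightarrow> N A y = g y" "N ''v'' 0 = x"
    show "(if fval p N then exp_val e1 N else exp_val e2 N) = g x"
      by (rule g[OF _ frame[OF *(2)] *(3,4)]) (use *(1) Mb in simp)
  qed
  then obtain t M' where t: "exec (fill A b p e1 e2) M t M'" "t \<le> fill_time p e1 e2 B"
    and t3: "\<forall>a. a \<noteq> ''v'' \<longrightarrow> a \<noteq> ''f'' \<longrightarrow> a \<noteq> A \<longrightarrow> M' a = M a" and t4: "\<forall>x<m. M' A x = g x"
    unfolding Mb by (elim exE conjE) (rule that)
  have "holds ((A, m, g) # L) M'" unfolding holds_Cons using t4 frame[OF t3[rule_format]] by blast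
  then show "\<exists>t M'. exec (fill A b p e1 e2) M t M' \<and> t \<le> fill_time p e1 e2 B \<and> holds ((A, m, g) # L) M'"
    using t(1,2) by blast
qed

text \<open>The array \<open>mt\<close> collects the multiples of the second factor, and the product
  is its last entry. The time depends on the first factor only.\<close>

definition mul :: "string \<Rightarrow> string \<Rightarrow> string \<Rightarrow> com" where
  "mul z x y = Seq (Write ''b1'' (Const 0) (Plus (Scalar x) (Const 1)))
     (Seq (fill ''mt'' ''b1'' (Tst (V 0)) (Plus (Read ''mt'' (Minus (V 0) (Const 1))) (Scalar y)) (Const 0))
        (Write z (Const 0) (Read ''mt'' (Scalar x))))"

text \<open>\<open>exp_time\<close> ignores the names of arrays, so \<open>''x''\<close> stands for
  any second factor.\<close>

definition mul_time :: "nat \<Rightarrow> nat" where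
  "mul_time B = 20 + fill_time (Tst (V 0)) (Plus (Read ''mt'' (Minus (V 0) (Const 1))) (Scalar ''x'')) (Const 0) B"

lemma exec_mul:
  assumes x: "x \<notin> temps" and y: "y \<notin> temps" and B: "M x 0 < B"
  shows "\<exists>t M'. exec (mul z x y) M t M' \<and> t \<le> mul_time B \<and> M' z 0 = M x 0 * M y 0 \<and>
    (\<forall>a. a \<notin> {''v'', ''f'', ''b1'', ''mt'', z} \<longrightarrow> M' a = M a)"
proof -
  let ?M1 = "M(''b1'' := (M ''b1'')(0 := M x 0 + 1))"
  have xy: "x \<noteq> ''b1''" "y \<noteq> ''b1''" "x \<noteq> ''v''" "x \<noteq> ''f''" "x \<noteq> ''mt''" "y \<noteq> ''v''" "y \<noteq> ''f''" "y \<noteq> ''mt''"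
    using x y unfolding temps_def by blast+
  have w1: "exec (Write ''b1'' (Const 0) (Plus (Scalar x) (Const 1))) M 6 ?M1"
    using exec.Write[of "''b1''" "Const 0" "Plus (Scalar x) (Const 1)" M] by (simp add: eval_nat_numeral)
  let ?e = "Plus (Read ''mt'' (Minus (V 0) (Const 1))) (Scalar y)"
  have "\<exists>t M'. exec (fill ''mt'' ''b1'' (Tst (V 0)) ?e (Const 0)) ?M1 t M' \<and> t \<le> fill_time (Tst (V 0)) ?e (Const 0) B \<and>
    (\<forall>a. a \<noteq> ''v'' \<longrightarrow> a \<noteq> ''f'' \<longrightarrow> a \<noteq> ''mt'' \<longrightarrow> M' a = ?M1 a) \<and> (\<forall>i<?M1 ''b1'' 0. M' ''mt'' i = i * M y 0)"
  proof (rule exec_fill)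
    fix i N
    assume N: "\<And>a. a \<noteq> ''v'' \<Longrightarrow> a \<noteq> ''f'' \<Longrightarrow> a \<noteq> ''mt'' \<Longrightarrow> N a = ?M1 a" "\<And>j. j < i \<Longrightarrow> N ''mt'' j = j * M y 0" "N ''v'' 0 = i"
    have "N y = M y" using N(1)[of y] xy by simp
    then show "(if fval (Tst (V 0)) N then exp_val ?e N else exp_val (Const 0) N) = i * M y 0"
      using N(2)[of "i - 1"] N(3) by (cases i) auto
  qed (use xy B in auto)
  then obtain t M2 where t: "exec (fill ''mt'' ''b1'' (Tst (V 0)) ?e (Const 0)) ?M1 t M2"
    "t \<le> fill_time (Tst (V 0)) ?e (Const 0) B" "\<And>a. a \<noteq> ''v'' \<Longrightarrow> a \<noteq> ''f'' \<Longrightarrow> a \<noteq> ''mt'' \<Longrightarrow> M2 a = ?M1 a"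
    "\<And>i. i < Suc (M x 0) \<Longrightarrow> M2 ''mt'' i = i * M y 0" by auto
  have M2x: "M2 x = M x" using t(3)[of x] xy by simp
  let ?M3 = "M2(z := (M2 z)(0 := M x 0 * M y 0))"
  have w3: "exec (Write z (Const 0) (Read ''mt'' (Scalar x))) M2 5 ?M3"
    using exec.Write[of z "Const 0" "Read ''mt'' (Scalar x)" M2] t(4)[of "M x 0"] M2x by (simp add: eval_nat_numeral)
  have "exec (mul z x y) M (6 + (t + 5)) ?M3"
    unfolding mul_def by (rule exec.Seq[OF w1 exec.Seq[OF t(1) w3]])
  moreover have "6 + (t + 5) \<le> mul_time B" using t(2) unfolding mul_time_def fill_time_def by simp
  moreover have "\<forall>a. a \<notin> {''v'', ''f'', ''b1'', ''mt'', z} \<longrightarrow> ?M3 a = M a" using t(3) by simp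
  moreover have "?M3 z 0 = M x 0 * M y 0" by simp
  ultimately show ?thesis by blast
qed

lemma triple_mul:
  assumes x: "(x, 1, \<lambda>_. u) \<in> set L" and y: "(y, 1, \<lambda>_. u') \<in> set L" and z: "z \<notin> names L"
    and L: "names L \<inter> temps = {}" and B: "u < B"
  shows "triple L (mul z x y) (mul_time B) ((z, 1, \<lambda>_. u * u') # L)"
  unfolding triple_def
proof (intro allI impI)
  fix M assume M: "holds L M"
  have in_names: "a \<in> names L" if "(a, v) \<in> set L" for a v using that unfolding names_def by force
  have xy: "x \<notin> temps" "y \<notin> temps" using in_names[OF x] in_names[OF y] L by blast+
  have Mx: "M x 0 = u" "M y 0 = u'" using holdsD[OF M x, of 0] holdsD[OF M y, of 0] by simp_all
  obtain t M' where t: "exec (mul z x y) M t M'" "t \<le> mul_time B" "M' z 0 = u * u'"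
    "\<And>a. a \<notin> {''v'', ''f'', ''b1'', ''mt'', z} \<Longrightarrow> M' a = M a"
    using exec_mul[OF xy, of M B z] B unfolding Mx by blast
  have "holds L M'"
  proof (rule holds_frame[OF M])
    fix a assume "a \<in> names L"
    then have "a \<notin> temps" "a \<noteq> z" using L z by blast+
    then show "M' a = M a" using t(4)[of a] unfolding temps_def by simp
  qed
  then have "holds ((z, 1, \<lambda>_. u * u') # L) M'" unfolding holds_Cons using t(3) by simp
  then show "\<exists>t M'. exec (mul z x y) M t M' \<and> t \<le> mul_time B \<and> holds ((z, 1, \<lambda>_. u * u') # L) M'"
    using t(1,2) by blast
qed

text \<open>The fixed base is the first factor and the growing power the second. As only the first
  factor governs the time of \<open>mul\<close>, each round costs the same.\<close>

definition pow :: "string \<Rightarrow> string \<Rightarrow> string \<Rightarrow> com" where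
  "pow z x y = Seq (Write z (Const 0) (Const 1)) (Seq (Write ''ctr'' (Const 0) (Scalar y))
     (While (Scalar ''ctr'') (Seq (mul z x z) (Write ''ctr'' (Const 0) (Minus (Scalar ''ctr'') (Const 1))))))"

definition pow_time :: "nat \<Rightarrow> nat" where
  "pow_time B = B * (mul_time B + 20) + 20"

lemma triple_pow:
  assumes x: "(x, 1, \<lambda>_. u) \<in> set L" and y: "(y, 1, \<lambda>_. m) \<in> set L" and z: "z \<notin> names L" "z \<notin> temps"
    and L: "names L \<inter> temps = {}" and B: "u < B" "m \<le> B"
  shows "triple L (pow z x y) (pow_time B) ((z, 1, \<lambda>_. u ^ m) # L)"
  unfolding triple_def
proof (intro allI impI)
  fix M assume M: "holds L M"
  have in_names: "a \<in> names L" if "(a, v) \<in> set L" for a v using that unfolding names_def by force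
  have xy: "x \<notin> temps" "y \<notin> temps" "x \<noteq> z" "y \<noteq> z" using in_names[OF x] in_names[OF y] L z by blast+
  have zc: "z \<noteq> ''ctr''" "''ctr'' \<notin> names L" using z(2) L unfolding temps_def by blast+
  let ?body = "Seq (mul z x z) (Write ''ctr'' (Const 0) (Minus (Scalar ''ctr'') (Const 1)))"
  have loop: "\<exists>t M'. exec (While (Scalar ''ctr'') ?body) N t M' \<and> t \<le> r * (mul_time B + 20) + 10 \<and>
      holds L M' \<and> M' z 0 = u ^ (r + s)"
    if "holds L N" "N z 0 = u ^ s" "N ''ctr'' 0 = r" for r s N
    using that
  proof (induction r arbitrary: s N)
    case 0
    then have "exp_val (Scalar ''ctr'') N = 0" by simp
    from exec.WhileFalse[OF this] show ?case using 0 by (intro exI[of _ "exp_time (Scalar ''ctr'') + 1"] exI[of _ N]) simp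
  next
    case (Suc r)
    have ne: "exp_val (Scalar ''ctr'') N \<noteq> 0" using Suc.prems(3) by simp
    have Nx: "N x 0 = u" using holdsD[OF Suc.prems(1) x, of 0] by simp
    obtain t N1 where t: "exec (mul z x z) N t N1" "t \<le> mul_time B" "N1 z 0 = u * u ^ s"
      "\<And>a. a \<notin> {''v'', ''f'', ''b1'', ''mt'', z} \<Longrightarrow> N1 a = N a"
      using exec_mul[OF xy(1) z(2), of N B z] B unfolding Nx Suc.prems(2) by blast
    let ?N2 = "N1(''ctr'' := (N1 ''ctr'')(0 := r))"
    have "N1 ''ctr'' 0 = Suc r" using t(4)[of "''ctr''"] Suc.prems(3) zc by simp
    then have w: "exec (Write ''ctr'' (Const 0) (Minus (Scalar ''ctr'') (Const 1))) N1 6 ?N2"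
      using exec.Write[of "''ctr''" "Const 0" "Minus (Scalar ''ctr'') (Const 1)" N1] by (simp add: eval_nat_numeral)
    have h2: "holds L ?N2"
    proof (rule holds_frame[OF Suc.prems(1)])
      fix a assume "a \<in> names L"
      then have "a \<notin> temps" "a \<noteq> z" using L z by blast+
      then show "?N2 a = N a" using t(4)[of a] unfolding temps_def by simp
    qed
    have z2: "?N2 z 0 = u ^ Suc s" using t(3) zc by simp
    have c2: "?N2 ''ctr'' 0 = r" by simp
    obtain t' M' where r: "exec (While (Scalar ''ctr'') ?body) ?N2 t' M'" "t' \<le> r * (mul_time B + 20) + 10"
      "holds L M'" "M' z 0 = u ^ (r + Suc s)" using Suc.IH[OF h2 z2 c2] by blast
    have "exec (While (Scalar ''ctr'') ?body) N (exp_time (Scalar ''ctr'') + (t + 6) + t' + 1) M'"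
      by (rule exec.WhileTrue[OF ne exec.Seq[OF t(1) w] r(1)])
    moreover have "exp_time (Scalar ''ctr'') + (t + 6) + t' + 1 \<le> Suc r * (mul_time B + 20) + 10"
      using t(2) r(2) by simp
    moreover have "M' z 0 = u ^ (Suc r + s)" using r(4) by simp
    ultimately show ?case using r(3) by blast
  qed
  let ?M1 = "M(z := (M z)(0 := 1))"
  let ?M2 = "?M1(''ctr'' := (?M1 ''ctr'')(0 := m))"
  have w1: "exec (Write z (Const 0) (Const 1)) M 3 ?M1"
    using exec.Write[of z "Const 0" "Const 1" M] by (simp add: eval_nat_numeral)
  have "?M1 y 0 = m" using holdsD[OF M y, of 0] xy by simp
  then have w2: "exec (Write ''ctr'' (Const 0) (Scalar y)) ?M1 4 ?M2"
    using exec.Write[of "''ctr''" "Const 0" "Scalar y" ?M1] by (simp add: eval_nat_numeral)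
  have h: "holds L ?M2"
  proof (rule holds_frame[OF M])
    fix a assume "a \<in> names L"
    then have "a \<noteq> z" "a \<noteq> ''ctr''" using z zc by blast+
    then show "?M2 a = M a" by simp
  qed
  have z2: "?M2 z 0 = u ^ 0" using zc by simp
  have c2: "?M2 ''ctr'' 0 = m" by simp
  obtain t M' where t: "exec (While (Scalar ''ctr'') ?body) ?M2 t M'" "t \<le> m * (mul_time B + 20) + 10"
      "holds L M'" "M' z 0 = u ^ (m + 0)" using loop[OF h z2 c2] by blast
  have "exec (pow z x y) M (3 + (4 + t)) M'"
    unfolding pow_def by (rule exec.Seq[OF w1 exec.Seq[OF w2 t(1)]])
  moreover have "m * (mul_time B + 20) \<le> B * (mul_time B + 20)" using B(2) by (rule mult_le_mono1)
  then have "3 + (4 + t) \<le> pow_time B" using t(2) unfolding pow_time_def by linarith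
  moreover have "holds ((z, 1, \<lambda>_. u ^ m) # L) M'" unfolding holds_Cons using t(3,4) by simp
  ultimately show "\<exists>t M'. exec (pow z x y) M t M' \<and> t \<le> pow_time B \<and> holds ((z, 1, \<lambda>_. u ^ m) # L) M'"
    by blast
qed

definition mult_table :: "string \<Rightarrow> string \<Rightarrow> string \<Rightarrow> com" where
  "mult_table A d b = fill A b (Tst (V 0)) (Plus (Read A (Minus (V 0) (Const 1))) (Scalar d)) (Const 0)"

text \<open>The remainder of \<open>x\<close> equals that of \<open>x - d\<close> as soon as
  \<open>d \<le> x\<close>, so it can be copied from an earlier entry; \<open>div_table\<close> adds
  1 to such an entry.\<close>

definition mod_table :: "string \<Rightarrow> string \<Rightarrow> string \<Rightarrow> com" where
  "mod_table A d b = fill A b (Tst (Minus (Scalar d) (V 0))) (V 0) (Read A (Minus (V 0) (Scalar d)))"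

definition div_table :: "string \<Rightarrow> string \<Rightarrow> string \<Rightarrow> com" where
  "div_table A d b = fill A b (Tst (Minus (Scalar d) (V 0))) (Const 0)
     (Plus (Read A (Minus (V 0) (Scalar d))) (Const 1))"

definition table_time :: "nat \<Rightarrow> nat" where
  "table_time B = B * 70 + 20"

context
  fixes A d b :: string and L :: facts and u m B :: nat
  assumes A: "A \<notin> names L" "A \<notin> temps" and L: "names L \<inter> temps = {}"
    and d: "(d, 1, \<lambda>_. u) \<in> set L" and b: "(b, 1, \<lambda>_. m) \<in> set L" "m \<le> B"
begin

lemma table_names: "A \<noteq> ''v''" "A \<noteq> ''f''" "d \<noteq> ''v''" "d \<noteq> ''f''"
proof -
  have "d \<in> names L" using d unfolding names_def by force
  then show "A \<noteq> ''v''" "A \<noteq> ''f''" "d \<noteq> ''v''" "d \<noteq> ''f''" using A(2) L unfolding temps_def by blast+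
qed

lemma triple_mult_table: "triple L (mult_table A d b) (table_time B) ((A, m, \<lambda>x. x * u) # L)"
proof -
  let ?e = "Plus (Read A (Minus (V 0) (Const 1))) (Scalar d)"
  have "triple L (mult_table A d b) (fill_time (Tst (V 0)) ?e (Const 0) B) ((A, m, \<lambda>x. x * u) # L)"
    unfolding mult_table_def
  proof (rule triple_fill[OF _ _ _ A L b])
    fix x N assume N: "holds L N" "\<And>y. y < x \<Longrightarrow> N A y = y * u" "N ''v'' 0 = x"
    have "N d 0 = u" using holdsD[OF N(1) d, of 0] by simp
    then show "(if fval (Tst (V 0)) N then exp_val ?e N else exp_val (Const 0) N) = x * u"
      using N(2)[of "x - 1"] N(3) by (cases x) auto
  qed (use table_names in auto)
  moreover have "fill_time (Tst (V 0)) ?e (Const 0) B \<le> table_time B"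
    unfolding fill_time_def table_time_def by simp
  ultimately show ?thesis unfolding triple_def using le_trans by blast
qed

text \<open>For \<open>u = 0\<close> the recursion would refer to the entry that is being computed.
  An empty table must be allowed nevertheless: without pairs, \<open>w\<close> is 0 and the tables
  for \<open>w\<close> have length 0.\<close>

lemma triple_mod_table:
  assumes "0 < m \<Longrightarrow> 0 < u"
  shows "triple L (mod_table A d b) (table_time B) ((A, m, \<lambda>x. x mod u) # L)"
proof -
  let ?p = "Tst (Minus (Scalar d) (V 0))" and ?e = "Read A (Minus (V 0) (Scalar d))"
  have "triple L (mod_table A d b) (fill_time ?p (V 0) ?e B) ((A, m, \<lambda>x. x mod u) # L)"
    unfolding mod_table_def
  proof (rule triple_fill[OF _ _ _ A L b])
    fix x N assume N: "x < m" "holds L N" "\<And>y. y < x \<Longrightarrow> N A y = y mod u" "N ''v'' 0 = x"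
    have "N d 0 = u" using holdsD[OF N(2) d, of 0] by simp
    moreover have "N A (x - u) = x mod u" if "\<not> x < u"
      using N(3)[of "x - u"] that assms N(1) by (simp add: le_mod_geq)
    ultimately show "(if fval ?p N then exp_val (V 0) N else exp_val ?e N) = x mod u"
      using N(4) by auto
  qed (use table_names in auto)
  moreover have "fill_time ?p (V 0) ?e B \<le> table_time B"
    unfolding fill_time_def table_time_def by simp
  ultimately show ?thesis unfolding triple_def using le_trans by blast
qed

lemma triple_div_table:
  assumes "0 < m \<Longrightarrow> 0 < u"
  shows "triple L (div_table A d b) (table_time B) ((A, m, \<lambda>x. x div u) # L)"
proof -
  let ?p = "Tst (Minus (Scalar d) (V 0))" and ?e = "Plus (Read A (Minus (V 0) (Scalar d))) (Const 1)"
  have "triple L (div_table A d b) (fill_time ?p (Const 0) ?e B) ((A, m, \<lambda>x. x div u) # L)"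
    unfolding div_table_def
  proof (rule triple_fill[OF _ _ _ A L b])
    fix x N assume N: "x < m" "holds L N" "\<And>y. y < x \<Longrightarrow> N A y = y div u" "N ''v'' 0 = x"
    have "N d 0 = u" using holdsD[OF N(2) d, of 0] by simp
    moreover have "Suc (N A (x - u)) = x div u" if "\<not> x < u"
      using N(3)[of "x - u"] that assms N(1) by (simp add: le_div_geq)
    ultimately show "(if fval ?p N then exp_val (Const 0) N else exp_val ?e N) = x div u"
      using N(4) by auto
  qed (use table_names in auto)
  moreover have "fill_time ?p (Const 0) ?e B \<le> table_time B"
    unfolding fill_time_def table_time_def by simp
  ultimately show ?thesis unfolding triple_def using le_trans by blast
qed

end

lemma poly_bounded_times: "poly_bounded mul_time" "poly_bounded pow_time" "poly_bounded table_time"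
proof -
  show m: "poly_bounded mul_time" unfolding mul_time_def by (intro poly_bounded_intros poly_bounded_fill_time)
  show "poly_bounded pow_time" unfolding pow_time_def by (intro poly_bounded_intros m)
  show "poly_bounded table_time" unfolding table_time_def by (intro poly_bounded_intros)
qed

section \<open>The certificate conditions as bounded formulas\<close>

definition Fle :: "exp \<Rightarrow> exp \<Rightarrow> fm" where "Fle x y = Neg (Tst (Minus x y))"
definition Flt :: "exp \<Rightarrow> exp \<Rightarrow> fm" where "Flt x y = Tst (Minus y x)"
definition Tabsd :: "exp \<Rightarrow> exp \<Rightarrow> exp" where "Tabsd x y = Plus (Minus x y) (Minus y x)"
definition Feq :: "exp \<Rightarrow> exp \<Rightarrow> fm" where "Feq x y = Neg (Tst (Tabsd x y))"
definition Fimp :: "fm \<Rightarrow> fm \<Rightarrow> fm" where "Fimp p q = Neg (Conj p (Neg q))"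
definition Fdisj :: "fm \<Rightarrow> fm \<Rightarrow> fm" where "Fdisj p q = Neg (Conj (Neg p) (Neg q))"
definition Fall :: "nat \<Rightarrow> string \<Rightarrow> fm \<Rightarrow> fm" where "Fall x b p = Neg (Exi x b (Neg p))"
definition Fif :: "fm \<Rightarrow> fm \<Rightarrow> fm \<Rightarrow> fm" where "Fif p q r = Conj (Fimp p q) (Fimp (Neg p) r)"

lemma fval_derived:
  "fval (Fle x y) M \<longleftrightarrow> exp_val x M \<le> exp_val y M"
  "fval (Flt x y) M \<longleftrightarrow> exp_val x M < exp_val y M"
  "fval (Feq x y) M \<longleftrightarrow> exp_val x M = exp_val y M"
  "fval (Fimp p q) M \<longleftrightarrow> (fval p M \<longrightarrow> fval q M)"
  "fval (Fdisj p q) M \<longleftrightarrow> fval p M \<or> fval q M"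
  "fval (Fall v b p) M \<longleftrightarrow> (\<forall>u<M b 0. fval p (setv v u M))"
  "fval (Fif p q r) M \<longleftrightarrow> (if fval p M then fval q M else fval r M)"
  "exp_val (Tabsd x y) M = absd (exp_val x M) (exp_val y M)"
  unfolding Fle_def Flt_def Feq_def Fimp_def Fdisj_def Fall_def Fif_def Tabsd_def absd_def by auto

lemma fm_ok_derived:
  "fm_ok d (Fle x y) \<longleftrightarrow> exp_ok d x \<and> exp_ok d y"
  "fm_ok d (Flt x y) \<longleftrightarrow> exp_ok d x \<and> exp_ok d y"
  "fm_ok d (Feq x y) \<longleftrightarrow> exp_ok d x \<and> exp_ok d y"
  "fm_ok d (Fimp p q) \<longleftrightarrow> fm_ok d p \<and> fm_ok d q"
  "fm_ok d (Fdisj p q) \<longleftrightarrow> fm_ok d p \<and> fm_ok d q"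
  "fm_ok d (Fall v b p) \<longleftrightarrow> v = d \<and> b \<noteq> ''v'' \<and> b \<noteq> ''f'' \<and> fm_ok (Suc d) p"
  "fm_ok d (Fif p q r) \<longleftrightarrow> fm_ok d p \<and> fm_ok d q \<and> fm_ok d r"
  "exp_ok d (Tabsd x y) \<longleftrightarrow> exp_ok d x \<and> exp_ok d y"
  unfolding Fle_def Flt_def Feq_def Fimp_def Fdisj_def Fall_def Fif_def Tabsd_def by auto

lemma bounds_derived:
  "bounds (Fle x y) = {}" "bounds (Flt x y) = {}" "bounds (Feq x y) = {}"
  "bounds (Fimp p q) = bounds p \<union> bounds q" "bounds (Fdisj p q) = bounds p \<union> bounds q"
  "bounds (Fall v b p) = insert b (bounds p)" "bounds (Fif p q r) = bounds p \<union> bounds q \<union> bounds r"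
  unfolding Fle_def Flt_def Feq_def Fimp_def Fdisj_def Fall_def Fif_def by auto

lemma exp_ok_mono: "exp_ok d e \<Longrightarrow> d \<le> d' \<Longrightarrow> exp_ok d' e"
  by (induction e) (auto split: if_splits)

lemma exp_setv: "exp_ok x e \<Longrightarrow> exp_val e (setv x u M) = exp_val e M"
  by (rule exp_agree) (auto simp: agree_def setv_def)

lemma setv_array: "a \<noteq> ''v'' \<Longrightarrow> setv x u M a = M a"
  unfolding setv_def by simp

lemma setv_v: "setv x u M ''v'' y = (if y = x then u else M ''v'' y)"
  unfolding setv_def by simp

text \<open>Expressions have no product, so the starts of rows are looked up in tables of multiples:
  \<open>offN\<close> for \<open>N\<close> here, and \<open>rown\<close> for \<open>n\<close> in
  \<open>Tph\<close> and \<open>Fad\<close>.\<close>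

definition Tdig :: "exp \<Rightarrow> exp \<Rightarrow> exp" where "Tdig j e = Read ''dig'' (Plus (Read ''offN'' j) e)"
definition TS :: "exp \<Rightarrow> exp \<Rightarrow> exp" where "TS e q = Tdig q e"
definition TE :: "exp \<Rightarrow> exp \<Rightarrow> exp" where "TE e q = Tdig (Plus (Scalar ''Q'') q) e"
definition TL :: "exp \<Rightarrow> exp \<Rightarrow> exp" where "TL e q = Tdig (Plus (Scalar ''Q'') (Plus (Scalar ''Q'') q)) e"
definition TZ :: "exp \<Rightarrow> exp \<Rightarrow> exp" where
  "TZ e q = Tdig (Plus (Scalar ''Q'') (Plus (Scalar ''Q'') (Plus (Scalar ''Q'') q))) e"
definition Tph :: "exp \<Rightarrow> exp \<Rightarrow> exp" where "Tph d v = Read ''part'' (Plus (Read ''rown'' d) v)"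
definition Town :: "exp \<Rightarrow> exp" where "Town q = Read ''ow'' q"
definition Trw :: "exp \<Rightarrow> exp" where "Trw q = Read ''rw'' q"
definition Tc :: "exp \<Rightarrow> exp" where "Tc q = Read ''c'' (Town q)"
definition Ts :: "exp \<Rightarrow> exp" where "Ts q = Read ''s'' (Town q)"
definition Tt :: "exp \<Rightarrow> exp" where "Tt q = Read ''t'' (Town q)"
definition Fad :: "exp \<Rightarrow> exp \<Rightarrow> fm" where "Fad u v = Tst (Read ''adj'' (Plus (Read ''rown'' u) v))"

lemmas term_defs = Tdig_def TS_def TE_def TL_def TZ_def Tph_def Town_def Trw_def Tc_def Ts_def Tt_def

lemma exp_ok_terms:
  "exp_ok d (TS e q) \<longleftrightarrow> exp_ok d e \<and> exp_ok d q" "exp_ok d (TE e q) \<longleftrightarrow> exp_ok d e \<and> exp_ok d q"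
  "exp_ok d (TL e q) \<longleftrightarrow> exp_ok d e \<and> exp_ok d q" "exp_ok d (TZ e q) \<longleftrightarrow> exp_ok d e \<and> exp_ok d q"
  "exp_ok d (Tph x v) \<longleftrightarrow> exp_ok d x \<and> exp_ok d v" "exp_ok d (Town q) \<longleftrightarrow> exp_ok d q"
  "exp_ok d (Trw q) \<longleftrightarrow> exp_ok d q" "exp_ok d (Tc q) \<longleftrightarrow> exp_ok d q" "exp_ok d (Ts q) \<longleftrightarrow> exp_ok d q"
  "exp_ok d (Tt q) \<longleftrightarrow> exp_ok d q" "fm_ok d (Fad u v) \<longleftrightarrow> exp_ok d u \<and> exp_ok d v" "bounds (Fad u v) = {}"
  unfolding term_defs Fad_def by auto

definition Fdiamond :: "nat \<Rightarrow> exp \<Rightarrow> exp \<Rightarrow> exp \<Rightarrow> fm" where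
  "Fdiamond x e q v = Conj (Flt (Tph (Tc q) (TS e q)) (Tph (Tc q) v))
    (Conj (Flt (Tph (Tc q) v) (Tph (Tc q) (TE e q)))
      (Fall x ''k'' (Conj
        (Fle (Tabsd (Tph (V x) v) (Tph (V x) (TS e q))) (Minus (Tph (Tc q) v) (Tph (Tc q) (TS e q))))
        (Fle (Tabsd (Tph (V x) (TE e q)) (Tph (V x) v)) (Minus (Tph (Tc q) (TE e q)) (Tph (Tc q) v))))))"

definition Fpiece :: "exp \<Rightarrow> exp \<Rightarrow> fm" where
  "Fpiece e q = Conj (Flt (TS e q) (Scalar ''n'')) (Conj (Flt (TE e q) (Scalar ''n'')) (Conj (Flt (TL e q) (Scalar ''k''))
    (Conj (Fle (Tph (Tc q) (TS e q)) (Tph (Tc q) (TE e q)))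
    (Conj (Feq (Tabsd (Tph (TL e q) (TE e q)) (Tph (TL e q) (TS e q))) (Minus (Tph (Tc q) (TE e q)) (Tph (Tc q) (TS e q))))
      (Fimp (Flt (Plus (Trw q) (Const 1)) (Scalar ''w'')) (Feq (TE e q) (TS e (Plus q (Const 1)))))))))"

definition Fpair :: "nat \<Rightarrow> exp \<Rightarrow> exp \<Rightarrow> exp \<Rightarrow> fm" where
  "Fpair x e q q' = Conj
    (Fimp (Conj (Feq (Town q) (Town q')) (Conj (Feq (Trw q) (Const 0)) (Feq (Plus (Trw q') (Const 1)) (Scalar ''w''))))
       (Fdisj (Conj (Feq (TS e q) (Ts q)) (Feq (TE e q') (Tt q))) (Conj (Feq (TS e q) (Tt q)) (Feq (TE e q') (Ts q)))))
    (Conj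
      (Fimp (Neg (Feq (Town q) (Town q'))) (Fall x ''n'' (Fimp
         (Conj (Fdisj (Feq (V x) (TS e q)) (Feq (V x) (TE e q))) (Fdisj (Feq (V x) (TS e q')) (Feq (V x) (TE e q'))))
         (Fdisj (Feq (V x) (Ts q)) (Feq (V x) (Tt q))))))
      (Fimp (Neg (Feq (TL e q) (TL e q')))
         (Fall x ''n'' (Neg (Conj (Fdiamond (Suc x) e q (V x)) (Fdiamond (Suc x) e q' (V x)))))))"

abbreviation TlS :: "exp \<Rightarrow> exp \<Rightarrow> exp" where "TlS e q \<equiv> Tph (TL e q) (TS e q)"
abbreviation TlE :: "exp \<Rightarrow> exp \<Rightarrow> exp" where "TlE e q \<equiv> Tph (TL e q) (TE e q)"

definition Finit :: "nat \<Rightarrow> exp \<Rightarrow> fm" where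
  "Finit x e = Fall x ''Q'' (Conj (Fpiece e (V x)) (Conj (Fall (Suc x) ''Q'' (Fpair (Suc (Suc x)) e (V x) (V (Suc x))))
     (Fif (Fle (TlS e (V x)) (TlE e (V x))) (Feq (TZ e (V x)) (TS e (V x))) (Feq (TZ e (V x)) (TE e (V x))))))"

definition Facc :: "nat \<Rightarrow> exp \<Rightarrow> fm" where
  "Facc x e = Fall x ''Q''
     (Fif (Fle (TlS e (V x)) (TlE e (V x))) (Feq (TZ e (V x)) (TE e (V x))) (Feq (TZ e (V x)) (TS e (V x))))"

definition Fbetween :: "exp \<Rightarrow> exp \<Rightarrow> exp \<Rightarrow> fm" where
  "Fbetween h x y = Fdisj (Conj (Flt x h) (Flt h y)) (Conj (Flt y h) (Flt h x))"

definition Factive :: "exp \<Rightarrow> exp \<Rightarrow> exp \<Rightarrow> fm" where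
  "Factive h x y = Fdisj (Conj (Fle x h) (Flt h y)) (Conj (Fle y h) (Flt h x))"

definition Fstep :: "nat \<Rightarrow> exp \<Rightarrow> exp \<Rightarrow> exp \<Rightarrow> fm" where
  "Fstep x h e f = Fall x ''Q'' (Conj (Feq (TS f (V x)) (TS e (V x))) (Conj (Feq (TE f (V x)) (TE e (V x)))
    (Conj (Feq (TL f (V x)) (TL e (V x))) (Conj (Flt (TZ f (V x)) (Scalar ''n''))
    (Conj (Fif (Factive h (TlS e (V x)) (TlE e (V x)))
        (Conj (Fad (TZ e (V x)) (TZ f (V x))) (Feq (Tph (TL e (V x)) (TZ f (V x))) (Plus h (Const 1))))
        (Feq (TZ f (V x)) (TZ e (V x))))
      (Fimp (Fbetween (Plus h (Const 1)) (TlS e (V x)) (TlE e (V x)))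
        (Fall (Suc x) ''Q'' (Conj (Neg (Feq (TZ f (V x)) (TS e (V (Suc x))))) (Conj (Neg (Feq (TZ f (V x)) (TE e (V (Suc x)))))
          (Fimp (Conj (Neg (Feq (V x) (V (Suc x)))) (Conj (Feq (TL e (V x)) (TL e (V (Suc x))))
              (Fbetween (Plus h (Const 1)) (TlS e (V (Suc x))) (TlE e (V (Suc x))))))
            (Neg (Feq (TZ f (V x)) (TZ f (V (Suc x)))))))))))))))"

lemmas form_defs = Fdiamond_def Fpiece_def Fpair_def Finit_def Facc_def Fstep_def Fbetween_def Factive_def

lemma fm_ok_forms:
  assumes "exp_ok x e"
  shows "fm_ok x (Finit x e)" "fm_ok x (Facc x e)"
    "exp_ok x h \<Longrightarrow> exp_ok x f \<Longrightarrow> fm_ok x (Fstep x h e f)"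
  using assms exp_ok_mono[of x _ "Suc x"] exp_ok_mono[of x _ "Suc (Suc x)"] exp_ok_mono[of x _ "Suc (Suc (Suc x))"]
    exp_ok_mono[of x _ "Suc (Suc (Suc (Suc x)))"]
  unfolding form_defs by (simp_all add: fm_ok_derived exp_ok_terms)

lemma bounds_forms:
  "bounds (Finit x e) \<subseteq> {''Q'', ''n'', ''k''}" "bounds (Facc x e) \<subseteq> {''Q'', ''n'', ''k''}"
  "bounds (Fstep x h e f) \<subseteq> {''Q'', ''n'', ''k''}"
  unfolding form_defs by (simp_all add: bounds_derived exp_ok_terms)

context dsp_instance
begin

text \<open>Arguments run up to \<open>base\<close>, beyond both \<open>n\<close> and
  \<open>k\<close>: the digits of an arbitrary configuration are not restricted further, and each
  formula must agree with its counterpart on these too.\<close>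

definition tables :: "memory \<Rightarrow> bool" where
  "tables M \<longleftrightarrow> M ''n'' 0 = n \<and> M ''k'' 0 = k \<and> M ''Q'' 0 = length sts * w \<and> M ''N'' 0 = codes \<and> M ''w'' 0 = w \<and>
     (\<forall>j<width. M ''offN'' j = j * codes) \<and> (\<forall>j<width. \<forall>e<codes. M ''dig'' (j * codes + e) = dig e j) \<and>
     (\<forall>d<base. M ''rown'' d = d * n) \<and> (\<forall>q<length sts * w. M ''ow'' q = q div w \<and> M ''rw'' q = q mod w) \<and>
     (\<forall>d<base. \<forall>v<base. M ''part'' (d * n + v) = lvl d v \<and> M ''adj'' (d * n + v) = inp ''adj'' (d * n + v)) \<and>
     (\<forall>i<length sts. M ''s'' i = inp ''s'' i \<and> M ''t'' i = inp ''t'' i \<and> M ''c'' i = c i)"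

lemma tables_setv: "tables (setv x u M) \<longleftrightarrow> tables M"
  unfolding tables_def by (simp add: setv_array)

lemma dig_base: "dig e j < base"
  unfolding dig_def base_def by simp

lemma fields_base: "S (dig e) q < base" "E (dig e) q < base" "L (dig e) q < base" "Z (dig e) q < base"
  unfolding S_def E_def L_def Z_def using dig_base by blast+

context
  fixes M :: memory
  assumes M: "tables M"
begin

lemma scalars_val: "M ''n'' 0 = n" "M ''k'' 0 = k" "M ''Q'' 0 = length sts * w" "M ''N'' 0 = codes" "M ''w'' 0 = w"
  using M unfolding tables_def by simp_all

lemma Tdig_val: "exp_val j M < width \<Longrightarrow> exp_val e M < codes \<Longrightarrow> exp_val (Tdig j e) M = dig (exp_val e M) (exp_val j M)"
  using M unfolding tables_def Tdig_def by simp

lemma fields_val: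
  assumes "exp_val q M < length sts * w" "exp_val e M < codes"
  shows "exp_val (TS e q) M = S (dig (exp_val e M)) (exp_val q M)" "exp_val (TE e q) M = E (dig (exp_val e M)) (exp_val q M)"
    "exp_val (TL e q) M = L (dig (exp_val e M)) (exp_val q M)" "exp_val (TZ e q) M = Z (dig (exp_val e M)) (exp_val q M)"
  using assms unfolding TS_def TE_def TL_def TZ_def S_def E_def L_def Z_def
  by (simp_all add: Tdig_val scalars_val width_def)

lemma Tph_val: "exp_val d M < base \<Longrightarrow> exp_val v M < base \<Longrightarrow> exp_val (Tph d v) M = lvl (exp_val d M) (exp_val v M)"
  using M unfolding tables_def Tph_def by simp

lemma Fad_val: "exp_val u M < base \<Longrightarrow> exp_val v M < base \<Longrightarrow> fval (Fad u v) M \<longleftrightarrow> adj (exp_val u M) (exp_val v M)"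
  using M unfolding tables_def Fad_def adj_def by simp

lemma own_val:
  assumes "exp_val q M < length sts * w"
  shows "exp_val (Town q) M = exp_val q M div w" "exp_val (Trw q) M = exp_val q M mod w"
    "exp_val (Tc q) M = c (exp_val q M div w)" "exp_val (Ts q) M = inp ''s'' (exp_val q M div w)"
    "exp_val (Tt q) M = inp ''t'' (exp_val q M div w)"
  using M assms less_mult_imp_div_less[OF assms] unfolding tables_def Town_def Trw_def Tc_def Ts_def Tt_def by simp_all

lemma c_base: "q < length sts * w \<Longrightarrow> c (q div w) < base"
  using c_lt[OF less_mult_imp_div_less[of q "length sts" w]] unfolding base_def by simp

end

lemma below_base: "x < n \<Longrightarrow> x < base" "x < k \<Longrightarrow> x < base"
  unfolding base_def by simp_all

lemmas val_simps = fval_derived exp_setv setv_v setv_array tables_setv scalars_val fields_val Tph_val Fad_val own_val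
  c_base fields_base exp_ok_terms below_base

lemma Fdiamond_val:
  assumes "tables M" "exp_ok x e" "exp_ok x q" "exp_ok x v"
    and "exp_val e M < codes" "exp_val q M < length sts * w" "exp_val v M < n"
  shows "fval (Fdiamond x e q v) M \<longleftrightarrow> diamond (dig (exp_val e M)) (exp_val q M) (exp_val v M)"
  using assms unfolding Fdiamond_def diamond_def by (simp add: val_simps cong: conj_cong imp_cong)

lemma Fpiece_val:
  assumes "tables M" "exp_val e M < codes" "exp_val q M < length sts * w"
  shows "fval (Fpiece e q) M \<longleftrightarrow> piece_ok (dig (exp_val e M)) (exp_val q M)"
  using assms next_piece[OF assms(3)] unfolding Fpiece_def piece_ok_def by (simp add: val_simps cong: conj_cong imp_cong)

lemma Fpair_val:
  assumes "tables M" "exp_ok x e" "exp_ok x q" "exp_ok x q'"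
    and "exp_val e M < codes" "exp_val q M < length sts * w" "exp_val q' M < length sts * w"
  shows "fval (Fpair x e q q') M \<longleftrightarrow> pair_ok (dig (exp_val e M)) (exp_val q M) (exp_val q' M)"
  using assms exp_ok_mono[of x _ "Suc x"] unfolding Fpair_def pair_ok_def
  by (simp add: val_simps Fdiamond_val cong: conj_cong imp_cong)

lemma Finit_val:
  assumes "tables M" "exp_ok x e" "exp_val e M < codes"
  shows "fval (Finit x e) M \<longleftrightarrow> init (dig (exp_val e M))"
  using assms exp_ok_mono[of x _ "Suc x"] exp_ok_mono[of x _ "Suc (Suc x)"] unfolding Finit_def init_def
  by (simp add: val_simps Fpiece_val Fpair_val cong: conj_cong imp_cong)

lemma Facc_val:
  assumes "tables M" "exp_ok x e" "exp_val e M < codes"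
  shows "fval (Facc x e) M \<longleftrightarrow> acc (dig (exp_val e M))"
  using assms unfolding Facc_def acc_def
  by (simp add: val_simps cong: conj_cong imp_cong)

lemma Fbetween_val: "fval (Fbetween h x y) M \<longleftrightarrow> between (exp_val h M) (exp_val x M) (exp_val y M)"
  and Factive_val: "fval (Factive h x y) M \<longleftrightarrow> active (exp_val h M) (exp_val x M) (exp_val y M)"
  unfolding Fbetween_def between_def Factive_def active_def by (simp_all add: fval_derived)

lemma Fstep_val:
  assumes "tables M" "exp_ok x h" "exp_ok x e" "exp_ok x f" "exp_val e M < codes" "exp_val f M < codes"
  shows "fval (Fstep x h e f) M \<longleftrightarrow> step (exp_val h M) (dig (exp_val e M)) (dig (exp_val f M))"
  using assms exp_ok_mono[of x _ "Suc x"] unfolding Fstep_def step_def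
  by (simp add: val_simps Fbetween_val Factive_val cong: conj_cong imp_cong)

end

section \<open>The program\<close>

text \<open>
  The tables \<open>dig\<close> and \<open>R\<close> consist of rows of length \<open>N\<close>, the number of configurations: entry
  \<open>j * N + e\<close> of \<open>dig\<close> is digit \<open>j\<close> of configuration \<open>e\<close>, and entry \<open>h * N + e\<close> of \<open>R\<close> tells whether \<open>e\<close> is
  reachable at time \<open>h\<close>. The following is the start of the row above that of entry \<open>v\<^sub>0\<close>.
\<close>

definition prev_row :: exp where
  "prev_row = Minus (Minus (V 0) (Read ''rN'' (V 0))) (Scalar ''N'')"

text \<open>Row 0 tests \<open>init\<close>, and every later row looks for a predecessor in the row
  before. \<open>qN\<close> gives the row number and \<open>rN\<close> the configuration of an
  entry.\<close>

definition Freach :: fm where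
  "Freach = Fif (Flt (V 0) (Scalar ''N'')) (Finit 1 (V 0))
     (Exi 1 ''N'' (Conj (Tst (Read ''R'' (Plus prev_row (V 1))))
        (Fstep 2 (Minus (Read ''qN'' (V 0)) (Const 1)) (V 1) (Read ''rN'' (V 0)))))"

definition Fanswer :: fm where
  "Fanswer = Exi 1 ''N'' (Conj (Tst (Read ''R'' (Plus (Read ''offN'' (Scalar ''n'')) (V 1)))) (Facc 2 (V 1)))"

text \<open>The scalars in order: \<open>be\<close> is the base, \<open>z\<close> the bound on the
  number of cuts per path, \<open>w\<close> the number of pieces per path, \<open>Q\<close> that of
  all pieces, \<open>D\<close> the number of digits, \<open>N\<close> that of configurations,
  \<open>W\<close> the number of rows and \<open>Y\<close> the size of the two large tables.
  Constants such as \<open>2 ^ k\<close> may be built in because \<open>k\<close> is fixed. The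
  answer is a table with a single entry.\<close>

definition commands :: "nat \<Rightarrow> com list" where
  "commands k = [
     Write ''k'' (Const 0) (Const k),
     Write ''one'' (Const 0) (Const 1),
     Write ''be'' (Const 0) (Plus (Scalar ''n'') (Const (k + 2))),
     Write ''E'' (Const 0) (Const (2 ^ k)),
     Write ''G'' (Const 0) (Const (5 * k * k)),
     mul ''g'' ''G'' ''l'',
     pow ''z'' ''g'' ''E'',
     Write ''w'' (Const 0) (Plus (Scalar ''z'') (Scalar ''z'')),
     mul ''Q'' ''l'' ''w'',
     Write ''D'' (Const 0) (Plus (Scalar ''Q'') (Plus (Scalar ''Q'') (Plus (Scalar ''Q'') (Scalar ''Q'')))),
     pow ''N'' ''be'' ''D'',
     Write ''W'' (Const 0) (Plus (Scalar ''D'') (Plus (Scalar ''n'') (Const 1))),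
     mul ''Y'' ''N'' ''W'',
     mod_table ''rB'' ''be'' ''N'',
     div_table ''qB'' ''be'' ''N'',
     mod_table ''rN'' ''N'' ''Y'',
     div_table ''qN'' ''N'' ''Y'',
     mult_table ''offN'' ''N'' ''W'',
     mult_table ''rown'' ''n'' ''be'',
     mod_table ''rw'' ''w'' ''Q'',
     div_table ''ow'' ''w'' ''Q'',
     fill ''dig'' ''Y'' (Flt (V 0) (Scalar ''N'')) (Read ''rB'' (V 0)) (Read ''dig'' (Plus prev_row (Read ''qB'' (Read ''rN'' (V 0))))),
     fill ''R'' ''Y'' Freach (Const 1) (Const 0),
     fill ''out'' ''one'' Fanswer (Const 1) (Const 0)]"

definition program :: "nat \<Rightarrow> com" where
  "program k = foldr Seq (commands k) Skip"

definition program_time :: "nat \<Rightarrow> nat" where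
  "program_time B = 3 * mul_time B + 2 * pow_time B + 8 * table_time B + 100 +
     fill_time (Flt (V 0) (Scalar ''N'')) (Read ''rB'' (V 0)) (Read ''dig'' (Plus prev_row (Read ''qB'' (Read ''rN'' (V 0))))) B +
     fill_time Freach (Const 1) (Const 0) B +
     fill_time Fanswer (Const 1) (Const 0) B"

lemma poly_bounded_program_time: "poly_bounded program_time"
  unfolding program_time_def
  by (intro poly_bounded_intros poly_bounded_times poly_bounded_fill_time)

lemma triple_Nil: "triple L (foldr Seq [] Skip) 1 L"
  unfolding triple_def using exec.Skip by auto

lemma triple_foldr:
  "triple L p T L' \<Longrightarrow> triple L' (foldr Seq ps Skip) T' L'' \<Longrightarrow> triple L (foldr Seq (p # ps) Skip) (T + T') L''"
  using triple_Seq by simp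

lemma triple_mono: "triple L p T L' \<Longrightarrow> T \<le> T' \<Longrightarrow> triple L p T' L'"
  unfolding triple_def using le_trans by blast

lemma holds_facts:
  "holds [] M \<longleftrightarrow> True" "holds ((a, m, g) # L) M \<longleftrightarrow> (\<forall>x<m. M a x = g x) \<and> holds L M"
  unfolding holds_def by simp_all

lemma names_simps: "names [] = {}" "names ((a, u) # L) = insert a (names L)"
  unfolding names_def by simp_all

context dsp_instance
begin

text \<open>A common number of rows for both large tables: \<open>dig\<close> needs
  \<open>width\<close> rows and \<open>R\<close> needs \<open>n + 1\<close>.\<close>

definition W :: nat where "W = width + (n + 1)"

lemma code_less:
  assumes "e < codes" "j < W"
  shows "j * codes + e < codes * W"
proof -
  have "j * codes + e < Suc j * codes" using assms(1) by simp
  also have "\<dots> \<le> W * codes" using assms(2) by (intro mult_le_mono1) simp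
  finally show ?thesis by (simp add: mult.commute)
qed

lemma codes_pos: "0 < codes" and base_pos: "0 < base"
  unfolding codes_def base_def by simp_all

lemma prev_row_index:
  assumes "codes \<le> y"
  shows "y - y mod codes - codes = (y div codes - 1) * codes" "0 < y div codes" "e < codes \<Longrightarrow> (y div codes - 1) * codes + e < y"
proof -
  have 1: "y - y mod codes = y div codes * codes" by (simp add: minus_mod_eq_div_mult)
  then show "y - y mod codes - codes = (y div codes - 1) * codes" by (simp add: diff_mult_distrib)
  show pos: "0 < y div codes" using assms codes_pos by (simp add: div_greater_zero_iff)
  assume "e < codes"
  then have "(y div codes - 1) * codes + e < Suc (y div codes - 1) * codes" by simp
  also have "Suc (y div codes - 1) = y div codes" using pos by simp
  also have "y div codes * codes \<le> y" by simp
  finally show "(y div codes - 1) * codes + e < y" .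
qed

lemma dig_rec: "dig e (Suc j) = dig (e div base) j" "dig e 0 = e mod base"
  unfolding dig_def by (simp_all add: div_mult2_eq)

text \<open>The length \<open>base * n + base\<close> covers every index \<open>d * n + v\<close>
  with both arguments below \<open>base\<close>, that is, every cell which the formulas may
  touch.\<close>

definition inputs :: facts where
  "inputs = [(''n'', 1, \<lambda>_. n), (''l'', 1, \<lambda>_. length sts), (''adj'', base * n + base, inp ''adj''),
     (''part'', base * n + base, inp ''part''), (''s'', length sts, inp ''s''), (''t'', length sts, inp ''t''),
     (''c'', length sts, c)]"

lemma holds_inputs: "holds inputs inp"
  unfolding inputs_def holds_facts by (simp add: inp_simps)

text \<open>From here on, each list describes the memory after one more command of the
  program.\<close>

definition facts1 :: facts where "facts1 = (''k'', 1, \<lambda>_. k) # inputs"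
definition facts2 :: facts where "facts2 = (''one'', 1, \<lambda>_. 1) # facts1"
definition facts3 :: facts where "facts3 = (''be'', 1, \<lambda>_. base) # facts2"
definition facts4 :: facts where "facts4 = (''E'', 1, \<lambda>_. 2 ^ k) # facts3"
definition facts5 :: facts where "facts5 = (''G'', 1, \<lambda>_. 5 * k * k) # facts4"
definition facts6 :: facts where "facts6 = (''g'', 1, \<lambda>_. 5 * k * k * length sts) # facts5"
definition facts7 :: facts where "facts7 = (''z'', 1, \<lambda>_. (5 * k * k * length sts) ^ 2 ^ k) # facts6"
definition facts8 :: facts where "facts8 = (''w'', 1, \<lambda>_. w) # facts7"
definition facts9 :: facts where "facts9 = (''Q'', 1, \<lambda>_. length sts * w) # facts8"
definition facts10 :: facts where "facts10 = (''D'', 1, \<lambda>_. width) # facts9"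
definition facts11 :: facts where "facts11 = (''N'', 1, \<lambda>_. codes) # facts10"
definition facts12 :: facts where "facts12 = (''W'', 1, \<lambda>_. W) # facts11"
definition facts13 :: facts where "facts13 = (''Y'', 1, \<lambda>_. codes * W) # facts12"
definition facts14 :: facts where "facts14 = (''rB'', codes, \<lambda>x. x mod base) # facts13"
definition facts15 :: facts where "facts15 = (''qB'', codes, \<lambda>x. x div base) # facts14"
definition facts16 :: facts where "facts16 = (''rN'', codes * W, \<lambda>x. x mod codes) # facts15"
definition facts17 :: facts where "facts17 = (''qN'', codes * W, \<lambda>x. x div codes) # facts16"
definition facts18 :: facts where "facts18 = (''offN'', W, \<lambda>x. x * codes) # facts17"
definition facts19 :: facts where "facts19 = (''rown'', base, \<lambda>x. x * n) # facts18"
definition facts20 :: facts where "facts20 = (''rw'', length sts * w, \<lambda>x. x mod w) # facts19"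
definition facts21 :: facts where "facts21 = (''ow'', length sts * w, \<lambda>x. x div w) # facts20"
definition facts22 :: facts where "facts22 = (''dig'', codes * W, \<lambda>y. dig (y mod codes) (y div codes)) # facts21"
definition facts23 :: facts where "facts23 = (''R'', codes * W, \<lambda>y. if tab (y div codes) (y mod codes) then 1 else 0) # facts22"
definition facts24 :: facts where "facts24 = (''out'', 1, \<lambda>y. if \<exists>e<codes. tab n e \<and> acc (dig e) then 1 else 0) # facts23"

lemmas facts_defs = inputs_def facts1_def facts2_def facts3_def facts4_def facts5_def facts6_def facts7_def facts8_def facts9_def facts10_def facts11_def facts12_def facts13_def facts14_def facts15_def facts16_def facts17_def facts18_def facts19_def facts20_def facts21_def facts22_def facts23_def facts24_def

context
  fixes B :: nat
  assumes w: "w = 2 * (5 * k * k * length sts) ^ (2 ^ k)"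
    and B: "5 * k * k < B" "5 * k * k * length sts < B" "2 ^ k \<le> B" "length sts < B" "base < B" "width \<le> B" "codes < B"
      "W \<le> B" "codes * W \<le> B" "length sts * w \<le> B" "n \<le> B" "k \<le> B" "1 \<le> B"
begin

lemma w_pos: "0 < length sts * w \<Longrightarrow> 0 < w"
  by simp

lemma tables_facts:
  assumes "holds facts22 M"
  shows "tables M"
proof -
  have idx: "d * n + v < base * n + base" if "d < base" "v < base" for d v
    using that by (intro add_le_less_mono mult_le_mono1) simp_all
  have wW: "width < W" unfolding W_def by simp
  have jW: "j < W" if "j < width" for j using that wW by simp
  have "M ''dig'' (j * codes + e) = dig e j" if "j < width" "e < codes" for j e
    using assms code_less[OF that(2) jW[OF that(1)]] that unfolding facts_defs holds_facts by simp
  then show ?thesis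
    using assms idx jW unfolding tables_def facts_defs holds_facts by (simp add: lvl_def)
qed


text \<open>By \<open>dig_rec\<close>, digit \<open>j + 1\<close> of a configuration is digit
  \<open>j\<close> of its quotient by the base. That entry lies in the previous row and is already
  filled.\<close>

lemma triple_filldig:
  "triple facts21 (fill ''dig'' ''Y'' (Flt (V 0) (Scalar ''N'')) (Read ''rB'' (V 0)) (Read ''dig'' (Plus prev_row (Read ''qB'' (Read ''rN'' (V 0)))))) (fill_time (Flt (V 0) (Scalar ''N'')) (Read ''rB'' (V 0)) (Read ''dig'' (Plus prev_row (Read ''qB'' (Read ''rN'' (V 0))))) B) ((''dig'', codes * W, \<lambda>y. dig (y mod codes) (y div codes)) # facts21)"
proof (rule triple_fill)
  fix x N assume x: "x < codes * W" and N: "holds facts21 N" "\<And>y. y < x \<Longrightarrow> N ''dig'' y = dig (y mod codes) (y div codes)"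
    "N ''v'' 0 = x"
  have v: "N ''N'' 0 = codes" "N ''rN'' x = x mod codes" "\<And>e. e < codes \<Longrightarrow> N ''rB'' e = e mod base"
    "\<And>e. e < codes \<Longrightarrow> N ''qB'' e = e div base"
    using N(1) x unfolding facts_defs holds_facts by simp_all
  show "(if fval (Flt (V 0) (Scalar ''N'')) N then exp_val (Read ''rB'' (V 0)) N
      else exp_val (Read ''dig'' (Plus prev_row (Read ''qB'' (Read ''rN'' (V 0))))) N) = dig (x mod codes) (x div codes)"
  proof (cases "x < codes")
    case True
    then show ?thesis using v N(3) by (simp add: fval_derived dig_rec)
  next
    case False
    let ?e = "x mod codes div base"
    have e: "?e < codes" using codes_pos by (meson div_le_dividend le_less_trans mod_less_divisor)
    note p = prev_row_index[of x]
    have "N ''dig'' ((x div codes - 1) * codes + ?e) = dig ?e (x div codes - 1)"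
      using N(2)[OF p(3)[OF _ e]] False e codes_pos by simp
    also have "\<dots> = dig (x mod codes) (x div codes)"
      using dig_rec(1)[of "x mod codes" "x div codes - 1"] p(2) False by simp
    finally show ?thesis
      using v N(3) p(1) False codes_pos by (simp add: fval_derived prev_row_def)
  qed
qed (use B in \<open>simp_all add: fm_ok_derived bounds_derived prev_row_def facts_defs names_simps temps_def\<close>)

lemma triple_fillR:
  "triple facts22 (fill ''R'' ''Y'' Freach (Const 1) (Const 0)) (fill_time Freach (Const 1) (Const 0) B) ((''R'', codes * W, \<lambda>y. if tab (y div codes) (y mod codes) then 1 else 0) # facts22)"
proof (rule triple_fill)
  fix x N assume x: "x < codes * W" and N: "holds facts22 N"
    "\<And>y. y < x \<Longrightarrow> N ''R'' y = (if tab (y div codes) (y mod codes) then 1 else 0)" "N ''v'' 0 = x"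
  note tb = tables_facts[OF N(1)]
  have v: "N ''N'' 0 = codes" "N ''rN'' x = x mod codes" "N ''qN'' x = x div codes"
    using N(1) x unfolding facts_defs holds_facts by simp_all
  have "fval Freach N \<longleftrightarrow> tab (x div codes) (x mod codes)"
  proof (cases "x < codes")
    case True
    then show ?thesis
      using Finit_val[OF tb, of 1 "V 0"] v N(3) unfolding Freach_def by (simp add: fval_derived)
  next
    case False
    note p = prev_row_index[of x]
    have 1: "N ''R'' ((x div codes - Suc 0) * codes + e) \<noteq> 0 \<longleftrightarrow> tab (x div codes - Suc 0) e" if "e < codes" for e
      using N(2)[OF p(3)[OF _ that]] False that codes_pos by simp
    have 2: "fval (Fstep 2 (Minus (Read ''qN'' (V 0)) (Const 1)) (V 1) (Read ''rN'' (V 0))) (setv 1 e N) \<longleftrightarrow>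
        step (x div codes - Suc 0) (dig e) (dig (x mod codes))" if "e < codes" for e
      using Fstep_val[of "setv 1 e N" 2 "Minus (Read ''qN'' (V 0)) (Const 1)" "V 1" "Read ''rN'' (V 0)"]
        tb v N(3) that codes_pos by (simp add: tables_setv setv_v setv_array)
    obtain h where h: "x div codes = Suc h" using p(2) False not0_implies_Suc by fastforce
    have "fval Freach N \<longleftrightarrow> (\<exists>e<codes. tab h e \<and> step h (dig e) (dig (x mod codes)))"
      using False v N(3) 1 2 p(1) h unfolding Freach_def
      by (simp add: fval_derived setv_v setv_array prev_row_def cong: conj_cong)
    then show ?thesis using h by simp
  qed
  then show "(if fval Freach N then exp_val (Const 1) N else exp_val (Const 0) N) = (if tab (x div codes) (x mod codes) then 1 else 0)"
    by simp
next
  show "fm_ok 1 Freach" unfolding Freach_def prev_row_def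
    by (simp add: fm_ok_derived fm_ok_forms numeral_2_eq_2)
next
  fix c assume "c \<in> bounds Freach"
  then have "c = ''N'' \<or> c = ''Q'' \<or> c = ''n'' \<or> c = ''k''"
    using bounds_forms unfolding Freach_def by (fastforce simp: bounds_derived)
  then show "\<exists>u. (c, 1, \<lambda>_. u) \<in> set facts22 \<and> u \<le> B"
  proof (elim disjE)
    show ?thesis if "c = ''N''" unfolding that by (rule exI[of _ codes]) (use B in \<open>simp add: facts_defs\<close>)
    show ?thesis if "c = ''Q''" unfolding that by (rule exI[of _ "length sts * w"]) (use B in \<open>simp add: facts_defs\<close>)
    show ?thesis if "c = ''n''" unfolding that by (rule exI[of _ n]) (use B in \<open>simp add: facts_defs\<close>)
    show ?thesis if "c = ''k''" unfolding that by (rule exI[of _ k]) (use B in \<open>simp add: facts_defs\<close>)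
  qed
qed (use B in \<open>simp_all add: facts_defs names_simps temps_def\<close>)

lemma triple_fillout:
  "triple facts23 (fill ''out'' ''one'' Fanswer (Const 1) (Const 0)) (fill_time Fanswer (Const 1) (Const 0) B) ((''out'', 1, \<lambda>y. if \<exists>e<codes. tab n e \<and> acc (dig e) then 1 else 0) # facts23)"
proof (rule triple_fill)
  fix x N assume x: "x < (1 :: nat)" and N: "holds facts23 N" "N ''v'' 0 = x"
  have "holds facts22 N" using N(1) unfolding facts23_def holds_facts by blast
  note tb = tables_facts[OF this]
  have nW: "n < W" unfolding W_def by simp
  have v: "N ''N'' 0 = codes" "N ''n'' 0 = n" "N ''offN'' n = n * codes"
    "\<And>e. e < codes \<Longrightarrow> N ''R'' (n * codes + e) = (if tab n e then 1 else 0)"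
    using N(1) code_less[OF _ nW] nW codes_pos unfolding facts_defs holds_facts by simp_all
  have "fval (Facc 2 (V 1)) (setv 1 e N) \<longleftrightarrow> acc (dig e)" if "e < codes" for e
    using Facc_val[of "setv 1 e N" 2 "V 1"] tb that by (simp add: tables_setv setv_v)
  then have "fval Fanswer N \<longleftrightarrow> (\<exists>e<codes. tab n e \<and> acc (dig e))"
    using v unfolding Fanswer_def by (simp add: setv_v setv_array cong: conj_cong) blast
  then show "(if fval Fanswer N then exp_val (Const 1) N else exp_val (Const 0) N) =
      (if \<exists>e<codes. tab n e \<and> acc (dig e) then 1 else 0)" by (simp only: exp_val.simps)
next
  show "fm_ok 1 Fanswer" unfolding Fanswer_def by (simp add: fm_ok_derived fm_ok_forms numeral_2_eq_2)
next
  fix c assume "c \<in> bounds Fanswer"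
  then have "c = ''N'' \<or> c = ''Q'' \<or> c = ''n'' \<or> c = ''k''"
    using bounds_forms unfolding Fanswer_def by fastforce
  then show "\<exists>u. (c, 1, \<lambda>_. u) \<in> set facts23 \<and> u \<le> B"
  proof (elim disjE)
    show ?thesis if "c = ''N''" unfolding that by (rule exI[of _ codes]) (use B in \<open>simp add: facts_defs\<close>)
    show ?thesis if "c = ''Q''" unfolding that by (rule exI[of _ "length sts * w"]) (use B in \<open>simp add: facts_defs\<close>)
    show ?thesis if "c = ''n''" unfolding that by (rule exI[of _ n]) (use B in \<open>simp add: facts_defs\<close>)
    show ?thesis if "c = ''k''" unfolding that by (rule exI[of _ k]) (use B in \<open>simp add: facts_defs\<close>)
  qed
qed (use B in \<open>simp_all add: facts_defs names_simps temps_def\<close>)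

lemma program_triple: "triple inputs (program k) (program_time B) facts24"
proof -
  have t1: "triple inputs (Write ''k'' (Const 0) (Const k)) (exp_time (Const k) + 2) facts1"
    unfolding facts1_def
    by (rule triple_scalar) (simp add: facts_defs names_simps, simp add: facts_defs holds_facts base_def width_def W_def)
  have t2: "triple facts1 (Write ''one'' (Const 0) (Const 1)) (exp_time (Const 1) + 2) facts2"
    unfolding facts2_def
    by (rule triple_scalar) (simp add: facts_defs names_simps, simp add: facts_defs holds_facts base_def width_def W_def)
  have t3: "triple facts2 (Write ''be'' (Const 0) (Plus (Scalar ''n'') (Const (k + 2)))) (exp_time (Plus (Scalar ''n'') (Const (k + 2))) + 2) facts3"
    unfolding facts3_def
    by (rule triple_scalar) (simp add: facts_defs names_simps, simp add: facts_defs holds_facts base_def width_def W_def)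
  have t4: "triple facts3 (Write ''E'' (Const 0) (Const (2 ^ k))) (exp_time (Const (2 ^ k)) + 2) facts4"
    unfolding facts4_def
    by (rule triple_scalar) (simp add: facts_defs names_simps, simp add: facts_defs holds_facts base_def width_def W_def)
  have t5: "triple facts4 (Write ''G'' (Const 0) (Const (5 * k * k))) (exp_time (Const (5 * k * k)) + 2) facts5"
    unfolding facts5_def
    by (rule triple_scalar) (simp add: facts_defs names_simps, simp add: facts_defs holds_facts base_def width_def W_def)
  have t6: "triple facts5 (mul ''g'' ''G'' ''l'') (mul_time B) facts6"
    unfolding facts6_def
    by (rule triple_mul) (use B in \<open>simp_all add: facts_defs names_simps temps_def\<close>)
  have t7: "triple facts6 (pow ''z'' ''g'' ''E'') (pow_time B) facts7"
    unfolding facts7_def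
    by (rule triple_pow) (use B in \<open>simp_all add: facts_defs names_simps temps_def\<close>)
  have t8: "triple facts7 (Write ''w'' (Const 0) (Plus (Scalar ''z'') (Scalar ''z''))) (exp_time (Plus (Scalar ''z'') (Scalar ''z'')) + 2) facts8"
    unfolding facts8_def
    by (rule triple_scalar) (simp add: facts_defs names_simps, use w in \<open>simp add: facts_defs holds_facts\<close>)
  have t9: "triple facts8 (mul ''Q'' ''l'' ''w'') (mul_time B) facts9"
    unfolding facts9_def
    by (rule triple_mul) (use B in \<open>simp_all add: facts_defs names_simps temps_def\<close>)
  have t10: "triple facts9 (Write ''D'' (Const 0) (Plus (Scalar ''Q'') (Plus (Scalar ''Q'') (Plus (Scalar ''Q'') (Scalar ''Q''))))) (exp_time (Plus (Scalar ''Q'') (Plus (Scalar ''Q'') (Plus (Scalar ''Q'') (Scalar ''Q'')))) + 2) facts10"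
    unfolding facts10_def
    by (rule triple_scalar) (simp add: facts_defs names_simps, simp add: facts_defs holds_facts base_def width_def W_def)
  have t11: "triple facts10 (pow ''N'' ''be'' ''D'') (pow_time B) facts11"
    unfolding facts11_def
    unfolding codes_def by (rule triple_pow) (use B in \<open>simp_all add: facts_defs names_simps temps_def\<close>)
  have t12: "triple facts11 (Write ''W'' (Const 0) (Plus (Scalar ''D'') (Plus (Scalar ''n'') (Const 1)))) (exp_time (Plus (Scalar ''D'') (Plus (Scalar ''n'') (Const 1))) + 2) facts12"
    unfolding facts12_def
    by (rule triple_scalar) (simp add: facts_defs names_simps, simp add: facts_defs holds_facts base_def width_def W_def)
  have t13: "triple facts12 (mul ''Y'' ''N'' ''W'') (mul_time B) facts13"
    unfolding facts13_def
    by (rule triple_mul) (use B in \<open>simp_all add: facts_defs names_simps temps_def\<close>)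
  have t14: "triple facts13 (mod_table ''rB'' ''be'' ''N'') (table_time B) facts14"
    unfolding facts14_def
    by (rule triple_mod_table) (use B codes_pos base_pos w_pos in \<open>simp_all add: facts_defs names_simps temps_def\<close>)
  have t15: "triple facts14 (div_table ''qB'' ''be'' ''N'') (table_time B) facts15"
    unfolding facts15_def
    by (rule triple_div_table) (use B codes_pos base_pos w_pos in \<open>simp_all add: facts_defs names_simps temps_def\<close>)
  have t16: "triple facts15 (mod_table ''rN'' ''N'' ''Y'') (table_time B) facts16"
    unfolding facts16_def
    by (rule triple_mod_table) (use B codes_pos base_pos w_pos in \<open>simp_all add: facts_defs names_simps temps_def\<close>)
  have t17: "triple facts16 (div_table ''qN'' ''N'' ''Y'') (table_time B) facts17"
    unfolding facts17_def
    by (rule triple_div_table) (use B codes_pos base_pos w_pos in \<open>simp_all add: facts_defs names_simps temps_def\<close>)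
  have t18: "triple facts17 (mult_table ''offN'' ''N'' ''W'') (table_time B) facts18"
    unfolding facts18_def
    by (rule triple_mult_table) (use B codes_pos base_pos w_pos in \<open>simp_all add: facts_defs names_simps temps_def\<close>)
  have t19: "triple facts18 (mult_table ''rown'' ''n'' ''be'') (table_time B) facts19"
    unfolding facts19_def
    by (rule triple_mult_table) (use B codes_pos base_pos w_pos in \<open>simp_all add: facts_defs names_simps temps_def\<close>)
  have t20: "triple facts19 (mod_table ''rw'' ''w'' ''Q'') (table_time B) facts20"
    unfolding facts20_def
    by (rule triple_mod_table) (use B codes_pos base_pos w_pos in \<open>simp_all add: facts_defs names_simps temps_def\<close>)
  have t21: "triple facts20 (div_table ''ow'' ''w'' ''Q'') (table_time B) facts21"
    unfolding facts21_def
    by (rule triple_div_table) (use B codes_pos base_pos w_pos in \<open>simp_all add: facts_defs names_simps temps_def\<close>)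
  have t22: "triple facts21 (fill ''dig'' ''Y'' (Flt (V 0) (Scalar ''N'')) (Read ''rB'' (V 0)) (Read ''dig'' (Plus prev_row (Read ''qB'' (Read ''rN'' (V 0)))))) (fill_time (Flt (V 0) (Scalar ''N'')) (Read ''rB'' (V 0)) (Read ''dig'' (Plus prev_row (Read ''qB'' (Read ''rN'' (V 0))))) B) facts22"
    unfolding facts22_def
    by (rule triple_filldig)
  have t23: "triple facts22 (fill ''R'' ''Y'' Freach (Const 1) (Const 0)) (fill_time Freach (Const 1) (Const 0) B) facts23"
    unfolding facts23_def
    by (rule triple_fillR)
  have t24: "triple facts23 (fill ''out'' ''one'' Fanswer (Const 1) (Const 0)) (fill_time Fanswer (Const 1) (Const 0) B) facts24"
    unfolding facts24_def
    by (rule triple_fillout)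
  show ?thesis
    unfolding program_def commands_def
    by (rule triple_mono[OF triple_foldr[OF t1 triple_foldr[OF t2 triple_foldr[OF t3 triple_foldr[OF t4 triple_foldr[OF t5 triple_foldr[OF t6 triple_foldr[OF t7 triple_foldr[OF t8 triple_foldr[OF t9 triple_foldr[OF t10 triple_foldr[OF t11 triple_foldr[OF t12 triple_foldr[OF t13 triple_foldr[OF t14 triple_foldr[OF t15 triple_foldr[OF t16 triple_foldr[OF t17 triple_foldr[OF t18 triple_foldr[OF t19 triple_foldr[OF t20 triple_foldr[OF t21 triple_foldr[OF t22 triple_foldr[OF t23 triple_foldr[OF t24 triple_Nil]]]]]]]]]]]]]]]]]]]]]]]]])
      (simp add: program_time_def)
qed

end

end

section \<open>The exponent of the running time\<close>

lemma less_power_self: "2 \<le> X \<Longrightarrow> a < X ^ a" for a X :: nat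
  by (meson less_exp less_le_trans power_mono zero_le)

lemma power_sum_le:
  fixes X :: nat
  assumes "2 \<le> X"
  shows "X ^ a + X ^ b \<le> X ^ (a + b + 1)"
proof -
  have "X ^ a \<le> X ^ (a + b)" "X ^ b \<le> X ^ (a + b)" using assms by (intro power_increasing; simp)+
  then have "X ^ a + X ^ b \<le> 2 * X ^ (a + b)" by linarith
  also have "\<dots> \<le> X * X ^ (a + b)" using assms by (rule mult_le_mono1)
  finally show ?thesis by simp
qed

definition pieces :: "nat \<Rightarrow> nat \<Rightarrow> nat" where
  "pieces k l = 2 * (5 * k * k * l) ^ (2 ^ k)"

text \<open>Chosen so that every quantity of the program is at most this power of
  \<open>X = max n 2\<close>. As \<open>base < X ^ (k + 4)\<close>, there are at most
  \<open>X ^ ((k + 4) * D)\<close> configurations with \<open>D = 4 * (l * pieces k l)\<close>.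
  Quantities unrelated to \<open>n\<close>, such as \<open>l\<close> and \<open>k\<close>, enter the
  exponent through \<open>a < X ^ a\<close>.\<close>

definition exponent :: "nat \<Rightarrow> nat \<Rightarrow> nat" where
  "exponent k l = (k + 10 + 2 ^ k + 5 * k * k) * (4 * (l * pieces k l) + l + pieces k l + 1)"

lemma program_correct:
  assumes k: "0 < k" and inst: "kdsp_instance k G Vs sts c" "pverts G = {..<n}"
  shows "\<exists>t M. exec (program k) (input_memory G Vs sts c) t M \<and>
    t \<le> program_time (max n 2 ^ exponent k (length sts)) \<and>
    M ''out'' 0 = (if kdsp_solvable G Vs sts c then 1 else 0)"
proof -
  define l where "l = length sts"
  define w where "w = pieces k l"
  define X where "X = max n 2"
  define e where "e = exponent k l"
  interpret dsp_instance k n G Vs sts c w by unfold_locales (use inst in simp_all)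
  have X: "2 \<le> X" "n \<le> X" unfolding X_def by simp_all
  have mono: "X ^ i \<le> X ^ j" if "i \<le> j" for i j using X that by (intro power_increasing) simp_all
  define C where "C = k + 10 + 2 ^ k + 5 * k * k"
  define D where "D = 4 * (l * w)"
  have e: "e = C * D + C * l + C * w + C"
    unfolding e_def exponent_def C_def D_def w_def by (simp only: distrib_left mult.right_neutral)
  have C: "k + 10 \<le> C" "5 * k * k + 10 \<le> C" "2 ^ k + 10 \<le> C" unfolding C_def by simp_all
  have "(k + 10) * D \<le> C * D" "l \<le> C * l" "w \<le> C * w" using C by simp_all
  then have le: "k * D + 10 * D + l + w + C \<le> e" unfolding e add_mult_distrib by linarith
  have D: "width = D" unfolding width_def D_def l_def by simp
  have lt: "a < X ^ e" if "a < X ^ b" "b \<le> e" for a b using that mono[OF that(2)] by simp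
  have b: "base < X ^ (k + 4)"
  proof -
    have "k + 2 < X ^ (k + 2)" by (rule less_power_self[OF X(1)])
    then have "base < X ^ 1 + X ^ (k + 2)" unfolding base_def using X by simp
    also have "\<dots> \<le> X ^ (1 + (k + 2) + 1)" by (rule power_sum_le[OF X(1)])
    also have "1 + (k + 2) + 1 = k + 4" by simp
    finally show ?thesis .
  qed
  have cd: "codes \<le> X ^ ((k + 4) * D)"
    unfolding codes_def D power_mult using b by (intro power_mono) simp_all
  have Wb: "W \<le> X ^ (D + 3)"
  proof -
    have "n + 1 \<le> 2 * X" using X by simp
    also have "\<dots> \<le> X * X" using X(1) by (rule mult_le_mono1)
    finally have "n + 1 \<le> X ^ 2" by (simp add: power2_eq_square)
    moreover have "D < X ^ D" by (rule less_power_self[OF X(1)])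
    ultimately have "W \<le> X ^ D + X ^ 2" unfolding W_def D by simp
    also have "\<dots> \<le> X ^ (D + 2 + 1)" by (rule power_sum_le[OF X(1)])
    also have "D + 2 + 1 = D + 3" by simp
    finally show ?thesis .
  qed
  have wX: "w = 2 * (5 * k * k * length sts) ^ (2 ^ k)" unfolding w_def pieces_def l_def ..
  have lw: "length sts * w \<le> D" unfolding D_def l_def by simp
  have tr: "triple inputs (program k) (program_time (X ^ e)) facts24"
  proof (rule program_triple[OF wX])
    show "5 * k * k < X ^ e" using lt[OF less_power_self[OF X(1)]] le C by simp
    show "5 * k * k * length sts < X ^ e"
    proof (rule lt)
      show "5 * k * k * length sts < X ^ (5 * k * k + l)"
        unfolding power_add l_def by (intro mult_strict_mono' less_power_self X) simp_all
    qed (use le C in simp)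
    have "X ^ k \<le> X ^ e" using mono le C by simp
    moreover have "2 ^ k \<le> X ^ k" using X(1) by (rule power_mono) simp
    ultimately show "2 ^ k \<le> X ^ e" by simp
    show "length sts < X ^ e" using lt[OF less_power_self[OF X(1), of l]] le unfolding l_def by simp
    show "base < X ^ e" using lt[OF b] le C by simp
    have D_less: "D < X ^ e" using lt[OF less_power_self[OF X(1), of D]] le by simp
    then show "width \<le> X ^ e" unfolding D by simp
    show "length sts * w \<le> X ^ e" using lw D_less by simp
    have "(k + 4) * D < e" using le C by (simp add: add_mult_distrib)
    then have "X ^ ((k + 4) * D) < X ^ e" using X by (intro power_strict_increasing) simp_all
    then show "codes < X ^ e" using cd by simp
    have "W \<le> X ^ e" using Wb mono[of "D + 3" e] le C by simp
    then show "W \<le> X ^ e" .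
    have "codes * W \<le> X ^ ((k + 4) * D) * X ^ (D + 3)" using cd Wb by (rule mult_le_mono)
    also have "\<dots> = X ^ ((k + 4) * D + (D + 3))" by (simp only: power_add)
    also have "\<dots> \<le> X ^ e" using mono le C by (simp add: add_mult_distrib)
    finally show "codes * W \<le> X ^ e" .
    have "X ^ 1 \<le> X ^ e" by (rule mono) (use le C in linarith)
    then show "n \<le> X ^ e" "1 \<le> X ^ e" using X by simp_all
    show "k \<le> X ^ e" using lt[OF less_power_self[OF X(1), of k]] le C by simp
  qed
  then obtain t M where t: "exec (program k) inp t M" "t \<le> program_time (X ^ e)" "holds facts24 M"
    using holds_inputs unfolding triple_def by blast
  have "M ''out'' 0 = (if \<exists>e<codes. tab n e \<and> acc (dig e) then 1 else 0)"
    using t(3) unfolding facts24_def holds_facts by blast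
  then have "M ''out'' 0 = (if kdsp_solvable G Vs sts c then 1 else 0)"
    unfolding solvable_iff_tab[OF k wX] .
  then show ?thesis using t(1,2) unfolding inp_def X_def e_def l_def by blast
qed

text \<open>The dominant term is \<open>l * pieces k l\<close>, a multiple of the power of
  \<open>l\<close> with exponent \<open>2 ^ k + 1\<close>, which does not exceed
  \<open>5 ^ k\<close> for positive \<open>k\<close>.\<close>

lemma exponent_bound:
  assumes k: "0 < k" and l: "0 < l"
  shows "exponent k l \<le> (k + 10 + 2 ^ k + 5 * k * k) * (10 * (5 * k * k) ^ (2 ^ k) + 2) * l ^ (5 ^ k)"
proof -
  define P where "P = l ^ (5 ^ k)"
  define \<alpha> where "\<alpha> = (5 * k * k) ^ (2 ^ k)"
  have "Suc (2 ^ j) \<le> 5 ^ j" if "0 < j" for j :: nat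
    using that by (induction j rule: nat_induct_non_zero) simp_all
  then have kk: "Suc (2 ^ k) \<le> 5 ^ k" using k .
  have P: "l ^ i \<le> P" if "i \<le> 5 ^ k" for i
    unfolding P_def using that l by (intro power_increasing) simp_all
  have w: "pieces k l = 2 * (\<alpha> * l ^ (2 ^ k))" unfolding pieces_def \<alpha>_def by (simp only: power_mult_distrib)
  have p1: "l ^ (2 ^ k) \<le> P" "l * l ^ (2 ^ k) \<le> P" "l \<le> P" "1 \<le> P"
    using P[of "2 ^ k"] P[of "Suc (2 ^ k)"] P[of 1] P[of 0] kk by simp_all
  have "pieces k l \<le> 2 * (\<alpha> * P)" unfolding w using p1(1) by (intro mult_le_mono2)
  moreover have "l * pieces k l = 2 * (\<alpha> * (l * l ^ (2 ^ k)))" unfolding w by (simp only: ac_simps)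
  then have "l * pieces k l \<le> 2 * (\<alpha> * P)" using mult_le_mono2[OF mult_le_mono2[OF p1(2)], of 2 \<alpha>] by metis
  ultimately have "4 * (l * pieces k l) + l + pieces k l + 1 \<le> 10 * (\<alpha> * P) + 2 * P" using p1(3,4) by linarith
  also have "\<dots> = (10 * \<alpha> + 2) * P" by (simp add: algebra_simps)
  finally have "exponent k l \<le> (k + 10 + 2 ^ k + 5 * k * k) * ((10 * \<alpha> + 2) * P)"
    unfolding exponent_def by (rule mult_le_mono2)
  then show ?thesis unfolding P_def \<alpha>_def by (simp only: mult.assoc)
qed

text \<open>The base is \<open>max n 2\<close> because no power of \<open>n\<close> exceeds 1 when
  \<open>n \<le> 1\<close>, whereas every run takes time.\<close>

theorem theorem4:
  fixes k :: nat
  shows "\<exists>p f. f \<in> O(\<lambda>l. real (l ^ (5 ^ k))) \<and>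
    kdsp_decides_within k p (\<lambda>n l. real (max n 2) powr f l)"
proof (cases "k = 0")
  case True
  \<comment> \<open>Without colours no pair can be assigned one, so there are no pairs and the
    answer is yes. The single command takes 3 steps, at most \<open>2 ^ 2\<close>.\<close>
  have "kdsp_decides_within k (Write ''out'' (Const 0) (Const 1)) (\<lambda>n l. real (max n 2) powr 2)"
    unfolding kdsp_decides_within_def
  proof (intro allI impI, elim conjE)
    fix n :: nat and G :: "nat pair_pre_digraph" and Vs sts c assume "kdsp_instance k G Vs sts c"
    then have "sts = []" using True unfolding kdsp_instance_def by (cases sts) auto
    then have "kdsp_solvable G Vs sts c" unfolding kdsp_solvable_def by simp
    moreover have "(3 :: real) \<le> real (max n 2) powr 2"
    proof -
      have "(2 :: real) ^ 2 \<le> real (max n 2) ^ 2" by (rule power_mono) simp_all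
      then show ?thesis by (simp add: powr_numeral)
    qed
    ultimately show "\<exists>t M. exec (Write ''out'' (Const 0) (Const 1)) (input_memory G Vs sts c) t M \<and>
        real t \<le> real (max n 2) powr 2 \<and> M ''out'' 0 = (if kdsp_solvable G Vs sts c then 1 else 0)"
      using exec.Write[of "''out''" "Const 0" "Const 1" "input_memory G Vs sts c"] by (fastforce simp: eval_nat_numeral)
  qed
  moreover have "(\<lambda>_. 2) \<in> O(\<lambda>l. real (l ^ (5 ^ k)))"
    by (rule bigoI[of _ 2], rule eventually_at_top_linorderI[of 1]) (simp add: True)
  ultimately show ?thesis by blast
next
  case False
  then have k: "0 < k" by simp
  obtain K d where T: "\<And>B. program_time B \<le> K * (B + 2) ^ d"
    using poly_bounded_program_time unfolding poly_bounded_def by blast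
  \<comment> \<open>With \<open>X = max n 2\<close>, the factor \<open>K\<close> is absorbed by
    \<open>X ^ K\<close> and the shift by 2 by two further powers of \<open>X\<close>.\<close>
  define f where "f l = K + (exponent k l + 2) * d" for l
  have "kdsp_decides_within k (program k) (\<lambda>n l. real (max n 2) powr real (f l))"
    unfolding kdsp_decides_within_def
  proof (intro allI impI, elim conjE)
    fix n and G :: "nat pair_pre_digraph" and Vs sts c
    assume "kdsp_instance k G Vs sts c" "pverts G = {..<n}"
    from program_correct[OF k this] obtain t M where
      t: "exec (program k) (input_memory G Vs sts c) t M" "t \<le> program_time (max n 2 ^ exponent k (length sts))"
      "M ''out'' 0 = (if kdsp_solvable G Vs sts c then 1 else 0)" by blast
    define X where "X = max n 2"
    define e where "e = exponent k (length sts)"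
    have X: "2 \<le> X" unfolding X_def by simp
    have "X ^ e + 2 \<le> X ^ e + X ^ 1" using X by simp
    also have "\<dots> \<le> X ^ (e + 1 + 1)" by (rule power_sum_le[OF X])
    finally have "(X ^ e + 2) ^ d \<le> (X ^ (e + 2)) ^ d" by (intro power_mono) simp_all
    then have "K * (X ^ e + 2) ^ d \<le> X ^ K * X ^ ((e + 2) * d)"
      unfolding power_mult using less_power_self[OF X, of K] by (intro mult_le_mono) simp_all
    also have "\<dots> = X ^ f (length sts)" unfolding f_def e_def by (simp only: power_add)
    finally have "t \<le> X ^ f (length sts)" using t(2) T[of "X ^ e"] unfolding X_def e_def by linarith
    then have "real t \<le> real X ^ f (length sts)" by (metis of_nat_le_iff of_nat_power)
    also have "\<dots> = real X powr real (f (length sts))" using X by (simp add: powr_realpow)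
    finally show "\<exists>t M. exec (program k) (input_memory G Vs sts c) t M \<and>
        real t \<le> real (max n 2) powr real (f (length sts)) \<and> M ''out'' 0 = (if kdsp_solvable G Vs sts c then 1 else 0)"
      using t(1,3) unfolding X_def by blast
  qed
  moreover have "(\<lambda>l. real (f l)) \<in> O(\<lambda>l. real (l ^ (5 ^ k)))"
  proof -
    define c where "c = (k + 10 + 2 ^ k + 5 * k * k) * (10 * (5 * k * k) ^ (2 ^ k) + 2)"
    have "f l \<le> (K + (c + 2) * d) * l ^ (5 ^ k)" if "1 \<le> l" for l
    proof -
      define P where "P = l ^ (5 ^ k)"
      have P: "1 \<le> P" unfolding P_def using that by simp
      have "exponent k l \<le> c * P" using exponent_bound[OF k] that unfolding c_def P_def by simp
      then have "exponent k l + 2 \<le> (c + 2) * P" using P unfolding add_mult_distrib by linarith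
      then have "(exponent k l + 2) * d \<le> (c + 2) * P * d" by (rule mult_le_mono1)
      moreover have "K \<le> K * P" using P by simp
      moreover have "(K + (c + 2) * d) * P = K * P + (c + 2) * P * d" by (simp add: algebra_simps)
      ultimately show ?thesis unfolding f_def P_def[symmetric] by linarith
    qed
    then have "norm (real (f l)) \<le> real (K + (c + 2) * d) * norm (real (l ^ (5 ^ k)))" if "1 \<le> l" for l
      using that by (metis abs_of_nat of_nat_le_iff of_nat_mult real_norm_def)
    then show ?thesis
      by (intro bigoI[of _ "real (K + (c + 2) * d)"] eventually_at_top_linorderI[of 1])
  qed
  ultimately show ?thesis by blast
qed

end
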